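(* For every integer $n\geq 1$ the following hold, where in each item $D$ is the formal derivative associated with the grammar $G$ given in that item. $(c_1)$ If $G=\{x\rightarrow xy^2,\ y\rightarrow x^2y\}$, then $$D^n(xy)=xy\sum_{k=0}^n B(n,k)\,x^{2n-2k}y^{2k}.$$ $(c_2)$ If $G=\{x\rightarrow xy^2,\ y\rightarrow x^2y\}$, then $$D^n(x^2y^2)=2^n x^2y^2\sum_{k=0}^n \left\langle {n+1 \atop k}\right\rangle x^{2n-2k}y^{2k}.$$ $(c_3)$ If $G=\{x\rightarrow xy^2,\ y\rightarrow x^2y\}$, then $$D^n(x)=x\sum_{k=1}^n N(n,k)\,x^{2n-2k}y^{2k},$$ where $N(n,k)$ is the number of perfect matchings of $[2n]$ in which exactly $k$ matching pairs have odd smaller entries. $(c_4)$ Let $r$ be a nonnegative integer. If $G=\{x\rightarrow xy,\ y\rightarrow xy\}$, then $$D^n(xy^r)=x\sum_{k=0}^{n}\left\langle {n+r \atop k}\right\rangle_{r} x^k y^{n+r-k}.$$ $(c_5)$ If $G=\{x\rightarrow xy^2,\ y\rightarrow xy\}$, then $$D^n(x)=x\sum_{k=0}^{n-1}2^k\left\langle {n \atop k}\right\rangle x^k y^{2n-2k}.$$ $(c_6)$ Let the numbers $T(n,k)$ be defined by the generating function $$\sqrt{A(2t,z)}=1+\sum_{n\geq 1}\sum_{k=1}^n T(n,k)\,t^k\frac{z^n}{n!},\qquad\text{where } A(t,z)=\frac{1-t}{1-te^{z(1-t)}}.$$ If $G=\{x\rightarrow xy^2,\ y\rightarrow xy\}$,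 then $$D^n(y)=\sum_{k=1}^{n}T(n,k)\,x^k y^{2n-2k+1}.$$ $(c_7)$ If $G=\{x\rightarrow x^2y,\ y\rightarrow y\}$, then $$D^n(x)=x\sum_{k=1}^n k!\left\{ {n \atop k}\right\} x^k y^k.$$ $(c_8)$ If $G=\{x\rightarrow x^2y,\ y\rightarrow y^2\}$, then $$D^n(x)=x\sum_{k=1}^n k!\left[ {n \atop k}\right] x^{k} y^n.$$ $(c_9)$ If $G=\{x\rightarrow xy^2,\ y\rightarrow y^2\}$, then $$D^n(x)=x\sum_{k=1}^n \left\lfloor {n \atop k}\right\rfloor y^{n+k}.$$ $(c_{10})$ If $G=\{x\rightarrow xy^3,\ y\rightarrow y^3\}$, then $$D^n(x)=x\sum_{k=1}^{n} b(n,k)\,y^{2n+k},$$ where $b(n,k)$ is the number of forests with $k$ rooted ordered trees with $n$ non-root vertices labeled in an organic way. $(c_{11})$ Let $r\geq 4$ be a fixed integer. If $G=\{x\rightarrow xy^r,\ y\rightarrow y^r\}$, then $$D^n(x)=x\sum_{k=1}^{n} a(n,k;r)\,y^{(r-1)n+k},$$ where $a(n,k;r)$ is the number of unordered $n$-vertex $k$-forests composed of $k$ plane increasing $r$-ary trees. $(c_{12})$ If $G=\{x\rightarrow x^2y,\ y\rightarrow xy\}$, then $$D^n(y)=x^n\sum_{k=1}^n d(n,k)\,y^k,$$ where $d(n,k)$ is the number of increasing mobiles (circular rooted trees) with $n+1$ nodes and $k$ leaves.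
   Context: Formal derivative. Letters $x,y$ are independent commuting indeterminates. A context-free grammar $G$ over $\{x,y\}$ is a set of substitution rules replacing each letter by a formal function of the letters. The formal derivative $D$ with respect to $G$ is the linear operator sending each letter to the right-hand side of its rule and satisfying $D(u+v)=D(u)+D(v)$, $D(uv)=D(u)v+uD(v)$ and $D(f(u))=\frac{\partial f(u)}{\partial u}D(u)$ for analytic $f$ (in particular $D$ kills constants; on polynomials in $x,y$ it is the derivation determined by the rules). Powers are iterates: $D^{n+1}(u)=D(D^n(u))$. Notation: $[n]=\{1,\ldots,n\}$, $\pm[n]=\{\pm1,\ldots,\pm n\}$. Eulerian numbers of type $B$: $B(n,k)$ is the number of signed permutations $\pi$ of $\pm[n]$ (bijections of $\pm[n]$ with $\pi(-i)=-\pi(i)$ for all $i$) with $\mathrm{des}_B(\pi)=k$, where $\mathrm{des}_B(\pi)=|\{i\in[n]:\pi(i-1)>\pi(i)\}|$ with $\pi(0)=0$. They satisfy $B(n+1,k)=(2n-2k+3)B(n,k-1)+(2k+1)B(n,k)$, with $B(0,0)=1$ and $B(0,k)=0$ for $k\geq1$. Eulerian numbers: $\left\langle {n \atop k}\right\rangle$ is the number of permutations $\pi$ of $[n]$ with exactly $k$ descents ($i<n$ with $\pi(i)>\pi(i+1)$), equivalently with exactly $k$ excedances ($i<n$ with $\pi(i)>i$). They satisfy $\left\langle {n \atop k}\right\rangle=(k+1)\left\langle {n-1 \atop k}\right\rangle+(n-k)\left\langle {n-1 \atop k-1}\right\rangle$, with $\left\langle {0 \atop 0}\right\rangle=1$ and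 $\left\langle {0 \atop k}\right\rangle=0$ for $k\geq 1$. With $A_n(t)=\sum_{k=0}^{n-1}\left\langle {n \atop k}\right\rangle t^k$, one has $A(t,z)=1+\sum_{n\geq 1}tA_n(t)\frac{z^n}{n!}=\frac{1-t}{1-te^{z(1-t)}}$. In $(c_6)$, $A(2t,z)$ is obtained by replacing $t$ by $2t$, and the square root is the formal power series in $z$ with constant term $1$. $r$-restricted Eulerian numbers: for a nonnegative integer $r$ and $m\ge r$, let $\mathcal{P}(m,m-r)$ be the set of permutations of $m$ numbers taken $m-r$ at a time, i.e. injective maps $\sigma:[m-r]\to[m]$. Such $\sigma$ has an excedance at position $i$ ($1\le i\le m-r$) if $\sigma(i)>i$. Then $\left\langle {m \atop k}\right\rangle_{r}$ is the number of $\sigma\in\mathcal{P}(m,m-r)$ with exactly $k$ excedances. $\left[ {n \atop k}\right]$ (unsigned Stirling number of the first kind) is the number of permutations of $[n]$ with exactly $k$ cycles; $\left\{ {n \atop k}\right\}$ (Stirling number of the second kind) is the number of partitions of $[n]$ into $k$ nonempty blocks; $\left\lfloor {n \atop k}\right\rfloor$ (unsigned Lah number) is the number of ways to partition $[n]$ into $k$ nonempty linearly ordered subsets. Trees and forests: - In $(c_{10})$: the forests are unordered collections of $k$ rooted ordered (plane) trees, each having at least one non-root vertex, with $n$ non-root vertices in total labeled bijectively by $[n]$; all roots carry the label $0$. The labeling is organic if labels increase along every path from a root to a leaf. - In $(c_{11})$: a plane increasing $r$-ary tree is a nonempty rooted tree in which each vertex has $r$ distinguishable (ordered) child positions, each either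 empty or occupied by a child, with distinct vertex labels increasing along every path away from the root. An $n$-vertex $k$-forest is an unordered collection of $k$ such trees whose vertices are in total labeled bijectively by $[n]$. - In $(c_{12})$: an increasing mobile with $m$ nodes is a rooted tree whose nodes are labeled bijectively by $[m]$, with labels increasing along every path away from the root, and in which the children of each node are arranged in a cyclic order (two arrangements differing by a rotation are identified). A leaf is a node without children. *)

theory Defs
  imports
    "HOL-Computational_Algebra.Polynomial_Factorial"
    "HOL-Computational_Algebra.Formal_Power_Series"
    "HOL-Library.Disjoint_Sets"
    "HOL-Combinatorics.Orbits"
begin

section \<open>The formal derivative of a grammar on two letters\<close>

text \<open>
  The polynomial ring \<open>\<real>[x, y]\<close> is rendered as \<open>\<real>[x][y]\<close>: the letter \<open>y\<close> is the outer
  indeterminate, the letter \<open>x\<close> the inner one.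
\<close>

definition x_letter :: "real poly poly" (\<open>\<x>\<close>) where
  "\<x> = [:[:0, 1:]:]"

definition y_letter :: "real poly poly" (\<open>\<y>\<close>) where
  "\<y> = [:0, 1:]"

abbreviation scalar :: "real \<Rightarrow> real poly poly" where
  "scalar c \<equiv> [:[:c:]:]"

text \<open>
  The formal derivative with respect to the grammar \<open>x \<rightarrow> f, y \<rightarrow> g\<close>, acting on polynomials. There the
  chain rule \<open>D (h(u)) = h'(u) D u\<close> for polynomial \<open>h\<close> is a consequence of the laws below.
\<close>

definition formal_derivative ::
  "real poly poly \<Rightarrow> real poly poly \<Rightarrow> (real poly poly \<Rightarrow> real poly poly) \<Rightarrow> bool" where
  "formal_derivative f g D \<longleftrightarrow>
     D \<x> = f \<and> D \<y> = g \<and>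
     (\<forall>u v. D (u + v) = D u + D v) \<and>
     (\<forall>c u. D (scalar c * u) = scalar c * D u) \<and>
     (\<forall>u v. D (u * v) = D u * v + u * D v)"

lemma map_poly_pderiv_add:
  fixes u v :: "real poly poly"
  shows "map_poly pderiv (u + v) = map_poly pderiv u + map_poly pderiv v"
  by (rule poly_eqI) (simp add: coeff_map_poly pderiv_add)

lemma pderiv_sum_poly: "pderiv (\<Sum>i\<in>I. p i) = (\<Sum>i\<in>I. pderiv (p i :: real poly))"
  by (induction I rule: infinite_finite_induct) (simp_all add: pderiv_add)

lemma map_poly_pderiv_mult:
  fixes u v :: "real poly poly"
  shows "map_poly pderiv (u * v) = map_poly pderiv u * v + u * map_poly pderiv v"
proof (rule poly_eqI)
  fix n
  have "pderiv (coeff (u * v) n) =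
        (\<Sum>i\<le>n. pderiv (coeff u i) * coeff v (n - i) + coeff u i * pderiv (coeff v (n - i)))"
    by (simp add: coeff_mult pderiv_sum_poly pderiv_mult add.commute mult.commute)
  then show "coeff (map_poly pderiv (u * v)) n =
             coeff (map_poly pderiv u * v + u * map_poly pderiv v) n"
    by (simp add: coeff_map_poly coeff_mult sum.distrib)
qed

lemma formal_derivative_exists:
  "formal_derivative f g (\<lambda>p. map_poly pderiv p * f + pderiv p * g)"
proof -
  have "map_poly pderiv (scalar c * u) = scalar c * map_poly pderiv u" for c u
    by (rule poly_eqI) (simp add: coeff_map_poly pderiv_smult)
  moreover have "smult [:1:] p = p" for p :: "real poly poly"
    by (metis one_pCons smult_1_left)
  ultimately show ?thesis
    unfolding formal_derivative_def x_letter_def y_letter_def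
    by (auto simp: map_poly_pderiv_add map_poly_pderiv_mult pderiv_add pderiv_mult pderiv_smult
          map_poly_pCons pderiv_pCons algebra_simps)
qed

lemma formal_derivative_unique:
  assumes D: "formal_derivative f g D" and E: "formal_derivative f g E"
  shows "D = E"
proof
  have letters: "D \<x> = E \<x>" "D \<y> = E \<y>"
    and add: "D (u + v) = D u + D v" "E (u + v) = E u + E v"
    and mult: "D (u * v) = D u * v + u * D v" "E (u * v) = E u * v + u * E v"
    for u v
    using D E unfolding formal_derivative_def by presburger+
  have lin: "D (scalar c * u) = scalar c * D u" "E (scalar c * u) = scalar c * E u" for c u
    using D E unfolding formal_derivative_def by blast+
  have zero: "D 0 = E 0"
    using add(1)[of 0 0] add(2)[of 0 0] by simp
  have one: "D 1 = E 1"
    using mult(1)[of 1 1] mult(2)[of 1 1] by simp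
  have sc: "D (scalar c) = E (scalar c)" for c
    using lin(1)[of c 1] lin(2)[of c 1] one by (simp only: mult.right_neutral)
  have inner: "D [:q:] = E [:q:]" for q :: "real poly"
  proof (induction q)
    case 0
    then show ?case by (simp add: zero)
  next
    case (pCons a q)
    have "[:pCons a q:] = scalar a + \<x> * [:q:]"
      by (simp add: x_letter_def)
    then show ?case
      by (simp only: add mult letters sc pCons.IH)
  qed
  show "D p = E p" for p
  proof (induction p)
    case 0
    then show ?case by (simp add: zero)
  next
    case (pCons a p)
    have "pCons a p = [:a:] + \<y> * p"
      by (simp add: y_letter_def)
    then show ?case
      by (simp only: add mult letters inner pCons.IH)
  qed
qed


section \<open>Eulerian numbers\<close>

text \<open>
  A signed permutation of \<open>\<plusminus>[n]\<close> is extended to all integers by the identity; in particular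
  \<open>\<pi> 0 = 0\<close>.
\<close>

definition signed_perms :: "nat \<Rightarrow> (int \<Rightarrow> int) set" where
  "signed_perms n = {\<pi>. \<pi> permutes ({- int n..int n} - {0}) \<and> (\<forall>i. \<pi> (- i) = - \<pi> i)}"

definition des_B :: "nat \<Rightarrow> (int \<Rightarrow> int) \<Rightarrow> nat" where
  "des_B n \<pi> = card {i \<in> {1..int n}. \<pi> (i - 1) > \<pi> i}"

definition eulerian_B :: "nat \<Rightarrow> nat \<Rightarrow> nat" where
  "eulerian_B n k = card {\<pi> \<in> signed_perms n. des_B n \<pi> = k}"

definition eulerian :: "nat \<Rightarrow> nat \<Rightarrow> nat" where
  "eulerian n k =
     card {\<pi>. \<pi> permutes {1..n} \<and> card {i \<in> {1..<n}. \<pi> i > \<pi> (i + 1)} = k}"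

text \<open>The argument order follows \<open>\<langle>m, k\<rangle>\<^sub>r\<close> with the subscript first; meant for \<open>m \<ge> r\<close>.\<close>

definition restricted_eulerian :: "nat \<Rightarrow> nat \<Rightarrow> nat \<Rightarrow> nat" where
  "restricted_eulerian r m k =
     card {\<sigma> \<in> {1..m - r} \<rightarrow>\<^sub>E {1..m}.
             inj_on \<sigma> {1..m - r} \<and> card {i \<in> {1..m - r}. \<sigma> i > i} = k}"

text \<open>
  \<open>eulerian_gf u\<close> is the power series \<open>A(u, z)\<close> in \<open>z\<close>, for \<open>u \<noteq> 1\<close> in a field of characteristic 0;
  substitution for the indeterminate \<open>t\<close> of \<open>\<real>(t)\<close> is a change of the argument \<open>u\<close>.
\<close>

definition eulerian_gf :: "'a::field_char_0 \<Rightarrow> 'a fps" where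
  "eulerian_gf u = fps_const (1 - u) / (1 - fps_const u * fps_exp (1 - u))"

definition t_indet :: "real poly fract" where
  "t_indet = to_fract [:0, 1:]"

text \<open>
  \<open>1 + (\<Sum>n\<ge>1. \<Sum>k=1..n. T(n,k) t^k z^n / n!)\<close>, as a power series in \<open>z\<close> over \<open>\<real>(t)\<close>.
\<close>

definition T_series :: "(nat \<Rightarrow> nat \<Rightarrow> real) \<Rightarrow> real poly fract fps" where
  "T_series T = Abs_fps (\<lambda>n. if n = 0 then 1
     else (\<Sum>k=1..n. to_fract [:T n k:] * t_indet ^ k) / fact n)"

text \<open>
  \<open>T_series T\<close> is the square root of \<open>A(2t, z)\<close> with constant term 1 (the constant term is built into
  \<open>T_series\<close>).
\<close>

definition sqrt_eulerian_numbers :: "(nat \<Rightarrow> nat \<Rightarrow> real) \<Rightarrow> bool" where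
  "sqrt_eulerian_numbers T \<longleftrightarrow> (T_series T)\<^sup>2 = eulerian_gf (2 * t_indet)"

text \<open>Such numbers exist; the proof bounds the degrees in \<open>t\<close> of the coefficients.\<close>

definition poly_deg_le :: "nat \<Rightarrow> real poly fract set" where
  "poly_deg_le n = to_fract ` {p. degree p \<le> n}"

lemma poly_deg_leI: "degree p \<le> n \<Longrightarrow> to_fract p \<in> poly_deg_le n"
  unfolding poly_deg_le_def by blast

lemma poly_deg_leE:
  assumes "a \<in> poly_deg_le n"
  obtains p where "a = to_fract p" "degree p \<le> n"
  using assms unfolding poly_deg_le_def by blast

lemma poly_deg_le_add:
  assumes "a \<in> poly_deg_le n" "b \<in> poly_deg_le n"
  shows "a + b \<in> poly_deg_le n"
  using assms by (metis poly_deg_leE poly_deg_leI to_fract_add degree_add_le)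

lemma poly_deg_le_diff:
  assumes "a \<in> poly_deg_le n" "b \<in> poly_deg_le n"
  shows "a - b \<in> poly_deg_le n"
  using assms by (metis poly_deg_leE poly_deg_leI to_fract_diff degree_diff_le)

lemma poly_deg_le_mult:
  assumes "a \<in> poly_deg_le m" "b \<in> poly_deg_le n"
  shows "a * b \<in> poly_deg_le (m + n)"
proof -
  obtain p q where p: "a = to_fract p" "degree p \<le> m" and q: "b = to_fract q" "degree q \<le> n"
    using assms by (elim poly_deg_leE)
  have "degree (p * q) \<le> m + n"
    using degree_mult_le[of p q] p(2) q(2) by linarith
  then show ?thesis
    unfolding p(1) q(1) to_fract_mult[symmetric] by (rule poly_deg_leI)
qed

lemma poly_deg_le_0: "0 \<in> poly_deg_le n"
  using poly_deg_leI[of 0 n] by simp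

lemma poly_deg_le_1: "1 \<in> poly_deg_le n"
  using poly_deg_leI[of 1 n] by simp

lemma poly_deg_le_sum:
  "(\<And>i. i \<in> I \<Longrightarrow> f i \<in> poly_deg_le n) \<Longrightarrow> sum f I \<in> poly_deg_le n"
  by (induction I rule: infinite_finite_induct) (auto simp: poly_deg_le_0 poly_deg_le_add)

lemma to_fract_of_nat: "to_fract (of_nat m) = of_nat m"
  by (induction m) auto

lemma poly_deg_le_divide_nat:
  assumes "a \<in> poly_deg_le n" and "m > 0"
  shows "a / of_nat m \<in> poly_deg_le n"
proof -
  from assms obtain p where p: "a = to_fract p" "degree p \<le> n"
    by (auto simp: poly_deg_le_def)
  let ?q = "smult (1 / of_nat m) p"
  have "of_nat m * ?q = p"
    using assms(2) by (simp add: of_nat_poly)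
  then have "a = to_fract (of_nat m * ?q)"
    by (simp only: p(1))
  also have "\<dots> = of_nat m * to_fract ?q"
    by (simp only: to_fract_mult to_fract_of_nat)
  finally have "a / of_nat m = to_fract ?q"
    using assms(2) by simp
  then show ?thesis
    using p(2) poly_deg_leI[of ?q n] assms(2) by simp
qed

lemma poly_deg_le_power: "a \<in> poly_deg_le 1 \<Longrightarrow> a ^ i \<in> poly_deg_le i"
proof (induction i)
  case (Suc i)
  then show ?case using poly_deg_le_mult[of a 1 "a ^ i" i] by simp
qed (simp add: poly_deg_le_1)

lemma t_indet_poly_deg_le: "t_indet \<in> poly_deg_le 1" "2 * t_indet \<in> poly_deg_le 1"
proof -
  show t: "t_indet \<in> poly_deg_le 1"
    unfolding t_indet_def by (rule poly_deg_leI) simp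
  show "2 * t_indet \<in> poly_deg_le 1"
    unfolding mult_2 by (intro poly_deg_le_add t)
qed

lemma two_t_neq_1: "2 * t_indet \<noteq> 1"
proof
  assume "2 * t_indet = 1"
  then have "to_fract ([:0, 1:] + [:0, 1:] :: real poly) = to_fract 1"
    by (simp only: t_indet_def mult_2 to_fract_add to_fract_1)
  then have "([:0, 1:] + [:0, 1:] :: real poly) = 1"
    by (simp only: to_fract_eq_iff)
  then show False by (simp add: one_pCons)
qed

unbundle fps_syntax

lemma eulerian_gf_mult:
  assumes "u \<noteq> 1"
  shows "eulerian_gf u * (1 - fps_const u * fps_exp (1 - u)) = fps_const (1 - u)"
proof -
  have "(1 - fps_const u * fps_exp (1 - u)) $ 0 \<noteq> 0"
    using assms by simp
  then show ?thesis
    by (simp add: eulerian_gf_def fps_divide_unit mult.assoc inverse_mult_eq_1)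
qed

lemma eulerian_gf_nth_0: "u \<noteq> 1 \<Longrightarrow> eulerian_gf u $ 0 = 1"
  using arg_cong[OF eulerian_gf_mult, of u "\<lambda>f. f $ 0"] by simp

lemma eulerian_gf_nth_rec:
  assumes u: "u \<noteq> 1" and n: "n > 0"
  shows "eulerian_gf u $ n = u * (\<Sum>i=1..n. eulerian_gf u $ (n - i) * (1 - u) ^ (i - 1) / fact i)"
proof -
  let ?A = "eulerian_gf u"
  have "(?A * (1 - fps_const u * fps_exp (1 - u))) $ n = 0"
    using eulerian_gf_mult[OF u] n by simp
  then have "?A $ n = (fps_const u * (fps_exp (1 - u) * ?A)) $ n"
    by (simp add: algebra_simps)
  also have "\<dots> = u * (\<Sum>i=0..n. (1 - u) ^ i / fact i * ?A $ (n - i))"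
    unfolding fps_mult_left_const_nth by (simp add: fps_mult_nth fps_exp_def)
  also have "(\<Sum>i=0..n. (1 - u) ^ i / fact i * ?A $ (n - i)) =
             ?A $ n + (\<Sum>i=1..n. (1 - u) ^ i / fact i * ?A $ (n - i))"
    by (simp add: sum.atLeast_Suc_atMost)
  also have "(\<Sum>i=1..n. (1 - u) ^ i / fact i * ?A $ (n - i)) =
             (1 - u) * (\<Sum>i=1..n. ?A $ (n - i) * (1 - u) ^ (i - 1) / fact i)"
    unfolding sum_distrib_left
  proof (rule sum.cong)
    fix i assume "i \<in> {1..n}"
    then have "(1 - u) ^ i = (1 - u) * (1 - u) ^ (i - 1)"
      by (cases i) auto
    then show "(1 - u) ^ i / fact i * ?A $ (n - i) =
               (1 - u) * (?A $ (n - i) * (1 - u) ^ (i - 1) / fact i)"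
      by (simp add: mult.commute mult.left_commute)
  qed simp
  finally have "(1 - u) * ?A $ n =
      (1 - u) * (u * (\<Sum>i=1..n. ?A $ (n - i) * (1 - u) ^ (i - 1) / fact i))"
    by (simp add: algebra_simps)
  then show ?thesis
    using u by simp
qed

lemma eulerian_gf_poly:
  "eulerian_gf (2 * t_indet) $ n \<in> poly_deg_le n \<and>
   (n > 0 \<longrightarrow> eulerian_gf (2 * t_indet) $ n / t_indet \<in> poly_deg_le (n - 1))"
proof (induction n rule: less_induct)
  case (less n)
  let ?u = "2 * t_indet" and ?A = "eulerian_gf (2 * t_indet)"
  show ?case
  proof (cases "n = 0")
    case True
    then show ?thesis
      by (simp add: eulerian_gf_nth_0[OF two_t_neq_1] poly_deg_le_1)
  next
    case False
    have t0: "t_indet \<noteq> 0"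
      by (simp add: t_indet_def)
    let ?S = "\<Sum>i=1..n. ?A $ (n - i) * (1 - ?u) ^ (i - 1) / fact i"
    have S: "?S \<in> poly_deg_le (n - 1)"
    proof (rule poly_deg_le_sum)
      fix i assume i: "i \<in> {1..n}"
      have "1 - ?u \<in> poly_deg_le 1"
        by (intro poly_deg_le_diff poly_deg_le_1 t_indet_poly_deg_le)
      then have "?A $ (n - i) * (1 - ?u) ^ (i - 1) \<in> poly_deg_le ((n - i) + (i - 1))"
        using less[of "n - i"] i by (intro poly_deg_le_mult poly_deg_le_power) auto
      then show "?A $ (n - i) * (1 - ?u) ^ (i - 1) / fact i \<in> poly_deg_le (n - 1)"
        using poly_deg_le_divide_nat[of _ _ "fact i"] i by simp
    qed
    have eq: "?A $ n = ?u * ?S"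
      using eulerian_gf_nth_rec[OF two_t_neq_1] False by simp
    have "?A $ n \<in> poly_deg_le (1 + (n - 1))"
      unfolding eq by (intro poly_deg_le_mult t_indet_poly_deg_le S)
    moreover have "?A $ n / t_indet = ?S + ?S"
      unfolding eq using t0 by simp
    ultimately show ?thesis
      using False poly_deg_le_add[OF S S] by simp
  qed
qed

lemma sqrt_eulerian_numbers_exist: "\<exists>T. sqrt_eulerian_numbers T"
proof -
  let ?A = "eulerian_gf (2 * t_indet)"
  define S where "S = fps_radical (\<lambda>_ _. 1) 2 ?A"
  have A0: "?A $ 0 = 1"
    by (rule eulerian_gf_nth_0[OF two_t_neq_1])
  have S2: "S ^ 2 = ?A"
    using power_radical[of ?A "\<lambda>_ _. 1" 1] A0 by (simp add: S_def numeral_2_eq_2)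
  have S0: "S $ 0 = 1"
    by (simp add: S_def)
  have t0: "t_indet \<noteq> 0"
    by (simp add: t_indet_def)
  have S_poly: "n > 0 \<Longrightarrow> S $ n / t_indet \<in> poly_deg_le (n - 1)" for n
  proof (induction n rule: less_induct)
    case (less n)
    have n: "n > 0" by fact
    have "?A $ n = (\<Sum>i=0..n. S $ i * S $ (n - i))"
      by (simp flip: S2 add: power2_eq_square fps_mult_nth)
    also have "{0..n} = insert 0 (insert n {1..<n})"
      using n by auto
    also have "(\<Sum>i\<in>\<dots>. S $ i * S $ (n - i)) = 2 * S $ n + (\<Sum>i=1..<n. S $ i * S $ (n - i))"
      using n by (simp add: S0)
    finally have rec: "?A $ n = 2 * S $ n + (\<Sum>i=1..<n. S $ i * S $ (n - i))" .
    have "t_indet * ((S $ i / t_indet) * (S $ (n - i) / t_indet)) = S $ i * S $ (n - i) / t_indet" for i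
      using t0 by simp
    then have "(\<Sum>i=1..<n. t_indet * ((S $ i / t_indet) * (S $ (n - i) / t_indet))) =
               (\<Sum>i=1..<n. S $ i * S $ (n - i)) / t_indet"
      by (simp only: sum_divide_distrib)
    then have eq: "S $ n / t_indet =
        (?A $ n / t_indet - (\<Sum>i=1..<n. t_indet * ((S $ i / t_indet) * (S $ (n - i) / t_indet))))
        / of_nat 2"
      by (simp only: rec add_divide_distrib) simp
    have summand: "t_indet * ((S $ i / t_indet) * (S $ (n - i) / t_indet)) \<in> poly_deg_le (n - 1)"
      if "i \<in> {1..<n}" for i
    proof -
      have "t_indet * ((S $ i / t_indet) * (S $ (n - i) / t_indet))
              \<in> poly_deg_le (1 + ((i - 1) + (n - i - 1)))"
        using that less.IH[of i] less.IH[of "n - i"]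
        by (intro poly_deg_le_mult t_indet_poly_deg_le) auto
      moreover have "1 + ((i - 1) + (n - i - 1)) = n - 1"
        using that by auto
      ultimately show ?thesis
        by metis
    qed
    show ?case
      unfolding eq
    proof (intro poly_deg_le_divide_nat poly_deg_le_diff poly_deg_le_sum)
      show "?A $ n / t_indet \<in> poly_deg_le (n - 1)"
        using eulerian_gf_poly n by blast
    qed (use summand in auto)
  qed
  have "\<exists>p. \<forall>n>0. S $ n / t_indet = to_fract (p n) \<and> degree (p n) \<le> n - 1"
    using S_poly unfolding poly_deg_le_def by (intro choice) blast
  then obtain p where p: "\<And>n. n > 0 \<Longrightarrow> S $ n / t_indet = to_fract (p n)"
      "\<And>n. n > 0 \<Longrightarrow> degree (p n) \<le> n - 1"
    by blast
  define T where "T n k = fact n * coeff (p n) (k - 1)" for n k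
  have "T_series T $ n = S $ n" for n
  proof (cases "n = 0")
    case True
    then show ?thesis by (simp add: T_series_def S0)
  next
    case False
    have shift: "to_fract (pCons 0 q) = t_indet * to_fract q" for q
      by (simp add: t_indet_def flip: to_fract_mult)
    have monom: "to_fract [:c:] * t_indet ^ k = to_fract (monom c k)" for c k
      by (induction k) (simp_all add: monom_0 monom_Suc shift mult.left_commute)
    have "(\<Sum>k=1..n. to_fract [:T n k:] * t_indet ^ k) =
          to_fract (\<Sum>k=1..n. monom (T n k) k)"
      by (simp add: monom)
    also have "(\<Sum>k=1..n. monom (T n k) k) = of_nat (fact n) * ([:0, 1:] * p n)"
    proof (rule poly_eqI)
      fix j
      have "coeff (p n) (j - 1) = 0" if "j > n"
        using that p(2)[of n] False by (intro coeff_eq_0) auto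
      then show "coeff (\<Sum>k=1..n. monom (T n k) k) j =
                 coeff (of_nat (fact n) * ([:0, 1:] * p n)) j"
        by (cases j) (auto simp: coeff_sum T_def of_nat_poly)
    qed
    also have "to_fract \<dots> = fact n * (t_indet * to_fract (p n))"
      by (simp only: to_fract_mult to_fract_of_nat t_indet_def) simp
    also have "t_indet * to_fract (p n) = S $ n"
      using p(1)[of n] False t0 by (simp add: field_simps)
    finally show ?thesis
      using False by (simp add: T_series_def)
  qed
  then have "T_series T = S"
    by (simp add: fps_eq_iff)
  then have "sqrt_eulerian_numbers T"
    by (simp add: sqrt_eulerian_numbers_def S2)
  then show ?thesis by blast
qed

unbundle no fps_syntax


section \<open>Matchings, Stirling numbers and Lah numbers\<close>

definition perfect_matchings :: "nat set \<Rightarrow> nat set set set" where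
  "perfect_matchings S = {M. partition_on S M \<and> (\<forall>e\<in>M. card e = 2)}"

definition matchings_odd_min :: "nat \<Rightarrow> nat \<Rightarrow> nat" where
  "matchings_odd_min n k =
     card {M \<in> perfect_matchings {1..2 * n}. card {e \<in> M. odd (Min e)} = k}"

text \<open>The cycles of \<open>\<pi>\<close> on \<open>[n]\<close>, fixed points included, are the orbits of the elements of \<open>[n]\<close>.\<close>

definition stirling_cycle :: "nat \<Rightarrow> nat \<Rightarrow> nat" where
  "stirling_cycle n k = card {\<pi>. \<pi> permutes {1..n} \<and> card (orbit \<pi> ` {1..n}) = k}"

definition stirling_set :: "nat \<Rightarrow> nat \<Rightarrow> nat" where
  "stirling_set n k = card {P. partition_on {1..n} P \<and> card P = k}"

text \<open>
  Unordered collections of \<open>k\<close> labeled structures are multisets. That the sum of the label multisets is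
  \<open>mset_set {1..n}\<close> says that every label in \<open>[n]\<close> occurs exactly once in the whole collection.
\<close>

definition lah :: "nat \<Rightarrow> nat \<Rightarrow> nat" where
  "lah n k = card {F :: nat list multiset.
     size F = k \<and> [] \<notin># F \<and> (\<Sum>l\<in>#F. mset l) = mset_set {1..n}}"


section \<open>Increasing trees and forests\<close>

datatype plane_tree = Plane_Node (root_label: nat) (subtrees: "plane_tree list")

fun plane_labels :: "plane_tree \<Rightarrow> nat multiset" where
  "plane_labels (Plane_Node a ts) = {#a#} + (\<Sum>t\<leftarrow>ts. plane_labels t)"

fun plane_increasing :: "plane_tree \<Rightarrow> bool" where
  "plane_increasing (Plane_Node a ts) \<longleftrightarrow>
     (\<forall>t\<in>set ts. a < root_label t \<and> plane_increasing t)"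

definition nonroot_labels :: "plane_tree \<Rightarrow> nat multiset" where
  "nonroot_labels t = (\<Sum>s\<leftarrow>subtrees t. plane_labels s)"

definition organic_forests :: "nat \<Rightarrow> nat \<Rightarrow> plane_tree multiset set" where
  "organic_forests n k = {F. size F = k \<and>
     (\<forall>t\<in>#F. root_label t = 0 \<and> subtrees t \<noteq> [] \<and> plane_increasing t) \<and>
     (\<Sum>t\<in>#F. nonroot_labels t) = mset_set {1..n}}"

text \<open>
  In an \<open>r\<close>-ary tree each node lists its \<open>r\<close> child positions in order, a position without a child being
  \<open>Empty\<close>. The trees of a forest are themselves nonempty.
\<close>

datatype rary_tree = Empty | Rary_Node nat "rary_tree list"

fun rary :: "nat \<Rightarrow> rary_tree \<Rightarrow> bool" where
  "rary r Empty \<longleftrightarrow> True"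
| "rary r (Rary_Node a ts) \<longleftrightarrow> length ts = r \<and> (\<forall>t\<in>set ts. rary r t)"

fun rary_labels :: "rary_tree \<Rightarrow> nat multiset" where
  "rary_labels Empty = {#}"
| "rary_labels (Rary_Node a ts) = {#a#} + (\<Sum>t\<leftarrow>ts. rary_labels t)"

fun root_above :: "nat \<Rightarrow> rary_tree \<Rightarrow> bool" where
  "root_above a Empty \<longleftrightarrow> True"
| "root_above a (Rary_Node b ts) \<longleftrightarrow> a < b"

fun rary_increasing :: "rary_tree \<Rightarrow> bool" where
  "rary_increasing Empty \<longleftrightarrow> True"
| "rary_increasing (Rary_Node a ts) \<longleftrightarrow> (\<forall>t\<in>set ts. root_above a t \<and> rary_increasing t)"

definition rary_forests :: "nat \<Rightarrow> nat \<Rightarrow> nat \<Rightarrow> rary_tree multiset set" where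
  "rary_forests r n k = {F. size F = k \<and>
     (\<forall>t\<in>#F. t \<noteq> Empty \<and> rary r t \<and> rary_increasing t) \<and>
     (\<Sum>t\<in>#F. rary_labels t) = mset_set {1..n}}"

text \<open>
  Nodes of a mobile with \<open>m\<close> nodes are identified with their labels in \<open>[m]\<close>. As labels increase away
  from the root, the root is 1, and the underlying rooted tree is given by the map \<open>par\<close> sending every
  other node to its parent, a smaller node; conversely every such map is a rooted tree. The cyclic
  orders on the sets of children are given by a permutation \<open>\<sigma>\<close> of the nonroot nodes sending each node to the next
  one in the cyclic order of its siblings: the orbit of a node under \<open>\<sigma>\<close> is exactly the set of
  children of its parent.
\<close>

definition increasing_mobiles :: "nat \<Rightarrow> ((nat \<Rightarrow> nat) \<times> (nat \<Rightarrow> nat)) set" where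
  "increasing_mobiles m = {(par, \<sigma>).
     par \<in> {2..m} \<rightarrow>\<^sub>E {1..m} \<and> (\<forall>i\<in>{2..m}. par i < i) \<and>
     \<sigma> permutes {2..m} \<and> (\<forall>i\<in>{2..m}. orbit \<sigma> i = {j \<in> {2..m}. par j = par i})}"

definition mobile_leaves :: "nat \<Rightarrow> (nat \<Rightarrow> nat) \<Rightarrow> nat set" where
  "mobile_leaves m par = {i \<in> {1..m}. \<forall>j\<in>{2..m}. par j \<noteq> i}"

definition mobile_number :: "nat \<Rightarrow> nat \<Rightarrow> nat" where
  "mobile_number n k =
     card {(par, \<sigma>) \<in> increasing_mobiles (n + 1). card (mobile_leaves (n + 1) par) = k}"

end

(*
  In each item the right-hand side is the sum of a monomial weight over a family of combinatorial
  structures, the exponents recording the size and a statistic. Every structure of size n + 1 arises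
  uniquely from one of size n by inserting a new extreme element (two of them in a matching), and
  the Leibniz rule applied to the weight of a structure lists the weights of all its extensions:
  each letter of the weight marks a place where an insertion has a given effect on the statistic.
  Only (c6) is different: there the exponential generating functions of the iterated derivatives
  satisfy an ordinary differential equation, because y^2 - 2x is annihilated by D, and the same
  equation characterises A(2t, z).
*)
theory Submission
  imports Defs
begin

section \<open>Formal derivatives of weighted families\<close>

text \<open>In all twelve grammars D x = x f and D y = y g, so D multiplies a monomial x^a y^b by a
  f + b g: the exponents themselves become the numbers of insertions. For this to work, the number
  of insertions of each effect may depend only on the size and the statistic, and the weights are
  tuned to that: a power of 2 absorbs the factor 2 of an even exponent, and k! absorbs the k + 1
  coming from x^(k + 1), so that a new block or cycle is opened in just one way. Each insertion
  count is proved as a summation identity for an arbitrary function of the statistic; with the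
  monomial weight in place of this function it matches the Leibniz rule at once, and no recurrence
  for the numbers with its boundary cases is required. What remains is truncated subtraction in the
  exponents, hence the bounds on the statistics. For the square root, D^n y is homogeneous of weight
  2n + 1 if x has weight 2 and y has weight 1, so setting y = 1 loses nothing and the series can be
  compared over R(t).\<close>

lemma formal_derivative_add:
  "formal_derivative f g D \<Longrightarrow> D (u + v) = D u + D v"
  by (simp add: formal_derivative_def)

lemma formal_derivative_mult:
  "formal_derivative f g D \<Longrightarrow> D (u * v) = D u * v + u * D v"
  by (simp add: formal_derivative_def)

lemma formal_derivative_scalar_mult:
  "formal_derivative f g D \<Longrightarrow> D (scalar c * u) = scalar c * D u"
  unfolding formal_derivative_def by blast

lemma formal_derivative_0: "formal_derivative f g D \<Longrightarrow> D 0 = 0"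
  using formal_derivative_add[of f g D 0 0] by simp

lemma formal_derivative_1: "formal_derivative f g D \<Longrightarrow> D 1 = 0"
  using formal_derivative_mult[of f g D 1 1] by simp

lemma formal_derivative_sum:
  "formal_derivative f g D \<Longrightarrow> D (\<Sum>i\<in>I. u i) = (\<Sum>i\<in>I. D (u i))"
  by (induction I rule: infinite_finite_induct)
    (simp_all add: formal_derivative_0 formal_derivative_add)

lemma formal_derivative_of_nat:
  "formal_derivative f g D \<Longrightarrow> D (of_nat m) = 0"
  by (induction m) (simp_all add: formal_derivative_0 formal_derivative_1 formal_derivative_add)

lemma formal_derivative_of_nat_mult:
  "formal_derivative f g D \<Longrightarrow> D (of_nat m * u) = of_nat m * D u"
  by (simp add: formal_derivative_mult formal_derivative_of_nat)

text \<open>With the logarithmic derivative h of u the power rule needs no exponent m - 1, so m = 0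
  is not special.\<close>

lemma formal_derivative_power:
  assumes "formal_derivative f g D" and "D u = u * h"
  shows "D (u ^ m) = of_nat m * u ^ m * h"
  by (induction m)
    (simp_all add: assms formal_derivative_1[OF assms(1)] formal_derivative_mult[OF assms(1)]
      algebra_simps)

text \<open>This is the form in which every grammar is applied: the eigenvalue-like factor turns the
  exponents a and b into multiplicities of f and g.\<close>

lemma formal_derivative_monomial:
  assumes "formal_derivative (\<x> * f) (\<y> * g) D"
  shows "D (\<x> ^ a * \<y> ^ b) = \<x> ^ a * \<y> ^ b * (of_nat a * f + of_nat b * g)"
proof -
  have "D (\<x> ^ a) = of_nat a * \<x> ^ a * f" "D (\<y> ^ b) = of_nat b * \<y> ^ b * g"
    using assms by (auto intro!: formal_derivative_power simp: formal_derivative_def)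
  then show ?thesis
    by (simp add: formal_derivative_mult[OF assms] algebra_simps)
qed

text \<open>
  Think of an insertion that extends a structure \<open>s\<close> of size \<open>n\<close> in \<open>\<alpha> n (st n s)\<close> ways that preserve
  the statistic and in \<open>\<beta> n (st n s)\<close> ways that raise it by one.
\<close>

lemma funpow_formal_derivative_weights:
  fixes st :: "nat \<Rightarrow> 's \<Rightarrow> nat"
  assumes D: "formal_derivative f g D"
    and rec: "\<And>n (f :: nat \<Rightarrow> real poly poly). (\<Sum>s\<in>S (Suc n). f (st (Suc n) s)) =
      (\<Sum>s\<in>S n. of_nat (\<alpha> n (st n s)) * f (st n s) +
                of_nat (\<beta> n (st n s)) * f (Suc (st n s)))"
    and wt: "\<And>n s. s \<in> S n \<Longrightarrow> D (m n (st n s)) =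
      of_nat (\<alpha> n (st n s)) * m (Suc n) (st n s) +
      of_nat (\<beta> n (st n s)) * m (Suc n) (Suc (st n s))"
  shows "(D ^^ n) (\<Sum>s\<in>S 0. m 0 (st 0 s)) = (\<Sum>s\<in>S n. m n (st n s))"
proof (induction n)
  case (Suc n)
  then show ?case
    by (simp add: formal_derivative_sum[OF D] wt rec[where f = "m (Suc n)"])
qed simp

lemma sum_by_statistic:
  assumes "finite S" and "finite K" and "\<And>s. s \<in> S \<Longrightarrow> st s \<in> K"
  shows "(\<Sum>s\<in>S. f (st s)) = (\<Sum>k\<in>K. of_nat (card {s \<in> S. st s = k}) * f k)"
proof -
  have "(\<Sum>k\<in>K. of_nat (card {s \<in> S. st s = k}) * f k) =
        (\<Sum>k\<in>K. \<Sum>s\<in>{s \<in> S. st s = k}. f (st s))"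
    by (intro sum.cong) auto
  also have "\<dots> = (\<Sum>s\<in>S. f (st s))"
    using assms by (intro sum.group) auto
  finally show ?thesis ..
qed

section \<open>Descents of words\<close>

text \<open>In the statistics a word carries a leading 0. It stands for pi(0) in
  \<open>des_B\<close>, and before a positive letter it causes no descent, so one function serves
  signed and ordinary permutations.\<close>

fun descents :: "int list \<Rightarrow> nat" where
  "descents (a # b # w) = of_bool (a > b) + descents (b # w)"
| "descents _ = 0"

definition insert_at :: "'a \<Rightarrow> nat \<Rightarrow> 'a list \<Rightarrow> 'a list" where
  "insert_at v i w = take i w @ v # drop i w"

lemma insert_at_Cons [simp]:
  "insert_at v 0 w = v # w" "insert_at v (Suc i) (a # w) = a # insert_at v i w"
  by (simp_all add: insert_at_def)

lemma set_insert_at [simp]: "set (insert_at v i w) = insert v (set w)"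
  by (auto simp: insert_at_def dest: in_set_takeD in_set_dropD)
    (metis append_take_drop_id in_set_conv_decomp UnE set_append)

lemma mset_insert_at [simp]: "mset (insert_at v i w) = add_mset v (mset w)"
proof -
  have "mset w = mset (take i w) + mset (drop i w)"
    by (simp flip: mset_append)
  then show ?thesis by (simp add: insert_at_def)
qed

lemma map_insert_at: "map f (insert_at v i w) = insert_at (f v) i (map f w)"
  by (simp add: insert_at_def take_map drop_map)

lemma distinct_insert_at [simp]: "distinct (insert_at v i w) \<longleftrightarrow> v \<notin> set w \<and> distinct w"
  by (metis distinct.simps(2) mset.simps(2) mset_eq_imp_distinct_iff mset_insert_at)

text \<open>The inserted letter is recognised as the only one with its image under f. With f = abs
  it is found whatever its sign; plain lists use the identity.\<close>

lemma insert_at_inject: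
  "\<lbrakk>insert_at v i w = insert_at v' i' w'; i \<le> length w; i' \<le> length w';
    f v = f v'; f v \<notin> f ` set w; f v \<notin> f ` set w'\<rbrakk> \<Longrightarrow> v = v' \<and> i = i' \<and> w = w'"
proof (induction i arbitrary: w i' w')
  case 0
  then show ?case
    by (cases i'; cases w') auto
next
  case (Suc i)
  then obtain a u where w: "w = a # u" by (cases w) auto
  show ?case
  proof (cases i')
    case 0
    then show ?thesis using Suc.prems by (auto simp: w)
  next
    case (Suc j)
    then obtain a' u' where w': "w' = a' # u'" using Suc.prems by (cases w') auto
    show ?thesis using Suc.prems Suc.IH[of u j u'] by (auto simp: w w' Suc)
  qed
qed

lemma insert_at_exhaust:
  assumes "v \<in> set u"
  obtains i w where "u = insert_at v i w" "i \<le> length w"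
proof -
  obtain w1 w2 where "u = w1 @ v # w2" using assms by (meson split_list)
  then have "u = insert_at v (length w1) (w1 @ w2)" by (simp add: insert_at_def)
  then show ?thesis using that[of "length w1" "w1 @ w2"] by simp
qed

lemma descents_le: "descents (a # w) \<le> length w"
  by (induction w arbitrary: a) (auto simp: of_bool_def intro: le_SucI)

text \<open>A maximal letter placed in a descent gap or at the end leaves the number of descents
  unchanged; in any other gap it creates one more.\<close>

lemma sum_descents_insert_max:
  fixes f :: "nat \<Rightarrow> 'a::comm_semiring_1"
  assumes "\<forall>b\<in>set (a # w). b < M"
  shows "(\<Sum>i\<le>length w. f (descents (a # insert_at M i w))) =
    of_nat (Suc (descents (a # w))) * f (descents (a # w)) +
    of_nat (length w - descents (a # w)) * f (Suc (descents (a # w)))"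
  using assms
proof (induction w arbitrary: a f)
  case (Cons b w)
  note le = descents_le[of b w]
  have "(\<Sum>i\<le>length (b # w). f (descents (a # insert_at M i (b # w)))) =
    f (Suc (descents (b # w))) + (\<Sum>i\<le>length w. f (of_bool (a > b) + descents (b # insert_at M i w)))"
    using Cons.prems by (simp add: sum.atMost_Suc_shift del: sum.atMost_Suc)
  \<comment> \<open>The induction hypothesis holds for every f, so the comparison of a with b can be
    absorbed into f.\<close>
  then show ?case
    using Cons.prems le by (simp add: Cons.IH[where f = "\<lambda>k. f (of_bool (a > b) + k)"] algebra_simps
        of_nat_diff Suc_diff_le)
qed simp

text \<open>Dually, a minimal letter preserves the number only in a descent gap; at the end it
  creates a descent.\<close>

lemma sum_descents_insert_min:
  fixes f :: "nat \<Rightarrow> 'a::comm_semiring_1"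
  assumes "\<forall>b\<in>set (a # w). M < b"
  shows "(\<Sum>i\<le>length w. f (descents (a # insert_at M i w))) =
    of_nat (descents (a # w)) * f (descents (a # w)) +
    of_nat (Suc (length w) - descents (a # w)) * f (Suc (descents (a # w)))"
  using assms
proof (induction w arbitrary: a f)
  case (Cons b w)
  note le = descents_le[of b w]
  have "(\<Sum>i\<le>length (b # w). f (descents (a # insert_at M i (b # w)))) =
    f (Suc (descents (b # w))) + (\<Sum>i\<le>length w. f (of_bool (a > b) + descents (b # insert_at M i w)))"
    using Cons.prems by (simp add: sum.atMost_Suc_shift del: sum.atMost_Suc)
  then show ?case
    using Cons.prems le by (simp add: Cons.IH[where f = "\<lambda>k. f (of_bool (a > b) + k)"] algebra_simps
        of_nat_diff Suc_diff_le)
qed simp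

lemma descents_eq_card: "descents w = card {i. Suc i < length w \<and> w ! i > w ! Suc i}"
proof (induction w rule: descents.induct)
  case (1 a b w)
  let ?A = "\<lambda>w. {i. Suc i < length w \<and> w ! i > (w ! Suc i :: int)}"
  have "?A (a # b # w) = {i. i = 0 \<and> a > b} \<union> Suc ` ?A (b # w)"
  proof (intro set_eqI)
    fix i show "i \<in> ?A (a # b # w) \<longleftrightarrow> i \<in> {i. i = 0 \<and> a > b} \<union> Suc ` ?A (b # w)"
      by (cases i) auto
  qed
  moreover have "finite (?A (b # w))"
    by (rule finite_subset[of _ "{..<length (b # w)}"]) auto
  ultimately have "card (?A (a # b # w)) = card {i::nat. i = 0 \<and> a > b} + card (Suc ` ?A (b # w))"
    by (simp only:) (rule card_Un_disjoint, auto)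
  moreover have "card {i::nat. i = 0 \<and> a > b} = of_bool (a > b)"
    by (cases "a > b") auto
  ultimately show ?case using 1 by (simp add: card_image)
qed simp_all

text \<open>\<open>E\<close> is the set of admissible signs: \<open>{1}\<close> for permutations, \<open>{1, -1}\<close> for signed ones.\<close>

definition signed_words :: "int set \<Rightarrow> nat \<Rightarrow> int list set" where
  "signed_words E n =
     {w. distinct (map abs w) \<and> set (map abs w) = int ` {1..n} \<and> sgn ` set w \<subseteq> E}"

lemma length_signed_word: "w \<in> signed_words E n \<Longrightarrow> length w = n"
  by (auto simp: signed_words_def card_image dest!: distinct_card)

text \<open>Deleting the unique letter of absolute value n + 1 leaves a word of length n; the sign e
  and one of the n + 1 places i restore it.\<close>

lemma signed_words_Suc:
  assumes "E \<subseteq> {1, -1}"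
  shows "bij_betw (\<lambda>(w, e, i). insert_at (e * int (Suc n)) i w)
           (signed_words E n \<times> E \<times> {..n}) (signed_words E (Suc n))"
proof (rule bij_betw_imageI)
  have abs_e: "\<bar>e * int (Suc n)\<bar> = int (Suc n)" if "e \<in> E" for e
    using that assms by (auto simp: abs_mult)
  have new: "int (Suc n) \<notin> abs ` set w" if "w \<in> signed_words E n" for w
    using that by (auto simp: signed_words_def)
  show "inj_on (\<lambda>(w, e, i). insert_at (e * int (Suc n)) i w) (signed_words E n \<times> E \<times> {..n})"
  proof (rule inj_onI, goal_cases)
    case (1 p p')
    obtain w e i w' e' i' where p: "p = (w, e, i)" "p' = (w', e', i')"
      by (metis prod_cases3)
    with 1 have w: "w \<in> signed_words E n" "w' \<in> signed_words E n" and e: "e \<in> E" "e' \<in> E"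
      and i: "i \<in> {..n}" "i' \<in> {..n}"
      and eq: "insert_at (e * int (Suc n)) i w = insert_at (e' * int (Suc n)) i' w'"
      by simp_all
    have "e * int (Suc n) = e' * int (Suc n) \<and> i = i' \<and> w = w'"
      using insert_at_inject[OF eq, where f = abs] w e i
      by (simp only: abs_e new length_signed_word atMost_iff) simp
    then show ?case by (simp add: p)
  qed
  show "(\<lambda>(w, e, i). insert_at (e * int (Suc n)) i w) ` (signed_words E n \<times> E \<times> {..n}) =
        signed_words E (Suc n)"
  proof (intro subset_antisym subsetI)
    fix u assume "u \<in> (\<lambda>(w, e, i). insert_at (e * int (Suc n)) i w) ` (signed_words E n \<times> E \<times> {..n})"
    then obtain w e i where u: "u = insert_at (e * int (Suc n)) i w"
      and w: "w \<in> signed_words E n" "e \<in> E" by auto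
    have "sgn (e * int (Suc n)) = e" using w(2) assms by (auto simp: sgn_mult)
    then show "u \<in> signed_words E (Suc n)"
      using w new[OF w(1)] abs_e[OF w(2)]
      by (auto simp: u signed_words_def map_insert_at atLeastAtMostSuc_conv)
  next
    fix u assume u: "u \<in> signed_words E (Suc n)"
    have "int (Suc n) \<in> int ` {1..Suc n}" by (rule imageI) simp
    then have "int (Suc n) \<in> abs ` set u" using u by (simp add: signed_words_def)
    then obtain v where v: "v \<in> set u" "\<bar>v\<bar> = int (Suc n)" by auto
    have v_eq: "v = sgn v * int (Suc n)"
      using sgn_mult_abs[of v] by (simp only: v(2))
    have e: "sgn v \<in> E"
      using u v(1) by (auto simp: signed_words_def)
    obtain i w where w: "u = insert_at v i w" "i \<le> length w"
      using insert_at_exhaust[OF v(1)] .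
    have fresh: "int (Suc n) \<notin> abs ` set w" and
      "insert (int (Suc n)) (abs ` set w) = insert (int (Suc n)) (int ` {1..n})"
      using u v(2) by (simp_all add: w signed_words_def map_insert_at atLeastAtMostSuc_conv)
    then have "abs ` set w = int ` {1..n}"
      by (subst (asm) insert_ident) auto
    then have "w \<in> signed_words E n"
      using u v(2) by (simp add: w signed_words_def map_insert_at)
    then show "u \<in> (\<lambda>(w, e, i). insert_at (e * int (Suc n)) i w) ` (signed_words E n \<times> E \<times> {..n})"
      using e w v_eq length_signed_word by (intro image_eqI[of _ _ "(w, sgn v, i)"]) auto
  qed
qed

lemma signed_words_0: "signed_words E 0 = {[]}"
  by (auto simp: signed_words_def)

lemma finite_signed_words: "finite E \<Longrightarrow> E \<subseteq> {1, -1} \<Longrightarrow> finite (signed_words E n)"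
proof (induction n)
  case (Suc n)
  then show ?case using bij_betw_finite[OF signed_words_Suc[of E n]] by simp
qed (simp add: signed_words_0)

text \<open>With d descents, the letter n + 1 preserves d in d + 1 places and raises it in n - d.
  The letter -(n + 1) adds d and n + 1 - d places to these, which gives 2d + 1 and 2n + 1 - 2d in
  the signed case.\<close>

lemma sum_signed_words_Suc:
  fixes f :: "nat \<Rightarrow> 'a::comm_semiring_1"
  shows
    "(\<Sum>w\<in>signed_words {1} (Suc n). f (descents (0 # w))) =
     (\<Sum>w\<in>signed_words {1} n.
        of_nat (Suc (descents (0 # w))) * f (descents (0 # w)) +
        of_nat (n - descents (0 # w)) * f (Suc (descents (0 # w))))" (is ?A)
    "(\<Sum>w\<in>signed_words {1, -1} (Suc n). f (descents (0 # w))) =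
     (\<Sum>w\<in>signed_words {1, -1} n.
        of_nat (2 * descents (0 # w) + 1) * f (descents (0 # w)) +
        of_nat (2 * n + 1 - 2 * descents (0 # w)) * f (Suc (descents (0 # w))))" (is ?B)
proof -
  have exp: "(\<Sum>w\<in>signed_words E (Suc n). f (descents (0 # w))) =
    (\<Sum>w\<in>signed_words E n. \<Sum>e\<in>E. \<Sum>i\<le>length w. f (descents (0 # insert_at (e * int (Suc n)) i w)))"
    if "E \<subseteq> {1, -1}" for E
    by (subst sum.reindex_bij_betw[OF signed_words_Suc[OF that], symmetric])
      (auto simp: sum.cartesian_product length_signed_word split_def intro!: sum.cong)
  have bound: "\<bar>b\<bar> < int (Suc n)" if "w \<in> signed_words E n" "b \<in> set (0 # w)" for w E b
  proof -
    have "abs ` set w \<subseteq> int ` {1..n}"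
      using that(1) by (simp add: signed_words_def)
    then show ?thesis using that(2) by fastforce
  qed
  have ins: "(\<Sum>i\<le>length w. f (descents (0 # insert_at (int (Suc n)) i w))) =
      of_nat (Suc (descents (0 # w))) * f (descents (0 # w)) +
      of_nat (n - descents (0 # w)) * f (Suc (descents (0 # w)))"
    "(\<Sum>i\<le>length w. f (descents (0 # insert_at (- int (Suc n)) i w))) =
      of_nat (descents (0 # w)) * f (descents (0 # w)) +
      of_nat (Suc n - descents (0 # w)) * f (Suc (descents (0 # w)))"
    if "w \<in> signed_words E n" for w E
    using sum_descents_insert_max[of 0 w "int (Suc n)" f]
      sum_descents_insert_min[of 0 w "- int (Suc n)" f] length_signed_word[OF that] bound[OF that]
    by (fastforce simp: abs_less_iff)+
  show ?A
    by (subst exp) (auto intro!: sum.cong simp: ins[simplified])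
  show ?B
  proof (subst exp)
    show "(\<Sum>w\<in>signed_words {1, -1} n. \<Sum>e\<in>{1, -1}. \<Sum>i\<le>length w.
        f (descents (0 # insert_at (e * int (Suc n)) i w))) =
     (\<Sum>w\<in>signed_words {1, -1} n.
        of_nat (2 * descents (0 # w) + 1) * f (descents (0 # w)) +
        of_nat (2 * n + 1 - 2 * descents (0 # w)) * f (Suc (descents (0 # w))))"
    proof (rule sum.cong)
      fix w assume w: "w \<in> signed_words {1, -1} n"
      \<comment> \<open>Splitting the truncated difference into the contributions of the two signs
        relies on the number of descents being at most n.\<close>
      have "2 * n + 1 - 2 * descents (0 # w) = (n - descents (0 # w)) + (Suc n - descents (0 # w))"
        using descents_le[of 0 w] length_signed_word[OF w] by simp
      then show "(\<Sum>e\<in>{1, -1}. \<Sum>i\<le>length w. f (descents (0 # insert_at (e * int (Suc n)) i w))) =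
        of_nat (2 * descents (0 # w) + 1) * f (descents (0 # w)) +
        of_nat (2 * n + 1 - 2 * descents (0 # w)) * f (Suc (descents (0 # w)))"
        by (simp only:) (simp add: ins[OF w, simplified] mult_2 algebra_simps)
    qed simp
  qed simp
qed

section \<open>Permutations and signed permutations in one-line notation\<close>

lemma map_upt_signed_words:
  assumes "inj_on (\<lambda>k. \<bar>f k\<bar>) {1..n}" and "(\<lambda>k. \<bar>f k\<bar>) ` {1..n} = int ` {1..n}"
    and "\<And>k. k \<in> {1..n} \<Longrightarrow> sgn (f k) \<in> E"
  shows "map f [1..<Suc n] \<in> signed_words E n"
proof -
  have set_upt: "set [1..<Suc n] = {1..n}" by auto
  have map_abs: "map abs (map f [1..<Suc n]) = map (\<lambda>k. \<bar>f k\<bar>) [1..<Suc n]"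
    by (simp only: map_map o_def)
  have "distinct (map (\<lambda>k. \<bar>f k\<bar>) [1..<Suc n])"
    using assms(1) unfolding distinct_map set_upt by simp
  moreover have "set (map (\<lambda>k. \<bar>f k\<bar>) [1..<Suc n]) = int ` {1..n}"
    unfolding set_map set_upt by (rule assms(2))
  moreover have "sgn ` set (map f [1..<Suc n]) \<subseteq> E"
    unfolding set_map set_upt using assms(3) by auto
  ultimately show ?thesis
    unfolding signed_words_def mem_Collect_eq map_abs by blast
qed

lemma permutes_signed_words:
  "bij_betw (\<lambda>\<pi>. map (int \<circ> \<pi>) [1..<Suc n]) {\<pi>. \<pi> permutes {1..n}} (signed_words {1} n)"
proof (rule bij_betw_imageI)
  let ?\<phi> = "\<lambda>\<pi>. map (int \<circ> \<pi>) [1..<Suc n]"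
  show "inj_on ?\<phi> {\<pi>. \<pi> permutes {1..n}}"
  proof (rule inj_onI, rule ext)
    fix \<pi> \<rho> i assume *: "\<pi> \<in> {\<pi>. \<pi> permutes {1..n}}" "\<rho> \<in> {\<pi>. \<pi> permutes {1..n}}"
      and eq: "?\<phi> \<pi> = ?\<phi> \<rho>"
    have "\<pi> i = \<rho> i" if "i \<in> {1..n}"
      using that eq by (simp add: map_eq_conv del: upt_Suc)
    then show "\<pi> i = \<rho> i"
      using * by (cases "i \<in> {1..n}") (simp_all add: permutes_not_in)
  qed
  show "?\<phi> ` {\<pi>. \<pi> permutes {1..n}} = signed_words {1} n"
  proof (intro subset_antisym subsetI)
    fix w assume "w \<in> ?\<phi> ` {\<pi>. \<pi> permutes {1..n}}"
    then obtain \<pi> where w: "w = ?\<phi> \<pi>" and \<pi>: "\<pi> permutes {1..n}" by auto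
    have "inj_on (\<lambda>k. \<bar>(int \<circ> \<pi>) k\<bar>) {1..n}"
      by (rule inj_onI) (simp add: inj_eq[OF permutes_inj[OF \<pi>]])
    moreover have "(\<lambda>k. \<bar>(int \<circ> \<pi>) k\<bar>) ` {1..n} = int ` {1..n}"
      using permutes_image[OF \<pi>] image_image[of int \<pi> "{1..n}"] by simp
    moreover have "\<pi> i > 0" if "i \<in> {1..n}" for i
      using permutes_in_image[OF \<pi>, of i] that by simp
    ultimately show "w \<in> signed_words {1} n"
      unfolding w by (intro map_upt_signed_words) simp_all
  next
    fix w assume w: "w \<in> signed_words {1} n"
    have len: "length w = n" by (rule length_signed_word[OF w])
    \<comment> \<open>List index i - 1 holds the value at i; outside [n] the function is the
      identity, as \<open>permutes\<close> demands.\<close>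
    define \<pi> where "\<pi> i = (if i \<in> {1..n} then nat (w ! (i - 1)) else i)" for i
    have pos: "v > 0" if "v \<in> set w" for v
      using w that by (auto simp: signed_words_def sgn_1_pos image_subset_iff)
    have "map abs w = w" using pos by (intro map_idI) (simp add: less_imp_le)
    then have dist: "distinct w" and setw: "set w = int ` {1..n}"
      using w by (simp_all add: signed_words_def del: set_map)
    have "inj_on \<pi> {1..n}"
    proof (rule inj_onI)
      fix i j assume ij: "i \<in> {1..n}" "j \<in> {1..n}" "\<pi> i = \<pi> j"
      then have "w ! (i - 1) = w ! (j - 1)"
        using pos[OF nth_mem, of "i - 1"] pos[OF nth_mem, of "j - 1"] len
        by (simp add: \<pi>_def) linarith
      then have "i - 1 = j - 1"
        using ij(1,2) len nth_eq_iff_index_eq[OF dist, of "i - 1" "j - 1"] by auto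
      then show "i = j" using ij(1,2) by auto
    qed
    moreover have "\<pi> i \<in> {1..n}" if "i \<in> {1..n}" for i
    proof -
      have "w ! (i - 1) \<in> int ` {1..n}"
        unfolding setw[symmetric] using that len by (intro nth_mem) auto
      then show ?thesis using that by (auto simp: \<pi>_def)
    qed
    ultimately have "\<pi> permutes {1..n}"
      by (intro bij_imp_permutes bij_betw_imageI endo_inj_surj) (auto simp: \<pi>_def)
    moreover have "w = ?\<phi> \<pi>"
      by (rule nth_equalityI) (use len pos in \<open>auto simp: \<pi>_def less_imp_le simp del: upt_Suc\<close>)
    ultimately show "w \<in> ?\<phi> ` {\<pi>. \<pi> permutes {1..n}}" by blast
  qed
qed

text \<open>Oddness makes the values at 1, ..., n determine the rest. Their absolute values are
  distinct: if those at i and j agree, then pi(i) is pi(j) or pi(-j), so i and j agree up to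
  sign.\<close>

lemma signed_perms_signed_words:
  "bij_betw (\<lambda>\<pi>. map (\<pi> \<circ> int) [1..<Suc n]) (signed_perms n) (signed_words {1, -1} n)"
proof (rule bij_betw_imageI)
  let ?\<phi> = "\<lambda>\<pi>. map (\<pi> \<circ> int) [1..<Suc n]"
  let ?S = "{- int n..int n} - {0}"
  have intcases: "(\<exists>k\<in>{1..n}. i = int k \<or> i = - int k)" if "i \<in> ?S" for i
    using that by (intro bexI[of _ "nat \<bar>i\<bar>"]) auto
  show "inj_on ?\<phi> (signed_perms n)"
  proof (rule inj_onI, rule ext)
    fix \<pi> \<rho> i assume *: "\<pi> \<in> signed_perms n" "\<rho> \<in> signed_perms n" "?\<phi> \<pi> = ?\<phi> \<rho>"
    then have "\<forall>k\<in>{1..n}. \<pi> (int k) = \<rho> (int k)"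
      by (auto simp: map_eq_conv simp del: upt_Suc)
    then have "\<pi> i = \<rho> i" if "i \<in> ?S"
      using intcases[OF that] * by (auto simp: signed_perms_def)
    then show "\<pi> i = \<rho> i"
      using * by (cases "i \<in> ?S") (auto simp: signed_perms_def permutes_not_in)
  qed
  show "?\<phi> ` signed_perms n = signed_words {1, -1} n"
  proof (intro subset_antisym subsetI)
    fix w assume "w \<in> ?\<phi> ` signed_perms n"
    then obtain \<pi> where w: "w = ?\<phi> \<pi>" and \<pi>: "\<pi> permutes ?S" and odd: "\<And>i. \<pi> (- i) = - \<pi> i"
      by (auto simp: signed_perms_def)
    have inj: "inj \<pi>" using \<pi> by (rule permutes_inj)
    have mem: "\<bar>\<pi> (int k)\<bar> \<in> int ` {1..n}" if "k \<in> {1..n}" for k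
    proof -
      have "\<pi> (int k) \<in> ?S" using that by (subst permutes_in_image[OF \<pi>]) auto
      then show ?thesis by (intro image_eqI[of _ _ "nat \<bar>\<pi> (int k)\<bar>"]) auto
    qed
    have inj_abs: "inj_on (\<lambda>k. \<bar>\<pi> (int k)\<bar>) {1..n}"
    proof (rule inj_onI)
      fix i j assume ij: "i \<in> {1..n}" "j \<in> {1..n}" "\<bar>\<pi> (int i)\<bar> = \<bar>\<pi> (int j)\<bar>"
      then have "\<pi> (int i) = \<pi> (int j) \<or> \<pi> (int i) = \<pi> (- int j)"
        by (auto simp: abs_eq_iff odd)
      then have "int i = int j \<or> int i = - int j" using inj by (simp add: inj_eq)
      then show "i = j" using ij by auto
    qed
    have "(\<lambda>k. \<bar>\<pi> (int k)\<bar>) ` {1..n} = int ` {1..n}"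
      by (intro card_subset_eq) (use mem card_image[OF inj_abs] in \<open>auto simp: card_image\<close>)
    moreover have "\<pi> (int k) \<noteq> 0" if "k \<in> {1..n}" for k
      using mem[OF that] by auto
    ultimately show "w \<in> signed_words {1, -1} n"
      unfolding w using inj_abs by (intro map_upt_signed_words) (simp_all add: sgn_if)
  next
    fix w assume w: "w \<in> signed_words {1, -1} n"
    have len: "length w = n" by (rule length_signed_word[OF w])
    \<comment> \<open>The factor sgn i extends the word oddly to negative arguments.\<close>
    define \<pi> where "\<pi> i = (if i \<in> ?S then sgn i * w ! (nat \<bar>i\<bar> - 1) else i)" for i
    have dist: "distinct (map abs w)" and setw: "abs ` set w = int ` {1..n}"
      using w by (simp_all add: signed_words_def)
    have abs_mem: "\<bar>w ! (nat \<bar>i\<bar> - 1)\<bar> \<in> int ` {1..n}" if "i \<in> ?S" for i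
    proof -
      have "w ! (nat \<bar>i\<bar> - 1) \<in> set w" using that len by (intro nth_mem) auto
      then show ?thesis unfolding setw[symmetric] by (rule imageI)
    qed
    have abs_\<pi>: "\<bar>\<pi> i\<bar> = \<bar>w ! (nat \<bar>i\<bar> - 1)\<bar>" if "i \<in> ?S" for i
      using that by (simp add: \<pi>_def abs_mult abs_sgn_eq)
    have "inj_on \<pi> ?S"
    proof (rule inj_onI)
      fix i j assume ij: "i \<in> ?S" "j \<in> ?S" "\<pi> i = \<pi> j"
      have lt: "nat \<bar>i\<bar> - 1 < length w" "nat \<bar>j\<bar> - 1 < length w"
        using ij(1,2) len by auto
      then have "map abs w ! (nat \<bar>i\<bar> - 1) = map abs w ! (nat \<bar>j\<bar> - 1)"
        using ij(3) abs_\<pi>[OF ij(1)] abs_\<pi>[OF ij(2)] by simp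
      then have "nat \<bar>i\<bar> - 1 = nat \<bar>j\<bar> - 1"
        using lt by (simp only: nth_eq_iff_index_eq[OF dist] length_map)
      then have "\<bar>i\<bar> = \<bar>j\<bar>" using ij by auto
      moreover have "w ! (nat \<bar>i\<bar> - 1) \<noteq> 0" using abs_mem[OF ij(1)] by auto
      ultimately have "sgn i = sgn j" "\<bar>i\<bar> = \<bar>j\<bar>" using ij by (auto simp: \<pi>_def)
      then show "i = j" by (metis sgn_mult_abs)
    qed
    moreover have "\<pi> i \<in> ?S" if "i \<in> ?S" for i
      using abs_mem[OF that] abs_\<pi>[OF that] by (auto simp: image_iff abs_if split: if_splits)
    ultimately have "\<pi> permutes ?S"
      by (intro bij_imp_permutes bij_betw_imageI endo_inj_surj) (auto simp: \<pi>_def)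
    then have "\<pi> \<in> signed_perms n"
      by (auto simp: signed_perms_def \<pi>_def)
    moreover have "w = ?\<phi> \<pi>"
      by (rule nth_equalityI) (use len in \<open>auto simp: \<pi>_def nat_add_distrib simp del: upt_Suc\<close>)
    ultimately show "w \<in> ?\<phi> ` signed_perms n" by blast
  qed
qed

lemma descents_map_upt:
  assumes "f 0 = 0"
  shows "descents (0 # map f [1..<Suc n]) = card {i. i < n \<and> f i > f (Suc i)}"
proof -
  have "0 # map f [1..<Suc n] = map f [0..<Suc n]"
    using assms by (simp add: upt_conv_Cons del: upt_Suc)
  then show ?thesis
    unfolding descents_eq_card by (rule ssubst) (rule arg_cong[where f = card], auto simp del: upt_Suc)
qed

lemma card_bij_betw_statistic:
  assumes "bij_betw \<phi> A B" and "\<And>a. a \<in> A \<Longrightarrow> P a \<longleftrightarrow> Q (\<phi> a)"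
  shows "card {a \<in> A. P a} = card {b \<in> B. Q b}"
proof (rule bij_betw_same_card[of \<phi>])
  show "bij_betw \<phi> {a \<in> A. P a} {b \<in> B. Q b}"
    using assms unfolding bij_betw_def inj_on_def by auto
qed

lemma eulerian_eq_card: "eulerian n k = card {w \<in> signed_words {1} n. descents (0 # w) = k}"
proof -
  have "descents (0 # map (int \<circ> \<pi>) [1..<Suc n]) = card {i \<in> {1..<n}. \<pi> i > \<pi> (i + 1)}"
    if "\<pi> permutes {1..n}" for \<pi>
  proof -
    have "\<pi> 0 = 0" using that by (simp add: permutes_not_in)
    \<comment> \<open>Index 0 drops out: pi(0) = 0 exceeds no value, so the leading 0 contributes no
      descent.\<close>
    then have "{i. i < n \<and> (int \<circ> \<pi>) i > (int \<circ> \<pi>) (Suc i)} = {i \<in> {1..<n}. \<pi> i > \<pi> (i + 1)}"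
      by (auto simp: Suc_le_eq intro: ccontr)
    then show ?thesis using \<open>\<pi> 0 = 0\<close> by (subst descents_map_upt) simp_all
  qed
  then show ?thesis
    unfolding eulerian_def using card_bij_betw_statistic[OF permutes_signed_words[of n]] by simp
qed

lemma eulerian_B_eq_card:
  "eulerian_B n k = card {w \<in> signed_words {1, -1} n. descents (0 # w) = k}"
proof -
  have "descents (0 # map (\<pi> \<circ> int) [1..<Suc n]) = des_B n \<pi>" if "\<pi> \<in> signed_perms n" for \<pi>
  proof -
    have "\<pi> 0 = 0" using that by (auto simp: signed_perms_def permutes_not_in)
    moreover have "{i \<in> {1..int n}. \<pi> (i - 1) > \<pi> i} =
        (\<lambda>i. int (Suc i)) ` {i. i < n \<and> (\<pi> \<circ> int) i > (\<pi> \<circ> int) (Suc i)}"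
    proof (intro subset_antisym subsetI)
      fix i assume "i \<in> {i \<in> {1..int n}. \<pi> (i - 1) > \<pi> i}"
      then show "i \<in> (\<lambda>i. int (Suc i)) ` {i. i < n \<and> (\<pi> \<circ> int) i > (\<pi> \<circ> int) (Suc i)}"
        by (intro image_eqI[of _ _ "nat (i - 1)"]) auto
    qed auto
    ultimately show ?thesis
      unfolding des_B_def by (subst descents_map_upt) (simp_all only:, auto simp: card_image inj_on_def)
  qed
  then show ?thesis
    unfolding eulerian_B_def
    using card_bij_betw_statistic[OF signed_perms_signed_words[of n]] by simp
qed

section \<open>Grammars counting descents\<close>

text \<open>The weight x^(2(n-k)+1) y^(2k+1) has the two insertion counts as its exponents: a letter
  x gains y^2 and stands for an insertion that raises k, a letter y gains x^2 and stands for one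
  that preserves k.\<close>

lemma eulerian_B_grammar:
  assumes D: "formal_derivative (\<x> * \<y>^2) (\<x>^2 * \<y>) D"
  shows "(D ^^ n) (\<x> * \<y>) =
    \<x> * \<y> * (\<Sum>k=0..n. of_nat (eulerian_B n k) * \<x>^(2*n - 2*k) * \<y>^(2*k))"
proof -
  have D': "formal_derivative (\<x> * \<y>^2) (\<y> * \<x>^2) D"
    using D by (simp only: mult.commute[of \<y>])
  let ?m = "\<lambda>n k. \<x> * \<y> * (\<x> ^ (2 * n - 2 * k) * \<y> ^ (2 * k))"
  let ?S = "signed_words {1, -1}"
  have le: "descents (0 # w) \<le> n" if "w \<in> ?S n" for w n
    using descents_le[of 0 w] length_signed_word[OF that] by simp
  have "D (?m n k) = of_nat (2 * k + 1) * ?m (Suc n) k + of_nat (2 * n + 1 - 2 * k) * ?m (Suc n) (Suc k)"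
    if k: "k \<le> n" for n k
  proof -
    obtain j where n: "n = k + j" using le_Suc_ex[OF k] by auto
    have "?m n k = \<x> ^ Suc (2 * j) * \<y> ^ Suc (2 * k)"
      by (simp add: n algebra_simps)
    then have "D (?m n k) = \<x> ^ Suc (2 * j) * \<y> ^ Suc (2 * k) *
        (of_nat (Suc (2 * j)) * \<y>\<^sup>2 + of_nat (Suc (2 * k)) * \<x>\<^sup>2)"
      by (simp only: formal_derivative_monomial[OF D'])
    also have "\<dots> = of_nat (2 * k + 1) * ?m (Suc n) k +
        of_nat (2 * n + 1 - 2 * k) * ?m (Suc n) (Suc k)"
      by (simp add: n power_add power2_eq_square algebra_simps)
    finally show ?thesis .
  qed
  then have "(D ^^ n) (\<Sum>w\<in>?S 0. ?m 0 (descents (0 # w))) = (\<Sum>w\<in>?S n. ?m n (descents (0 # w)))"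
    by (intro funpow_formal_derivative_weights[where S = ?S and m = ?m
          and st = "\<lambda>_ w. descents (0 # w)" and \<alpha> = "\<lambda>n k. 2 * k + 1"
          and \<beta> = "\<lambda>n k. 2 * n + 1 - 2 * k", OF D sum_signed_words_Suc(2)]) (simp_all only: le)
  also have "\<dots> = (\<Sum>k=0..n. of_nat (eulerian_B n k) * ?m n k)"
    unfolding eulerian_B_eq_card
    by (intro sum_by_statistic finite_signed_words) (use le in auto)
  finally show ?thesis
    by (simp add: signed_words_0 sum_distrib_left algebra_simps)
qed

lemma signed_words_1: "signed_words {1} (Suc 0) = {[1]}"
  using bij_betw_imp_surj_on[OF signed_words_Suc[of "{1}" 0]] by (simp add: signed_words_0)

text \<open>The first letter is positive, so the leading 0 starts no descent; this saves one against
  the general bound \<open>descents_le\<close>.\<close>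

lemma descents_positive_word_le:
  assumes w: "w \<in> signed_words {1} (Suc n)"
  shows "descents (0 # w) \<le> n"
proof -
  have pos: "v > 0" if "v \<in> set w" for v
    using w that by (auto simp: signed_words_def sgn_1_pos image_subset_iff)
  obtain a u where "w = a # u" "length u = n"
    using length_signed_word[OF w] by (auto simp: length_Suc_conv)
  then show ?thesis
    using pos[of a] descents_le[of a u] by simp
qed

lemma sum_eulerian:
  "(\<Sum>w\<in>signed_words {1} (Suc n). f (descents (0 # w))) =
   (\<Sum>k=0..n. of_nat (eulerian (Suc n) k) * f k)"
  unfolding eulerian_eq_card
  by (intro sum_by_statistic finite_signed_words) (use descents_positive_word_le in auto)

text \<open>The exponents 2(n-k+1) and 2(k+1) are twice the insertion counts for permutations of n +
  1 elements; the doubling at each step is collected in 2^n.\<close>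

lemma eulerian_grammar:
  assumes D: "formal_derivative (\<x> * \<y>^2) (\<x>^2 * \<y>) D"
  shows "(D ^^ n) (\<x>^2 * \<y>^2) =
    2^n * \<x>^2 * \<y>^2 * (\<Sum>k=0..n. of_nat (eulerian (n + 1) k) * \<x>^(2*n - 2*k) * \<y>^(2*k))"
proof -
  have D': "formal_derivative (\<x> * \<y>^2) (\<y> * \<x>^2) D"
    using D by (simp only: mult.commute[of \<y>])
  let ?m = "\<lambda>n k. 2 ^ n * (\<x> ^ 2 * \<y> ^ 2 * (\<x> ^ (2 * n - 2 * k) * \<y> ^ (2 * k)))"
  \<comment> \<open>Sizes are shifted by one: the start x^2 y^2 is the weight of the only
    permutation of [1].\<close>
  let ?S = "\<lambda>n. signed_words {1} (Suc n)"
  have "D (?m n k) = of_nat (Suc k) * ?m (Suc n) k + of_nat (Suc n - k) * ?m (Suc n) (Suc k)"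
    if k: "k \<le> n" for n k
  proof -
    obtain j where n: "n = k + j" using le_Suc_ex[OF k] by auto
    have "?m n k = of_nat (2 ^ n) * (\<x> ^ (2 * Suc j) * \<y> ^ (2 * Suc k))"
      by (simp add: n power2_eq_square algebra_simps)
    then have "D (?m n k) = of_nat (2 ^ n) * (\<x> ^ (2 * Suc j) * \<y> ^ (2 * Suc k) *
        (of_nat (2 * Suc j) * \<y>\<^sup>2 + of_nat (2 * Suc k) * \<x>\<^sup>2))"
      by (simp only: formal_derivative_monomial[OF D'] formal_derivative_of_nat_mult[OF D])
    also have "\<dots> = of_nat (Suc k) * ?m (Suc n) k + of_nat (Suc n - k) * ?m (Suc n) (Suc k)"
      by (simp add: n Suc_diff_le power_add power2_eq_square algebra_simps)
    finally show ?thesis .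
  qed
  then have "(D ^^ n) (\<Sum>w\<in>?S 0. ?m 0 (descents (0 # w))) = (\<Sum>w\<in>?S n. ?m n (descents (0 # w)))"
    by (intro funpow_formal_derivative_weights[where S = ?S and m = ?m
          and st = "\<lambda>_ w. descents (0 # w)" and \<alpha> = "\<lambda>n k. Suc k"
          and \<beta> = "\<lambda>n k. Suc n - k", OF D sum_signed_words_Suc(1)])
      (simp_all only: descents_positive_word_le)
  also have "\<dots> = (\<Sum>k=0..n. of_nat (eulerian (Suc n) k) * ?m n k)"
    by (rule sum_eulerian)
  finally show ?thesis
    by (simp add: signed_words_1 sum_distrib_left algebra_simps)
qed

text \<open>The letters of x^(k+1) give the k + 1 insertions that preserve k. The exponent 2(n-k) of
  y is twice the number of those that raise it, and the factor 2 turns 2^k into 2^(k+1).\<close>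

lemma eulerian_grammar_half:
  assumes D: "formal_derivative (\<x> * \<y>^2) (\<x> * \<y>) D" and "n \<ge> 1"
  shows "(D ^^ n) \<x> =
    \<x> * (\<Sum>k=0..n - 1. 2^k * of_nat (eulerian n k) * \<x>^k * \<y>^(2*n - 2*k))"
proof -
  have D': "formal_derivative (\<x> * \<y>^2) (\<y> * \<x>) D"
    using D by (simp only: mult.commute[of \<y>])
  let ?m = "\<lambda>n k. 2 ^ k * (\<x> * \<x> ^ k * \<y> ^ (2 * n - 2 * k))"
  let ?S = "\<lambda>n. signed_words {1} n"
  have le: "descents (0 # w) \<le> n" if "w \<in> ?S n" for w n
    using descents_le[of 0 w] length_signed_word[OF that] by simp
  have "D (?m n k) = of_nat (Suc k) * ?m (Suc n) k + of_nat (n - k) * ?m (Suc n) (Suc k)"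
    if k: "k \<le> n" for n k
  proof -
    obtain j where n: "n = k + j" using le_Suc_ex[OF k] by auto
    have "?m n k = of_nat (2 ^ k) * (\<x> ^ Suc k * \<y> ^ (2 * j))"
      by (simp add: n)
    then have "D (?m n k) = of_nat (2 ^ k) * (\<x> ^ Suc k * \<y> ^ (2 * j) *
        (of_nat (Suc k) * \<y>\<^sup>2 + of_nat (2 * j) * \<x>))"
      by (simp only: formal_derivative_monomial[OF D'] formal_derivative_of_nat_mult[OF D])
    also have "\<dots> = of_nat (Suc k) * ?m (Suc n) k + of_nat (n - k) * ?m (Suc n) (Suc k)"
      by (simp add: n power_add power2_eq_square algebra_simps)
    finally show ?thesis .
  qed
  then have "(D ^^ n) (\<Sum>w\<in>?S 0. ?m 0 (descents (0 # w))) = (\<Sum>w\<in>?S n. ?m n (descents (0 # w)))"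
    by (intro funpow_formal_derivative_weights[where S = ?S and m = ?m
          and st = "\<lambda>_ w. descents (0 # w)" and \<alpha> = "\<lambda>n k. Suc k"
          and \<beta> = "\<lambda>n k. n - k", OF D sum_signed_words_Suc(1)]) (simp_all only: le)
  \<comment> \<open>For n >= 1 the value k = n is not attained, as the first letter makes no descent
    with the leading 0.\<close>
  also have "\<dots> = (\<Sum>k=0..n - 1. of_nat (eulerian n k) * ?m n k)"
    using sum_eulerian[of "?m n" "n - 1"] \<open>n \<ge> 1\<close> by simp
  finally show ?thesis
    by (simp add: signed_words_0 sum_distrib_left algebra_simps)
qed

section \<open>Perfect matchings\<close>

lemma perfect_matchings_edge:
  assumes "M \<in> perfect_matchings S" and "e \<in> M"
  obtains a b where "a < b" "e = {a, b}" "a \<in> S" "b \<in> S"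
proof -
  have "card e = 2" "e \<subseteq> S"
    using assms by (auto simp: perfect_matchings_def partition_on_def)
  then show ?thesis
    using that by (auto simp: card_2_iff) (metis insert_commute linorder_neqE_nat)
qed

lemma perfect_matchings_disjoint:
  "\<lbrakk>M \<in> perfect_matchings S; e \<in> M; e' \<in> M; e \<noteq> e'\<rbrakk> \<Longrightarrow> e \<inter> e' = {}"
  by (auto simp: perfect_matchings_def partition_on_def disjoint_def)

lemma perfect_matchings_unique:
  assumes "M \<in> perfect_matchings S" and "{a, b} \<in> M" and "{a, c} \<in> M"
  shows "b = c"
proof -
  have "{a, b} = {a, c}" using perfect_matchings_disjoint[OF assms] by blast
  then show ?thesis by (auto simp: doubleton_eq_iff)
qed

lemma perfect_matchings_partner:
  assumes "M \<in> perfect_matchings S" and "a \<in> S"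
  obtains b where "{a, b} \<in> M" "b \<in> S" "b \<noteq> a"
proof -
  obtain e where e: "e \<in> M" "a \<in> e"
    using assms by (auto simp: perfect_matchings_def partition_on_def)
  obtain c d where "c < d" "e = {c, d}" "c \<in> S" "d \<in> S"
    using perfect_matchings_edge[OF assms(1) e(1)] .
  then show ?thesis using e that[of c] that[of d] by (auto simp: insert_commute)
qed

lemma perfect_matchings_insert:
  assumes "M \<in> perfect_matchings S" and "a \<noteq> b" and "a \<notin> S" and "b \<notin> S"
  shows "insert {a, b} M \<in> perfect_matchings (insert a (insert b S))" and "{a, b} \<notin> M"
proof -
  have "\<forall>e\<in>M. e \<subseteq> S" using assms(1) by (auto simp: perfect_matchings_def partition_on_def)
  then show "{a, b} \<notin> M" using assms by auto
  show "insert {a, b} M \<in> perfect_matchings (insert a (insert b S))"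
    using assms by (auto simp: perfect_matchings_def partition_on_def disjoint_def)
qed

lemma perfect_matchings_remove:
  assumes M: "M \<in> perfect_matchings S" and ab: "{a, b} \<in> M"
  shows "M - {{a, b}} \<in> perfect_matchings (S - {a, b})" and "a \<noteq> b" "a \<in> S" "b \<in> S"
proof -
  show ab': "a \<noteq> b" "a \<in> S" "b \<in> S"
    using assms by (auto simp: perfect_matchings_def partition_on_def)
  have "\<Union>(M - {{a, b}}) = S - {a, b}"
  proof -
    have "\<Union>M = S" using M by (simp add: perfect_matchings_def partition_on_def)
    moreover have "e \<inter> {a, b} = {}" if "e \<in> M - {{a, b}}" for e
      using perfect_matchings_disjoint[OF M _ ab, of e] that by auto
    ultimately show ?thesis by blast
  qed
  then show "M - {{a, b}} \<in> perfect_matchings (S - {a, b})"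
    using M by (auto simp: perfect_matchings_def partition_on_def disjoint_def)
qed

lemma finite_perfect_matching:
  assumes "finite S" and "M \<in> perfect_matchings S"
  shows "finite M"
  using assms by (auto simp: perfect_matchings_def partition_on_def intro: finite_UnionD)

lemma finite_perfect_matchings: "finite S \<Longrightarrow> finite (perfect_matchings S)"
  by (rule finite_subset[of _ "Pow (Pow S)"]) (auto simp: perfect_matchings_def partition_on_def)

section \<open>Matchings counted by odd minima\<close>

definition odd_minima :: "nat set set \<Rightarrow> nat" where
  "odd_minima M = card {e \<in> M. odd (Min e)}"

lemma odd_minima_insert:
  "finite M \<Longrightarrow> e \<notin> M \<Longrightarrow> odd_minima (insert e M) = of_bool (odd (Min e)) + odd_minima M"
proof -
  assume M: "finite M" "e \<notin> M"
  have "{e' \<in> insert e M. odd (Min e')} =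
      (if odd (Min e) then insert e else id) {e' \<in> M. odd (Min e')}" by auto
  then show ?thesis using M by (simp add: odd_minima_def)
qed

text \<open>
  The edges at the two new points \<open>p\<close>, \<open>q\<close> are obtained by splitting an old edge \<open>{a, b}\<close>, unless \<open>p\<close>
  and \<open>q\<close> are matched with each other.
\<close>

definition split_edge :: "nat \<Rightarrow> nat \<Rightarrow> nat set set \<Rightarrow> nat \<times> nat \<Rightarrow> nat set set" where
  "split_edge p q M = (\<lambda>(a, b). insert {a, p} (insert {b, q} (M - {{a, b}})))"

text \<open>The partners a of p and b of q recover the split edge. The pair (a, b) is ordered, so
  each old edge is split in two ways.\<close>

lemma split_edge_bij:
  assumes pq: "p \<noteq> q" "p \<notin> S" "q \<notin> S"
  shows "bij_betw (\<lambda>(M, c). split_edge p q M c)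
    (SIGMA M:perfect_matchings S. {(a, b). {a, b} \<in> M})
    {M \<in> perfect_matchings (insert p (insert q S)). {p, q} \<notin> M}" (is "bij_betw ?f ?A ?B")
proof (rule bij_betw_imageI)
  \<comment> \<open>The second conjunct undoes the splitting; injectivity follows from it once a and
    b are known.\<close>
  have mem: "split_edge p q M (a, b) \<in> ?B \<and>
      M = insert {a, b} (split_edge p q M (a, b) - {{a, p}, {b, q}})"
    if M: "M \<in> perfect_matchings S" and ab: "{a, b} \<in> M" for M a b
  proof -
    note rem = perfect_matchings_remove[OF M ab]
    have 1: "insert {b, q} (M - {{a, b}}) \<in> perfect_matchings (insert b (insert q (S - {a, b})))"
      and n1: "{b, q} \<notin> M - {{a, b}}"
      using rem pq perfect_matchings_remove(4)[OF M, of b q] by (auto intro!: perfect_matchings_insert)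
    have 2: "insert {a, p} (insert {b, q} (M - {{a, b}})) \<in>
        perfect_matchings (insert a (insert p (insert b (insert q (S - {a, b})))))"
      and n2: "{a, p} \<notin> insert {b, q} (M - {{a, b}})"
      using rem pq perfect_matchings_insert[OF 1, of a p] by auto
    have "insert a (insert p (insert b (insert q (S - {a, b})))) = insert p (insert q S)"
      using rem by auto
    moreover have "{p, q} \<notin> insert {a, p} (insert {b, q} (M - {{a, b}}))"
      using rem pq M by (auto simp: doubleton_eq_iff perfect_matchings_def partition_on_def)
    ultimately show ?thesis
      using 2 n1 n2 ab by (auto simp: split_edge_def)
  qed
  show "inj_on ?f ?A"
  proof (rule inj_onI)
    fix u v assume u: "u \<in> ?A" and v: "v \<in> ?A" and eq: "?f u = ?f v"
    obtain M a b where M: "u = (M, a, b)" "M \<in> perfect_matchings S" "{a, b} \<in> M" using u by auto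
    obtain M' a' b' where M': "v = (M', a', b')" "M' \<in> perfect_matchings S" "{a', b'} \<in> M'"
      using v by auto
    let ?N = "split_edge p q M (a, b)"
    have eq': "?N = split_edge p q M' (a', b')" using eq by (simp add: M M')
    have N: "?N \<in> perfect_matchings (insert p (insert q S))" using mem[OF M(2,3)] by simp
    have "{p, a} \<in> ?N" "{q, b} \<in> ?N" by (auto simp: split_edge_def insert_commute)
    moreover have "{p, a'} \<in> ?N" "{q, b'} \<in> ?N"
      unfolding eq' by (auto simp: split_edge_def insert_commute)
    ultimately have "a = a'" "b = b'" using perfect_matchings_unique[OF N] by blast+
    then show "u = v"
      using mem[OF M(2,3)] mem[OF M'(2,3)] eq' by (simp add: M(1) M'(1))
  qed
  show "?f ` ?A = ?B"
  proof (intro subset_antisym subsetI)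
    fix N assume "N \<in> ?f ` ?A"
    then show "N \<in> ?B" using mem by auto
  next
    fix N assume "N \<in> ?B"
    then have N: "N \<in> perfect_matchings (insert p (insert q S))" and npq: "{p, q} \<notin> N" by auto
    obtain a where a: "{p, a} \<in> N" using perfect_matchings_partner[OF N, of p] by blast
    obtain b where b: "{q, b} \<in> N" using perfect_matchings_partner[OF N, of q] by blast
    note ra = perfect_matchings_remove[OF N a]
    have neq: "{q, b} \<noteq> {p, a}" using npq a b pq by (auto simp: doubleton_eq_iff insert_commute)
    have b': "{q, b} \<in> N - {{p, a}}" using b neq by auto
    note rb = perfect_matchings_remove[OF ra(1) b']
    have "{p, a} \<inter> {q, b} = {}" using perfect_matchings_disjoint[OF N a b] neq by auto
    then have ab: "a \<noteq> b" "a \<noteq> q" "b \<noteq> p" "a \<noteq> p" "b \<noteq> q" "a \<in> S" "b \<in> S"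
      using ra rb by auto
    let ?M = "N - {{p, a}} - {{q, b}}"
    have "insert {a, b} ?M \<in> perfect_matchings (insert a (insert b (insert p (insert q S) - {p, a} - {q, b})))"
      and new: "{a, b} \<notin> ?M"
      using perfect_matchings_insert[OF rb(1), of a b] ab by auto
    moreover have "insert a (insert b (insert p (insert q S) - {p, a} - {q, b})) = S"
      using ab pq by auto
    ultimately have "insert {a, b} ?M \<in> perfect_matchings S" by simp
    moreover have "split_edge p q (insert {a, b} ?M) (a, b) = N"
      using a b new by (auto simp: split_edge_def insert_commute)
    ultimately show "N \<in> ?f ` ?A"
      by (intro image_eqI[of _ _ "(insert {a, b} ?M, (a, b))"]) auto
  qed
qed

lemma insert_edge_bij:
  assumes pq: "p \<noteq> q" "p \<notin> S" "q \<notin> S"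
  shows "bij_betw (insert {p, q}) (perfect_matchings S)
    {M \<in> perfect_matchings (insert p (insert q S)). {p, q} \<in> M}"
proof (rule bij_betw_byWitness[where f' = "\<lambda>M. M - {{p, q}}"])
  show "\<forall>M\<in>perfect_matchings S. insert {p, q} M - {{p, q}} = M"
    using perfect_matchings_insert(2)[OF _ pq] by auto
  show "insert {p, q} ` perfect_matchings S \<subseteq>
      {M \<in> perfect_matchings (insert p (insert q S)). {p, q} \<in> M}"
    using perfect_matchings_insert(1)[OF _ pq] by auto
  have "insert p (insert q S) - {p, q} = S" using pq by auto
  then show "(\<lambda>M. M - {{p, q}}) ` {M \<in> perfect_matchings (insert p (insert q S)). {p, q} \<in> M} \<subseteq>
      perfect_matchings S"
    using perfect_matchings_remove(1)[of _ "insert p (insert q S)" p q] by auto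
qed auto

text \<open>Every point is the minimum or the maximum of exactly one edge, so a sum over the points
  splits edge by edge. Apply this to the constant 1 and to the indicator of odd numbers, of which
  there are n.\<close>

lemma odd_elements_matching:
  assumes M: "M \<in> perfect_matchings {1..2 * n}"
  shows "card M = n" and "odd_minima M + card {e \<in> M. odd (Max e)} = n"
proof -
  have fin: "finite M" using finite_perfect_matching[OF _ M] by simp
  have S: "\<Union>M = {1..2 * n}" using M by (simp add: perfect_matchings_def partition_on_def)
  have sums: "(\<Sum>i=1..2 * n. h i) = (\<Sum>e\<in>M. h (Min e) + h (Max e))" for h :: "nat \<Rightarrow> nat"
  proof -
    have "(\<Sum>i\<in>\<Union>M. h i) = (\<Sum>e\<in>M. \<Sum>i\<in>e. h i)"
      using M perfect_matchings_disjoint[OF M]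
      by (subst sum.Union_disjoint) (auto simp: perfect_matchings_def card_ge_0_finite)
    also have "\<dots> = (\<Sum>e\<in>M. h (Min e) + h (Max e))"
    proof (rule sum.cong)
      fix e assume "e \<in> M"
      then obtain a b where "a < b" "e = {a, b}" using perfect_matchings_edge[OF M] by metis
      then show "(\<Sum>i\<in>e. h i) = h (Min e) + h (Max e)" by simp
    qed simp
    finally show ?thesis by (simp only: S)
  qed
  show "card M = n" using sums[of "\<lambda>_. 1"] by simp
  have "(\<Sum>i=1..2 * n. of_bool (odd i)) = n" by (induction n) auto
  then show "odd_minima M + card {e \<in> M. odd (Max e)} = n"
    using sums[of "\<lambda>i. of_bool (odd i)"] fin
    by (simp add: sum.distrib odd_minima_def sum.If_cases of_bool_def Int_def)
qed

text \<open>Matching the new points with each other adds the odd minimum 2n + 1. Splitting {a, b}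
  makes both a and b minima, so the count rises exactly if the larger one is odd. With k odd minima,
  n - k maxima are odd and k are even, and each edge is split in two ways: 2(n-k) + 1 extensions
  raise k and 2k preserve it.\<close>

lemma sum_perfect_matchings_Suc:
  fixes f :: "nat \<Rightarrow> 'a::comm_semiring_1"
  shows "(\<Sum>M\<in>perfect_matchings {1..2 * Suc n}. f (odd_minima M)) =
    (\<Sum>M\<in>perfect_matchings {1..2 * n}.
       of_nat (2 * odd_minima M) * f (odd_minima M) +
       of_nat (2 * n + 1 - 2 * odd_minima M) * f (Suc (odd_minima M)))"
proof -
  let ?S = "{1..2 * n}" and ?p = "2 * n + 1" and ?q = "2 * n + 2"
  let ?P = "perfect_matchings ?S"
  let ?Q = "perfect_matchings (insert ?p (insert ?q ?S))"
  have pq: "?p \<noteq> ?q" "?p \<notin> ?S" "?q \<notin> ?S" by auto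
  have "{1..2 * Suc n} = insert ?p (insert ?q ?S)" by auto
  then have "(\<Sum>M\<in>perfect_matchings {1..2 * Suc n}. f (odd_minima M)) =
     (\<Sum>M\<in>{M \<in> ?Q. {?p, ?q} \<in> M} \<union> {M \<in> ?Q. {?p, ?q} \<notin> M}. f (odd_minima M))"
    by (intro sum.cong) auto
  also have "\<dots> = (\<Sum>M\<in>{M \<in> ?Q. {?p, ?q} \<in> M}. f (odd_minima M)) +
      (\<Sum>M\<in>{M \<in> ?Q. {?p, ?q} \<notin> M}. f (odd_minima M))"
    by (intro sum.union_disjoint) (auto intro: finite_subset[OF _ finite_perfect_matchings])
  also have "(\<Sum>M\<in>{M \<in> ?Q. {?p, ?q} \<in> M}. f (odd_minima M)) = (\<Sum>M\<in>?P. f (Suc (odd_minima M)))"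
  proof (subst sum.reindex_bij_betw[OF insert_edge_bij[OF pq], symmetric], intro sum.cong refl)
    fix M assume M: "M \<in> ?P"
    show "f (odd_minima (insert {?p, ?q} M)) = f (Suc (odd_minima M))"
      using finite_perfect_matching[OF _ M] perfect_matchings_insert(2)[OF M pq]
      by (simp add: odd_minima_insert)
  qed
  also have "(\<Sum>M\<in>{M \<in> ?Q. {?p, ?q} \<notin> M}. f (odd_minima M)) =
      (\<Sum>M\<in>?P. \<Sum>c\<in>{(a, b). {a, b} \<in> M}. f (odd_minima (split_edge ?p ?q M c)))"
  proof (subst sum.reindex_bij_betw[OF split_edge_bij[OF pq], symmetric], subst sum.Sigma)
    have "{(a, b). {a, b} \<in> M} \<subseteq> ?S \<times> ?S" if "M \<in> ?P" for M
      using perfect_matchings_remove[OF that] by auto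
    then show "\<forall>M\<in>?P. finite {(a, b). {a, b} \<in> M}"
      by (meson finite_SigmaI finite_atLeastAtMost finite_subset)
  qed (auto simp: finite_perfect_matchings intro!: sum.cong)
  also have "\<dots> = (\<Sum>M\<in>?P. of_nat (2 * odd_minima M) * f (odd_minima M) +
       of_nat (2 * (n - odd_minima M)) * f (Suc (odd_minima M)))"
  proof (intro sum.cong refl)
    fix M assume M: "M \<in> ?P"
    have fin: "finite M" using finite_perfect_matching[OF _ M] by simp
    \<comment> \<open>The new points exceed a and b, so the two new edges have minima a and b; the
      smaller of them was already counted.\<close>
    have old: "odd_minima (split_edge ?p ?q M (a, b)) = odd_minima M + of_bool (odd (max a b))"
      if ab: "{a, b} \<in> M" for a b
    proof -
      note rem = perfect_matchings_remove[OF M ab]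
      have S: "\<Union>M = ?S" using M by (simp add: perfect_matchings_def partition_on_def)
      have new: "{b, ?q} \<notin> M - {{a, b}}" "{a, ?p} \<notin> insert {b, ?q} (M - {{a, b}})"
        using rem perfect_matchings_remove(4)[OF M, of b ?q] perfect_matchings_remove(4)[OF M, of a ?p]
        by (auto simp: doubleton_eq_iff)
      have "odd_minima (split_edge ?p ?q M (a, b)) =
          of_bool (odd a) + (of_bool (odd b) + odd_minima (M - {{a, b}}))"
        using fin new rem by (simp add: split_edge_def odd_minima_insert)
      moreover have "odd_minima M = of_bool (odd (min a b)) + odd_minima (M - {{a, b}})"
        using odd_minima_insert[of "M - {{a, b}}" "{a, b}"] fin ab by (simp add: insert_absorb)
      ultimately show ?thesis by (simp add: min_def max_def)
    qed
    have edge: "e = {Min e, Max e} \<and> Min e < Max e" if "e \<in> M" for e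
    proof -
      obtain a b where "a < b" "e = {a, b}" using perfect_matchings_edge[OF M \<open>e \<in> M\<close>] .
      then show ?thesis by simp
    qed
    let ?u = "\<lambda>e. (Min e, Max e :: nat)" and ?v = "\<lambda>e. (Max e, Min e :: nat)"
    have inj: "inj_on ?u M" "inj_on ?v M"
      using edge by (auto intro!: inj_onI) (metis)+
    have disj: "?u ` M \<inter> ?v ` M = {}"
    proof (rule equals0I)
      fix c assume "c \<in> ?u ` M \<inter> ?v ` M"
      then obtain e e' where "e \<in> M" "e' \<in> M" "Min e = Max e'" "Max e = Min e'" by auto
      then show False using edge[of e] edge[of e'] by (metis less_asym)
    qed
    have pairs: "{(a, b). {a, b} \<in> M} = ?u ` M \<union> ?v ` M"
    proof (intro subset_antisym subsetI)
      fix c assume "c \<in> {(a, b). {a, b} \<in> M}"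
      then obtain a b where c: "c = (a, b)" "{a, b} \<in> M" by auto
      then have "a \<noteq> b" using perfect_matchings_remove(2)[OF M] by auto
      then show "c \<in> ?u ` M \<union> ?v ` M"
        using c by (cases "a < b") (auto intro!: rev_image_eqI[of "{a, b}"])
    next
      fix c assume "c \<in> ?u ` M \<union> ?v ` M"
      then show "c \<in> {(a, b). {a, b} \<in> M}" using edge by (auto simp: insert_commute)
    qed
    have "(\<Sum>c\<in>{(a, b). {a, b} \<in> M}. f (odd_minima (split_edge ?p ?q M c))) =
      (\<Sum>e\<in>M. f (odd_minima (split_edge ?p ?q M (?u e)))) + (\<Sum>e\<in>M. f (odd_minima (split_edge ?p ?q M (?v e))))"
      unfolding pairs using fin
      by (simp only: sum.union_disjoint[OF _ _ disj] finite_imageI sum.reindex[OF inj(1)]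
          sum.reindex[OF inj(2)] o_def)
    also have "\<dots> = (\<Sum>e\<in>M. f (odd_minima M + of_bool (odd (Max e))) + f (odd_minima M + of_bool (odd (Max e))))"
      unfolding sum.distrib[symmetric]
    proof (intro sum.cong refl)
      fix e assume e: "e \<in> M"
      then have "{Min e, Max e} \<in> M" "{Max e, Min e} \<in> M" "Min e < Max e"
        using edge[OF e] by (auto simp: insert_commute)
      then show "f (odd_minima (split_edge ?p ?q M (?u e))) + f (odd_minima (split_edge ?p ?q M (?v e))) =
        f (odd_minima M + of_bool (odd (Max e))) + f (odd_minima M + of_bool (odd (Max e)))"
        by (simp only: old) (simp add: max_def)
    qed
    also have "\<dots> = of_nat (2 * card {e \<in> M. even (Max e)}) * f (odd_minima M) +
        of_nat (2 * card {e \<in> M. odd (Max e)}) * f (Suc (odd_minima M))"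
    proof -
      have "(\<Sum>e\<in>M. g (of_bool (odd (Max e)))) = of_nat (card {e \<in> M. even (Max e)}) * g 0 +
          of_nat (card {e \<in> M. odd (Max e)}) * g 1" for g :: "nat \<Rightarrow> 'a"
        using fin by (simp add: of_bool_def if_distrib[of g] sum.If_cases Int_def add.commute)
      from this[of "\<lambda>k. f (odd_minima M + k) + f (odd_minima M + k)"]
      show ?thesis by (simp add: algebra_simps mult_2)
    qed
    also have "card {e \<in> M. odd (Max e)} = n - odd_minima M"
      using odd_elements_matching(2)[OF M] by simp
    also have "card {e \<in> M. even (Max e)} = odd_minima M"
    proof -
      have "card M = card {e \<in> M. even (Max e)} + card {e \<in> M. odd (Max e)}"
        using fin by (subst card_Un_disjoint[symmetric]) (auto intro: arg_cong[where f = card])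
      then show ?thesis using odd_elements_matching[OF M] by simp
    qed
    finally show "(\<Sum>c\<in>{(a, b). {a, b} \<in> M}. f (odd_minima (split_edge ?p ?q M c))) =
      of_nat (2 * odd_minima M) * f (odd_minima M) +
      of_nat (2 * (n - odd_minima M)) * f (Suc (odd_minima M))" .
  qed
  finally show ?thesis
    unfolding sum.distrib[symmetric]
  proof (rule trans, intro sum.cong refl)
    fix M assume M: "M \<in> ?P"
    \<comment> \<open>The extra 1 is the extension by the edge of the two new points.\<close>
    have "2 * n + 1 - 2 * odd_minima M = Suc (2 * (n - odd_minima M))"
      using odd_elements_matching(2)[OF M] by simp
    then show "f (Suc (odd_minima M)) + (of_nat (2 * odd_minima M) * f (odd_minima M) +
       of_nat (2 * (n - odd_minima M)) * f (Suc (odd_minima M))) =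
       of_nat (2 * odd_minima M) * f (odd_minima M) +
       of_nat (2 * n + 1 - 2 * odd_minima M) * f (Suc (odd_minima M))"
      by (simp only: of_nat_Suc) (simp add: algebra_simps)
  qed
qed

text \<open>In x^(2(n-k)+1) y^(2k) the exponent of x counts the extensions that raise k, that of y
  the ones that preserve it.\<close>

lemma matchings_grammar:
  assumes D: "formal_derivative (\<x> * \<y>^2) (\<x>^2 * \<y>) D" and "n \<ge> 1"
  shows "(D ^^ n) \<x> =
    \<x> * (\<Sum>k=1..n. of_nat (matchings_odd_min n k) * \<x>^(2*n - 2*k) * \<y>^(2*k))"
proof -
  have D': "formal_derivative (\<x> * \<y>^2) (\<y> * \<x>^2) D"
    using D by (simp only: mult.commute[of \<y>])
  let ?m = "\<lambda>n k. \<x> * \<x> ^ (2 * n - 2 * k) * \<y> ^ (2 * k)"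
  let ?S = "\<lambda>n. perfect_matchings {1..2 * n}"
  have le: "odd_minima M \<le> n" if "M \<in> ?S n" for M n
    using odd_elements_matching(2)[OF that] by simp
  have "D (?m n k) = of_nat (2 * k) * ?m (Suc n) k + of_nat (2 * n + 1 - 2 * k) * ?m (Suc n) (Suc k)"
    if k: "k \<le> n" for n k
  proof -
    obtain j where n: "n = k + j" using le_Suc_ex[OF k] by auto
    have "?m n k = \<x> ^ Suc (2 * j) * \<y> ^ (2 * k)"
      by (simp add: n algebra_simps)
    then have "D (?m n k) = \<x> ^ Suc (2 * j) * \<y> ^ (2 * k) *
        (of_nat (Suc (2 * j)) * \<y>\<^sup>2 + of_nat (2 * k) * \<x>\<^sup>2)"
      by (simp only: formal_derivative_monomial[OF D'])
    also have "\<dots> = of_nat (2 * k) * ?m (Suc n) k +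
        of_nat (2 * n + 1 - 2 * k) * ?m (Suc n) (Suc k)"
      by (simp add: n power_add power2_eq_square algebra_simps)
    finally show ?thesis .
  qed
  then have "(D ^^ n) (\<Sum>M\<in>?S 0. ?m 0 (odd_minima M)) = (\<Sum>M\<in>?S n. ?m n (odd_minima M))"
    by (intro funpow_formal_derivative_weights[where S = ?S and m = ?m
          and st = "\<lambda>_. odd_minima" and \<alpha> = "\<lambda>n k. 2 * k"
          and \<beta> = "\<lambda>n k. 2 * n + 1 - 2 * k", OF D sum_perfect_matchings_Suc]) (simp_all only: le)
  moreover have "?S 0 = {{}}"
    by (auto simp: perfect_matchings_def partition_on_def)
  moreover have "(\<Sum>M\<in>?S n. ?m n (odd_minima M)) = (\<Sum>k=1..n. of_nat (matchings_odd_min n k) * ?m n k)"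
    unfolding matchings_odd_min_def odd_minima_def[symmetric]
  proof (intro sum_by_statistic finite_perfect_matchings)
    fix M assume M: "M \<in> ?S n"
    \<comment> \<open>The edge at the point 1 has the odd minimum 1, which excludes k = 0.\<close>
    obtain b where b: "{1, b} \<in> M" "b \<in> {1..2 * n}"
      using perfect_matchings_partner[OF M, of 1] \<open>n \<ge> 1\<close> by auto
    then have "{1, b} \<in> {e \<in> M. odd (Min e)}" by auto
    then have "odd_minima M > 0"
      using finite_perfect_matching[OF _ M] by (auto simp: odd_minima_def card_gt_0_iff)
    then show "odd_minima M \<in> {1..n}" using le[OF M] by simp
  qed auto
  ultimately show ?thesis
    by (simp add: odd_minima_def sum_distrib_left algebra_simps)
qed

section \<open>Excedances of injections\<close>

text \<open>The window of positions and values starts above c because it grows downwards: passing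
  from \<open>Suc c\<close> to c adds the position and the value \<open>Suc c\<close>, and the old
  entries keep their names.\<close>

definition partial_injections :: "nat \<Rightarrow> nat \<Rightarrow> nat \<Rightarrow> (nat \<Rightarrow> nat) set" where
  "partial_injections r c n =
     {\<sigma> \<in> {c<..c + n} \<rightarrow>\<^sub>E {c<..c + n + r}. inj_on \<sigma> {c<..c + n}}"

definition excedances :: "nat \<Rightarrow> nat \<Rightarrow> (nat \<Rightarrow> nat) \<Rightarrow> nat" where
  "excedances c n \<sigma> = card {i \<in> {c<..c + n}. \<sigma> i > i}"

lemma finite_partial_injections: "finite (partial_injections r c n)"
  unfolding partial_injections_def
  by (rule finite_subset[OF _ finite_PiE[of "{c<..c + n}" "\<lambda>_. {c<..c + n + r}"]]) auto

text \<open>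
  The inverse operation removes the least position \<open>d = Suc c\<close> and the least value \<open>d\<close>, and the position
  sent to \<open>d\<close> takes over the image of \<open>d\<close>.
\<close>

definition extend_injection :: "nat \<Rightarrow> nat \<Rightarrow> (nat \<Rightarrow> nat) \<Rightarrow> nat \<Rightarrow> nat \<Rightarrow> nat" where
  "extend_injection c n \<sigma> a = (\<lambda>i\<in>{c<..c + Suc n}.
     if i = Suc c then a else if \<sigma> i = a then Suc c else \<sigma> i)"

lemma extend_injection_bij:
  "bij_betw (\<lambda>(\<sigma>, a). extend_injection c n \<sigma> a)
     (partial_injections r (Suc c) n \<times> {c<..c + Suc n + r}) (partial_injections r c (Suc n))"
proof -
  let ?d = "Suc c"
  let ?rem = "\<lambda>\<sigma>. (\<lambda>i\<in>{?d<..?d + n}. if \<sigma> i = ?d then \<sigma> ?d else \<sigma> i)"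
  show ?thesis
  proof (rule bij_betw_byWitness[where f' = "\<lambda>\<sigma>. (?rem \<sigma>, \<sigma> ?d)"])
    show "\<forall>p\<in>partial_injections r (Suc c) n \<times> {c<..c + Suc n + r}.
        (\<lambda>\<sigma>. (?rem \<sigma>, \<sigma> ?d)) (case p of (\<sigma>, a) \<Rightarrow> extend_injection c n \<sigma> a) = p"
    proof
      fix p assume "p \<in> partial_injections r (Suc c) n \<times> {c<..c + Suc n + r}"
      then obtain \<sigma> a where p: "p = (\<sigma>, a)" and s: "\<sigma> \<in> partial_injections r (Suc c) n"
        by auto
      have "?rem (extend_injection c n \<sigma> a) = \<sigma>"
      proof (rule PiE_ext[of _ "{?d<..?d + n}" "\<lambda>_. UNIV"])
        show "\<sigma> \<in> {?d<..?d + n} \<rightarrow>\<^sub>E UNIV" using s by (auto simp: partial_injections_def PiE_def)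
        fix i assume i: "i \<in> {?d<..?d + n}"
        \<comment> \<open>All old values exceed d, so after the extension the value d marks the
          displaced position and nothing else.\<close>
        then have "\<sigma> i \<noteq> ?d"
          using s PiE_mem[of \<sigma> "{?d<..?d + n}" "\<lambda>_. {?d<..?d + n + r}" i] by (auto simp: partial_injections_def)
        then show "?rem (extend_injection c n \<sigma> a) i = \<sigma> i"
          using i by (auto simp: extend_injection_def)
      qed auto
      moreover have "extend_injection c n \<sigma> a ?d = a" by (simp add: extend_injection_def)
      ultimately show "(\<lambda>\<sigma>. (?rem \<sigma>, \<sigma> ?d)) (case p of (\<sigma>, a) \<Rightarrow> extend_injection c n \<sigma> a) = p"
        by (simp only: p prod.case)
    qed
    show "\<forall>\<sigma>\<in>partial_injections r c (Suc n).
        (case (?rem \<sigma>, \<sigma> ?d) of (\<sigma>, a) \<Rightarrow> extend_injection c n \<sigma> a) = \<sigma>"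
    proof
      fix \<sigma> assume s: "\<sigma> \<in> partial_injections r c (Suc n)"
      have "extend_injection c n (?rem \<sigma>) (\<sigma> ?d) = \<sigma>"
      proof (rule PiE_ext[of _ "{c<..c + Suc n}" "\<lambda>_. UNIV"])
        show "\<sigma> \<in> {c<..c + Suc n} \<rightarrow>\<^sub>E UNIV" using s by (auto simp: partial_injections_def PiE_def)
        show "extend_injection c n (?rem \<sigma>) (\<sigma> ?d) \<in> {c<..c + Suc n} \<rightarrow>\<^sub>E UNIV"
          by (auto simp: extend_injection_def)
        fix i assume i: "i \<in> {c<..c + Suc n}"
        have "\<sigma> i \<noteq> \<sigma> ?d" if "i \<noteq> ?d"
          using s i that inj_onD[of \<sigma> "{c<..c + Suc n}" i ?d] by (auto simp: partial_injections_def)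
        then show "extend_injection c n (?rem \<sigma>) (\<sigma> ?d) i = \<sigma> i"
          using i by (auto simp: extend_injection_def)
      qed
      then show "(case (?rem \<sigma>, \<sigma> ?d) of (\<sigma>, a) \<Rightarrow> extend_injection c n \<sigma> a) = \<sigma>" by simp
    qed
    show "(\<lambda>(\<sigma>, a). extend_injection c n \<sigma> a) `
        (partial_injections r (Suc c) n \<times> {c<..c + Suc n + r}) \<subseteq> partial_injections r c (Suc n)"
    proof (clarify)
      fix \<sigma> a assume s: "\<sigma> \<in> partial_injections r (Suc c) n" and a: "a \<in> {c<..c + Suc n + r}"
      have val: "\<sigma> i > ?d" "\<sigma> i \<le> ?d + n + r" if "i > ?d" "i \<le> ?d + n" for i
        using s that PiE_mem[of \<sigma> "{?d<..?d + n}" _ i] by (auto simp: partial_injections_def)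
      have inj: "\<sigma> i = \<sigma> j \<Longrightarrow> i = j" if "i > ?d" "i \<le> ?d + n" "j > ?d" "j \<le> ?d + n" for i j
        using s that inj_onD[of \<sigma> "{?d<..?d + n}" i j] by (auto simp: partial_injections_def)
      have "extend_injection c n \<sigma> a i \<in> {c<..c + Suc n + r}" if "i \<in> {c<..c + Suc n}" for i
        using that a val[of i] by (auto simp: extend_injection_def intro: less_imp_le)
      moreover have "inj_on (extend_injection c n \<sigma> a) {c<..c + Suc n}"
      proof (rule inj_onI)
        fix i j assume ij: "i \<in> {c<..c + Suc n}" "j \<in> {c<..c + Suc n}"
          "extend_injection c n \<sigma> a i = extend_injection c n \<sigma> a j"
        then show "i = j"
          using val[of i] val[of j] inj[of i j]
          by (cases "i = ?d"; cases "j = ?d") (auto simp: extend_injection_def split: if_splits)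
      qed
      ultimately show "extend_injection c n \<sigma> a \<in> partial_injections r c (Suc n)"
        by (simp add: partial_injections_def PiE_iff) (simp add: extend_injection_def)
    qed
    show "(\<lambda>\<sigma>. (?rem \<sigma>, \<sigma> ?d)) ` partial_injections r c (Suc n) \<subseteq>
        partial_injections r (Suc c) n \<times> {c<..c + Suc n + r}"
    proof
      fix p assume "p \<in> (\<lambda>\<sigma>. (?rem \<sigma>, \<sigma> ?d)) ` partial_injections r c (Suc n)"
      then obtain \<sigma> where p: "p = (?rem \<sigma>, \<sigma> ?d)" and s: "\<sigma> \<in> partial_injections r c (Suc n)" by auto
      have val: "\<sigma> i > c" "\<sigma> i \<le> ?d + n + r" if "i > c" "i \<le> ?d + n" for i
        using s that PiE_mem[of \<sigma> "{c<..c + Suc n}" _ i] by (auto simp: partial_injections_def)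
      have inj: "\<sigma> i = \<sigma> j \<Longrightarrow> i = j" if "i > c" "i \<le> ?d + n" "j > c" "j \<le> ?d + n" for i j
        using s that inj_onD[of \<sigma> "{c<..c + Suc n}" i j] by (auto simp: partial_injections_def)
      have "?rem \<sigma> i \<in> {?d<..?d + n + r}" if "i \<in> {?d<..?d + n}" for i
        using that val[of i] val[of ?d] inj[of i ?d] by (auto intro: Suc_lessI)
      moreover have "inj_on (?rem \<sigma>) {?d<..?d + n}"
      proof (rule inj_onI)
        fix i j assume ij: "i \<in> {?d<..?d + n}" "j \<in> {?d<..?d + n}" "?rem \<sigma> i = ?rem \<sigma> j"
        then show "i = j"
          using inj[of i j] inj[of i ?d] inj[of j ?d] by (auto split: if_splits)
      qed
      ultimately show "p \<in> partial_injections r (Suc c) n \<times> {c<..c + Suc n + r}"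
        using val[of ?d] by (simp add: p partial_injections_def PiE_iff del: restrict_apply)
    qed
  qed
qed

text \<open>If a is the value at one of the k excedances, the new excedance at d replaces the one
  lost there. For a = d neither happens. Any other a adds an excedance at d and destroys none, since
  a displaced non-excedance stays one. So k + 1 choices preserve k and n + r - k raise it.\<close>

lemma sum_partial_injections_Suc:
  fixes f :: "nat \<Rightarrow> 'a::comm_semiring_1"
  shows "(\<Sum>\<sigma>\<in>partial_injections r c (Suc n). f (excedances c (Suc n) \<sigma>)) =
    (\<Sum>\<sigma>\<in>partial_injections r (Suc c) n.
       of_nat (Suc (excedances (Suc c) n \<sigma>)) * f (excedances (Suc c) n \<sigma>) +
       of_nat (n + r - excedances (Suc c) n \<sigma>) * f (Suc (excedances (Suc c) n \<sigma>)))"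
proof -
  let ?d = "Suc c"
  have "(\<Sum>a\<in>{c<..c + Suc n + r}. f (excedances c (Suc n) (extend_injection c n \<sigma> a))) =
       of_nat (Suc (excedances ?d n \<sigma>)) * f (excedances ?d n \<sigma>) +
       of_nat (n + r - excedances ?d n \<sigma>) * f (Suc (excedances ?d n \<sigma>))"
    if s: "\<sigma> \<in> partial_injections r ?d n" for \<sigma>
  proof -
    define E where "E = {i \<in> {?d<..?d + n}. \<sigma> i > i}"
    have val: "\<sigma> i > ?d" "\<sigma> i \<le> ?d + n + r" if "i > ?d" "i \<le> ?d + n" for i
      using s that PiE_mem[of \<sigma> "{?d<..?d + n}" _ i] by (auto simp: partial_injections_def)
    have inj: "inj_on \<sigma> {?d<..?d + n}" using s by (simp add: partial_injections_def)
    have fin: "finite E" by (simp add: E_def)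
    \<comment> \<open>A displaced position receives the least value d, which is below it, so it is
      no excedance any more.\<close>
    have exc: "excedances c (Suc n) (extend_injection c n \<sigma> a) =
        of_bool (a > ?d) + card {i \<in> E. \<sigma> i \<noteq> a}" for a
    proof -
      have "{i \<in> {c<..c + Suc n}. extend_injection c n \<sigma> a i > i} =
        {i. i = ?d \<and> a > ?d} \<union> {i \<in> E. \<sigma> i \<noteq> a}"
        by (auto simp: extend_injection_def E_def split: if_splits)
      moreover have "card \<dots> = card {i. i = ?d \<and> a > ?d} + card {i \<in> E. \<sigma> i \<noteq> a}"
        using fin by (intro card_Un_disjoint) (auto simp: E_def)
      moreover have "card {i. i = ?d \<and> a > ?d} = of_bool (a > ?d)" by (cases "a > ?d") auto
      ultimately show ?thesis by (simp add: excedances_def)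
    qed
    have injE: "inj_on \<sigma> E" using inj by (rule inj_on_subset) (auto simp: E_def)
    have old: "excedances c (Suc n) (extend_injection c n \<sigma> a) = card E" if "a \<in> \<sigma> ` E" for a
    proof -
      from that obtain i where i: "i \<in> E" "a = \<sigma> i" by auto
      then have "{i \<in> E. \<sigma> i \<noteq> a} = E - {i}" using injE by (auto simp: inj_on_def)
      moreover have "a > ?d" using i val[of i] by (auto simp: E_def)
      moreover have "card E > 0" using i fin by (auto simp: card_gt_0_iff)
      ultimately show ?thesis using i fin by (simp add: exc card_Diff_singleton)
    qed
    have new: "excedances c (Suc n) (extend_injection c n \<sigma> a) = Suc (card E)"
      if "a \<in> {?d<..?d + n + r} - \<sigma> ` E" for a
    proof -
      have "{i \<in> E. \<sigma> i \<noteq> a} = E" using that by auto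
      then show ?thesis using that by (simp add: exc)
    qed
    have d: "excedances c (Suc n) (extend_injection c n \<sigma> ?d) = card E"
    proof -
      have "{i \<in> E. \<sigma> i \<noteq> ?d} = E" using val by (fastforce simp: E_def)
      then show ?thesis by (simp add: exc)
    qed
    have sub: "\<sigma> ` E \<subseteq> {?d<..?d + n + r}" using val by (auto simp: E_def)
    have "{c<..c + Suc n + r} = insert ?d {?d<..?d + n + r}" by auto
    then have "(\<Sum>a\<in>{c<..c + Suc n + r}. f (excedances c (Suc n) (extend_injection c n \<sigma> a))) =
      f (card E) + (\<Sum>a\<in>{?d<..?d + n + r}. f (excedances c (Suc n) (extend_injection c n \<sigma> a)))"
      by (simp add: d)
    also have "(\<Sum>a\<in>{?d<..?d + n + r}. f (excedances c (Suc n) (extend_injection c n \<sigma> a))) =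
      (\<Sum>a\<in>{?d<..?d + n + r} - \<sigma> ` E. f (Suc (card E))) + (\<Sum>a\<in>\<sigma> ` E. f (card E))"
      by (subst sum.subset_diff[OF sub]) (simp_all add: new old)
    also have "\<dots> = of_nat (n + r - card E) * f (Suc (card E)) + of_nat (card E) * f (card E)"
      using sub fin by (simp add: card_Diff_subset card_image[OF injE])
    finally show ?thesis
      by (simp add: excedances_def E_def algebra_simps)
  qed
  then have "(\<Sum>p\<in>partial_injections r ?d n \<times> {c<..c + Suc n + r}.
      f (excedances c (Suc n) (case p of (\<sigma>, a) \<Rightarrow> extend_injection c n \<sigma> a))) =
    (\<Sum>\<sigma>\<in>partial_injections r ?d n.
       of_nat (Suc (excedances ?d n \<sigma>)) * f (excedances ?d n \<sigma>) +
       of_nat (n + r - excedances ?d n \<sigma>) * f (Suc (excedances ?d n \<sigma>)))"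
    unfolding sum.cartesian_product' by (intro sum.cong) simp_all
  then show ?thesis
    by (simp only: sum.reindex_bij_betw[OF extend_injection_bij, where g = "\<lambda>\<sigma>. f (excedances c (Suc n) \<sigma>)"])
qed

lemma excedances_le: "excedances c n \<sigma> \<le> n"
proof -
  have "excedances c n \<sigma> \<le> card {c<..c + n}"
    unfolding excedances_def by (intro card_mono) auto
  then show ?thesis by simp
qed

text \<open>The k + 1 letters x of the weight each gain y and stand for the choices that preserve k;
  its n + r - k letters y each gain x and stand for the others.\<close>

lemma restricted_eulerian_grammar:
  assumes D: "formal_derivative (\<x> * \<y>) (\<x> * \<y>) D"
  shows "(D ^^ n) (\<x> * \<y>^r) =
    \<x> * (\<Sum>k=0..n. of_nat (restricted_eulerian r (n + r) k) * \<x>^k * \<y>^(n + r - k))"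
proof -
  have D': "formal_derivative (\<x> * \<y>) (\<y> * \<x>) D"
    using D by (simp only: mult.commute[of \<y>])
  let ?m = "\<lambda>n k. \<x> * \<x> ^ k * \<y> ^ (n + r - k)"
  have wt: "D (?m n k) = of_nat (Suc k) * ?m (Suc n) k + of_nat (n + r - k) * ?m (Suc n) (Suc k)"
    if k: "k \<le> n + r" for n k
  proof -
    obtain j where n: "n + r = k + j" using le_Suc_ex[OF k] by auto
    have "D (\<x> ^ Suc k * \<y> ^ j) = \<x> ^ Suc k * \<y> ^ j * (of_nat (Suc k) * \<y> + of_nat j * \<x>)"
      by (rule formal_derivative_monomial[OF D'])
    moreover have "\<x> ^ Suc k * \<y> ^ j = ?m n k" by (simp add: n)
    moreover have "?m n k * (of_nat (Suc k) * \<y> + of_nat j * \<x>) =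
      of_nat (Suc k) * ?m (Suc n) k + of_nat (n + r - k) * ?m (Suc n) (Suc k)"
      by (simp add: n algebra_simps)
    ultimately show ?thesis by (simp only:)
  qed
  \<comment> \<open>The claim is made for all c because the step for the window above c uses the
    window above \<open>Suc c\<close>; the weights do not depend on c.\<close>
  have "(D ^^ n) (\<x> * \<y> ^ r) = (\<Sum>\<sigma>\<in>partial_injections r c n. ?m n (excedances c n \<sigma>))" for c
  proof (induction n arbitrary: c)
    case 0
    have "partial_injections r c 0 = {\<lambda>_. undefined}" by (auto simp: partial_injections_def)
    then show ?case by (simp add: excedances_def)
  next
    case (Suc n)
    have "(D ^^ Suc n) (\<x> * \<y> ^ r) =
      (\<Sum>\<sigma>\<in>partial_injections r (Suc c) n. D (?m n (excedances (Suc c) n \<sigma>)))"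
      by (simp only: funpow.simps o_apply Suc[of "Suc c"] formal_derivative_sum[OF D])
    also have "\<dots> = (\<Sum>\<sigma>\<in>partial_injections r c (Suc n). ?m (Suc n) (excedances c (Suc n) \<sigma>))"
      unfolding sum_partial_injections_Suc[where f = "?m (Suc n)"]
      by (intro sum.cong refl wt) (use excedances_le trans_le_add1 in blast)
    finally show ?case .
  qed
  from this[of 0]
  have "(D ^^ n) (\<x> * \<y> ^ r) = (\<Sum>\<sigma>\<in>partial_injections r 0 n. ?m n (excedances 0 n \<sigma>))" .
  also have "\<dots> = (\<Sum>k=0..n. of_nat (card {\<sigma> \<in> partial_injections r 0 n. excedances 0 n \<sigma> = k}) * ?m n k)"
    by (intro sum_by_statistic finite_partial_injections) (simp_all add: excedances_le)
  also have "\<dots> = (\<Sum>k=0..n. of_nat (restricted_eulerian r (n + r) k) * ?m n k)"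
    by (simp add: restricted_eulerian_def partial_injections_def excedances_def conj_assoc
        atLeastSucAtMost_greaterThanAtMost)
  finally show ?thesis by (simp add: sum_distrib_left algebra_simps)
qed

section \<open>The square root of the Eulerian series\<close>

unbundle fps_syntax

text \<open>In characteristic 0 the equation expresses each coefficient of H through lower ones,
  linearly and without constant part.\<close>

lemma fps_linear_ode_eq_0:
  fixes H F :: "'a::field_char_0 fps"
  assumes "fps_deriv H = F * H" and "H $ 0 = 0"
  shows "H = 0"
proof -
  have "H $ n = 0" for n
  proof (induction n rule: less_induct)
    case (less n)
    show ?case
    proof (cases n)
      case (Suc m)
      have "of_nat (Suc m) * H $ Suc m = (F * H) $ m"
        by (metis assms(1) fps_deriv_nth add.commute plus_1_eq_Suc)
      also have "\<dots> = 0"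
        unfolding fps_mult_nth using less Suc by (intro sum.neutral) auto
      finally show ?thesis by (simp add: Suc del: of_nat_Suc)
    qed (simp add: assms)
  qed
  then show ?thesis by (simp add: fps_eq_iff)
qed

text \<open>The equation for F is nonlinear, but the defect H of the closed form obeys the linear
  equation H' = F H with H(0) = 0. This uses E' = (1 - u)(E - 1) for the denominator E.\<close>

lemma eulerian_gf_unique:
  fixes F :: "'a::field_char_0 fps"
  assumes ode: "fps_deriv F = F * (F - fps_const (1 - u))" and F0: "F $ 0 = 1" and u: "u \<noteq> 1"
  shows "F = eulerian_gf u"
proof -
  let ?E = "1 - fps_const u * fps_exp (1 - u)"
  let ?H = "F * ?E - fps_const (1 - u)"
  have "fps_deriv ?H = F * ?H"
    by (simp add: ode algebra_simps flip: fps_const_sub)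
  moreover have "?H $ 0 = 0" by (simp add: F0)
  ultimately have "?H = 0" by (rule fps_linear_ode_eq_0)
  then have "F * ?E = eulerian_gf u * ?E"
    by (simp only: right_minus_eq eulerian_gf_mult[OF u])
  moreover have "?E $ 0 \<noteq> 0" using u by simp
  then have "?E \<noteq> 0" by (metis fps_zero_nth)
  ultimately show ?thesis by simp
qed

section \<open>Exponential generating functions of iterated derivatives\<close>

text \<open>The letter \<open>y\<close> is specialised to 1 and \<open>x\<close> to the indeterminate \<open>t\<close>.\<close>

definition dehomogenize :: "real poly poly \<Rightarrow> real poly fract" where
  "dehomogenize p = to_fract (poly p 1)"

lemma dehomogenize_simps:
  "dehomogenize (p + q) = dehomogenize p + dehomogenize q"
  "dehomogenize (p - q) = dehomogenize p - dehomogenize q"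
  "dehomogenize (p * q) = dehomogenize p * dehomogenize q"
  "dehomogenize 0 = 0" "dehomogenize 1 = 1"
  "dehomogenize \<x> = t_indet" "dehomogenize \<y> = 1"
  "dehomogenize (scalar c) = to_fract [:c:]"
  by (simp_all add: dehomogenize_def x_letter_def y_letter_def t_indet_def)

lemma dehomogenize_power: "dehomogenize (p ^ m) = dehomogenize p ^ m"
  by (induction m) (simp_all add: dehomogenize_simps)

lemma dehomogenize_sum: "dehomogenize (\<Sum>i\<in>I. p i) = (\<Sum>i\<in>I. dehomogenize (p i))"
  by (induction I rule: infinite_finite_induct) (simp_all add: dehomogenize_simps)

text \<open>This is exp(z D) p, the formal flow of D, after specialising the letters.\<close>

definition derivative_egf :: "(real poly poly \<Rightarrow> real poly poly) \<Rightarrow> real poly poly \<Rightarrow> real poly fract fps" where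
  "derivative_egf D p = Abs_fps (\<lambda>n. dehomogenize ((D ^^ n) p) / fact n)"

lemma fps_deriv_derivative_egf: "fps_deriv (derivative_egf D p) = derivative_egf D (D p)"
  by (rule fps_ext) (simp add: derivative_egf_def funpow_swap1 field_simps del: of_nat_Suc)

lemma derivative_egf_add:
  assumes "formal_derivative f g D"
  shows "derivative_egf D (p + q) = derivative_egf D p + derivative_egf D q"
proof -
  have "(D ^^ n) (p + q) = (D ^^ n) p + (D ^^ n) q" for n
    by (induction n) (simp_all add: formal_derivative_add[OF assms])
  then show ?thesis
    by (simp add: derivative_egf_def fps_eq_iff dehomogenize_simps add_divide_distrib)
qed

text \<open>The exponential of a derivation is multiplicative. Comparing derivatives in z avoids the
  binomial form of the Leibniz rule; p and q vary in the induction because differentiation replaces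
  them by D p and D q.\<close>

lemma derivative_egf_mult:
  assumes D: "formal_derivative f g D"
  shows "derivative_egf D (p * q) = derivative_egf D p * derivative_egf D q"
proof -
  let ?E = "derivative_egf D"
  have "?E (p * q) $ n = (?E p * ?E q) $ n" for n
  proof (induction n arbitrary: p q)
    case 0
    then show ?case by (simp add: derivative_egf_def dehomogenize_simps)
  next
    case (Suc n)
    have "of_nat (Suc n) * ?E (p * q) $ Suc n = fps_deriv (?E (p * q)) $ n" by simp
    also have "\<dots> = (?E (D p) * ?E q + ?E p * ?E (D q)) $ n"
      by (simp add: fps_deriv_derivative_egf formal_derivative_mult[OF D] derivative_egf_add[OF D] Suc)
    also have "\<dots> = fps_deriv (?E p * ?E q) $ n"
      by (simp only: fps_deriv_mult fps_deriv_derivative_egf add.commute)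
    also have "\<dots> = of_nat (Suc n) * (?E p * ?E q) $ Suc n"
      by (simp del: fps_deriv_mult)
    finally show ?case by (simp del: of_nat_Suc)
  qed
  then show ?thesis by (simp add: fps_eq_iff)
qed

lemma derivative_egf_const:
  assumes "formal_derivative f g D" and "D p = 0"
  shows "derivative_egf D p = fps_const (dehomogenize p)"
proof (rule fps_ext)
  have "(D ^^ n) 0 = 0" for n
    by (induction n) (simp_all add: formal_derivative_0[OF assms(1)])
  then show "derivative_egf D p $ n = fps_const (dehomogenize p) $ n" for n
    by (cases n) (simp_all add: derivative_egf_def funpow_swap1 assms(2) dehomogenize_simps)
qed

lemma derivative_egf_nth_0: "derivative_egf D p $ 0 = dehomogenize p"
  by (simp add: derivative_egf_def)

text \<open>The conserved quantity \<open>y^2 - 2 x\<close> turns the two-letter system into one equation for \<open>y^2\<close>.\<close>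

lemma derivative_egf_y_square:
  assumes D: "formal_derivative (\<x> * \<y>^2) (\<x> * \<y>) D"
  shows "(derivative_egf D \<y>)\<^sup>2 = eulerian_gf (2 * t_indet)"
proof (rule eulerian_gf_unique)
  let ?c = "\<y> * \<y> - 2 * \<x>"
  have Dx: "D \<x> = \<x> * \<y>^2" and Dy: "D \<y> = \<x> * \<y>" using D by (simp_all add: formal_derivative_def)
  have "D (\<y> * \<y>) = 2 * \<x> * \<y>^2" and "D (2 * \<x>) = 2 * \<x> * \<y>^2"
    using formal_derivative_of_nat_mult[OF D, of 2 \<x>]
    by (simp_all add: formal_derivative_mult[OF D] Dx Dy power2_eq_square algebra_simps)
  moreover have "D (\<y> * \<y>) = D ?c + D (2 * \<x>)"
    by (simp only: diff_add_cancel flip: formal_derivative_add[OF D])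
  ultimately have "D ?c = 0" by simp
  \<comment> \<open>The value of the conserved quantity at x = t, y = 1; this is why A is taken at u
    = 2t.\<close>
  moreover have "dehomogenize ?c = 1 - 2 * t_indet"
    by (simp only: mult_2 dehomogenize_simps mult_1_left)
  ultimately have c: "derivative_egf D ?c = fps_const (1 - 2 * t_indet)"
    by (metis derivative_egf_const[OF D])
  have "fps_deriv ((derivative_egf D \<y>)\<^sup>2) = derivative_egf D (D (\<y> * \<y>))"
    by (simp only: power2_eq_square fps_deriv_derivative_egf flip: derivative_egf_mult[OF D])
  also have "D (\<y> * \<y>) = (\<y> * \<y>) * (2 * \<x>)"
    by (simp add: formal_derivative_mult[OF D] Dy algebra_simps)
  also have "derivative_egf D ((\<y> * \<y>) * (2 * \<x>)) =
      (derivative_egf D \<y>)\<^sup>2 * derivative_egf D (2 * \<x>)"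
    by (simp only: derivative_egf_mult[OF D] power2_eq_square)
  also have "derivative_egf D (2 * \<x>) = (derivative_egf D \<y>)\<^sup>2 - fps_const (1 - 2 * t_indet)"
  proof -
    have "derivative_egf D (?c + 2 * \<x>) = fps_const (1 - 2 * t_indet) + derivative_egf D (2 * \<x>)"
      by (simp only: derivative_egf_add[OF D] c)
    then show ?thesis by (simp add: derivative_egf_mult[OF D] power2_eq_square)
  qed
  finally show "fps_deriv ((derivative_egf D \<y>)\<^sup>2) =
    (derivative_egf D \<y>)\<^sup>2 * ((derivative_egf D \<y>)\<^sup>2 - fps_const (1 - 2 * t_indet))" .
qed (simp_all add: two_t_neq_1 derivative_egf_nth_0 dehomogenize_simps power2_eq_square)

text \<open>Power series over a field form an integral domain, so S is T or -T, and the constant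
  terms exclude -T.\<close>

lemma fps_square_eq_imp_eq:
  fixes S T :: "'a::field_char_0 fps"
  assumes "S\<^sup>2 = T\<^sup>2" and "S $ 0 = 1" and "T $ 0 = 1"
  shows "S = T"
proof -
  have "S \<noteq> - T"
  proof
    assume "S = - T"
    then have "S $ 0 = - T $ 0" by simp
    then show False using assms(2,3) by simp
  qed
  then show ?thesis using assms(1) by (auto simp: power2_eq_iff)
qed

text \<open>Read off from the two terms of D(x^k y^(2n-2k+1)), whose multiplicities are k and 2n -
  2k + 1.\<close>

fun y_coefficient :: "nat \<Rightarrow> nat \<Rightarrow> real" where
  "y_coefficient 0 k = of_bool (k = 0)"
| "y_coefficient (Suc n) 0 = 0"
| "y_coefficient (Suc n) (Suc k) =
     real (Suc k) * y_coefficient n (Suc k) + real (2 * n - 2 * k + 1) * y_coefficient n k"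

lemma y_coefficient_eq_0: "n < k \<Longrightarrow> y_coefficient n k = 0"
  by (induction n k rule: y_coefficient.induct) simp_all

lemma scalar_of_nat_mult: "scalar (real m * c) = of_nat m * scalar c"
  by (simp add: of_nat_poly)

text \<open>Its purpose is the shape of D^n y: the exponent of x fixes that of y, so the value at y
  = 1 determines the polynomial.\<close>

lemma funpow_D_y:
  assumes D: "formal_derivative (\<x> * \<y>^2) (\<x> * \<y>) D"
  shows "(D ^^ n) \<y> = (\<Sum>k\<le>n. scalar (y_coefficient n k) * (\<x> ^ k * \<y> ^ (2 * n - 2 * k + 1)))"
proof (induction n)
  case 0
  have "scalar 1 = 1" by (simp add: one_pCons)
  then show ?case by simp
next
  case (Suc n)
  have D': "formal_derivative (\<x> * \<y>^2) (\<y> * \<x>) D"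
    using D by (simp only: mult.commute[of \<y>])
  let ?m = "\<lambda>n k. \<x> ^ k * \<y> ^ (2 * n - 2 * k + 1)"
  have wt: "D (?m n k) = of_nat k * ?m (Suc n) k + of_nat (2 * n - 2 * k + 1) * ?m (Suc n) (Suc k)"
    if k: "k \<le> n" for k
  proof -
    obtain j where n: "n = k + j" using le_Suc_ex[OF k] by auto
    have "D (\<x> ^ k * \<y> ^ (2 * j + 1)) =
      \<x> ^ k * \<y> ^ (2 * j + 1) * (of_nat k * \<y>\<^sup>2 + of_nat (2 * j + 1) * \<x>)"
      by (rule formal_derivative_monomial[OF D'])
    moreover have "?m n k = \<x> ^ k * \<y> ^ (2 * j + 1)" by (simp add: n)
    moreover have "\<x> ^ k * \<y> ^ (2 * j + 1) * (of_nat k * \<y>\<^sup>2 + of_nat (2 * j + 1) * \<x>) =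
      of_nat k * ?m (Suc n) k + of_nat (2 * n - 2 * k + 1) * ?m (Suc n) (Suc k)"
      by (simp add: n power2_eq_square algebra_simps)
    ultimately show ?thesis by (simp only:)
  qed
  let ?c = y_coefficient
  have "(D ^^ Suc n) \<y> = (\<Sum>k\<le>n. scalar (?c n k) * D (?m n k))"
    by (simp only: funpow.simps o_apply Suc formal_derivative_sum[OF D] formal_derivative_scalar_mult[OF D])
  also have "\<dots> = (\<Sum>k\<le>n. scalar (real k * ?c n k) * ?m (Suc n) k) +
      (\<Sum>k\<le>n. scalar (real (2 * n - 2 * k + 1) * ?c n k) * ?m (Suc n) (Suc k))"
    unfolding sum.distrib[symmetric] scalar_of_nat_mult
    by (intro sum.cong refl, subst wt) (simp_all only: atMost_iff distrib_left mult_ac)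
  \<comment> \<open>Both the added term k = n + 1 and the term k = 0 vanish, so the index can be
    shifted to match the second sum.\<close>
  also have "(\<Sum>k\<le>n. scalar (real k * ?c n k) * ?m (Suc n) k) =
      (\<Sum>k\<le>Suc n. scalar (real k * ?c n k) * ?m (Suc n) k)"
    by (simp add: y_coefficient_eq_0)
  also have "\<dots> = (\<Sum>k\<le>n. scalar (real (Suc k) * ?c n (Suc k)) * ?m (Suc n) (Suc k))"
    by (subst sum.atMost_Suc_shift) simp
  also have "\<dots> + (\<Sum>k\<le>n. scalar (real (2 * n - 2 * k + 1) * ?c n k) * ?m (Suc n) (Suc k)) =
      (\<Sum>k\<le>n. scalar (?c (Suc n) (Suc k)) * ?m (Suc n) (Suc k))"
  proof -
    have "scalar (a + b) = scalar a + scalar b" for a b by simp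
    then show ?thesis
      by (simp only: y_coefficient.simps distrib_right sum.distrib)
  qed
  also have "\<dots> = (\<Sum>k\<le>Suc n. scalar (?c (Suc n) k) * ?m (Suc n) k)"
    by (subst sum.atMost_Suc_shift) simp
  finally show ?case .
qed

text \<open>The series of T and the flow of y are square roots of A(2t, z) with constant term 1,
  hence equal. Compare coefficients of z^n, then of t^k.\<close>

lemma sqrt_eulerian_grammar:
  assumes T: "sqrt_eulerian_numbers T" and D: "formal_derivative (\<x> * \<y>^2) (\<x> * \<y>) D"
    and n: "n \<ge> 1"
  shows "(D ^^ n) \<y> = (\<Sum>k=1..n. scalar (T n k) * \<x>^k * \<y>^(2*n - 2*k + 1))"
proof -
  let ?c = "y_coefficient n"
  have "T_series T = derivative_egf D \<y>"
  proof (rule fps_square_eq_imp_eq)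
    show "(T_series T)\<^sup>2 = (derivative_egf D \<y>)\<^sup>2"
      using T by (simp only: sqrt_eulerian_numbers_def derivative_egf_y_square[OF D])
    show "T_series T $ 0 = 1" by (simp add: T_series_def)
    show "derivative_egf D \<y> $ 0 = 1" by (simp only: derivative_egf_nth_0 dehomogenize_simps)
  qed
  then have "T_series T $ n = derivative_egf D \<y> $ n" by simp
  then have eq: "(\<Sum>k=1..n. to_fract [:T n k:] * t_indet ^ k) = dehomogenize ((D ^^ n) \<y>)"
    using n by (simp add: T_series_def derivative_egf_def)
  have Dn: "(D ^^ n) \<y> = (\<Sum>k=1..n. scalar (?c k) * (\<x> ^ k * \<y> ^ (2 * n - 2 * k + 1)))"
  proof -
    have "{..n} = insert 0 {1..n}" by auto
    moreover have "?c 0 = 0" using n by (cases n) auto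
    ultimately show ?thesis by (simp add: funpow_D_y[OF D])
  qed
  have "to_fract [:a:] * t_indet ^ k = to_fract (monom a k)" for a k
  proof (induction k)
    case (Suc k)
    have "to_fract [:a:] * t_indet ^ Suc k = t_indet * to_fract (monom a k)"
      by (simp add: mult.left_commute flip: Suc)
    also have "\<dots> = to_fract (monom a (Suc k))"
      by (simp add: t_indet_def monom_Suc flip: to_fract_mult)
    finally show ?case .
  qed (simp add: monom_0)
  moreover have "dehomogenize ((D ^^ n) \<y>) = (\<Sum>k=1..n. to_fract [:?c k:] * t_indet ^ k)"
    by (simp only: Dn dehomogenize_sum dehomogenize_simps dehomogenize_power power_one mult_1_right)
  \<comment> \<open>R[t] embeds into R(t), so the identity can be read as one of polynomials and
    their coefficients compared.\<close>
  ultimately have "to_fract (\<Sum>k=1..n. monom (T n k) k) = to_fract (\<Sum>k=1..n. monom (?c k) k)"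
    using eq by simp
  then have *: "(\<Sum>k=1..n. monom (T n k) k) = (\<Sum>k=1..n. monom (?c k) k)"
    by (simp only: to_fract_eq_iff)
  have "T n k = ?c k" if "k \<in> {1..n}" for k
    using arg_cong[OF *, of "\<lambda>p. coeff p k"] that by (simp add: coeff_sum)
  then show ?thesis unfolding Dn by (intro sum.cong) (simp_all only: mult.assoc)
qed

unbundle no fps_syntax

section \<open>Forests of growing structures\<close>

text \<open>
  Labeled structures, and unordered forests of them, that grow by inserting a new largest label \<open>N\<close>: a
  structure with \<open>m\<close> labels has \<open>c m + d\<close> places for \<open>N\<close>, and \<open>single N\<close> starts a new structure.
\<close>

locale growing_structures =
  fixes valid :: "'s \<Rightarrow> bool" and labels :: "'s \<Rightarrow> nat multiset" and single :: "nat \<Rightarrow> 's"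
    and children :: "nat \<Rightarrow> 's \<Rightarrow> 's set" and remove :: "nat \<Rightarrow> 's \<Rightarrow> 's" and c d :: nat
  assumes labels_nonempty: "valid t \<Longrightarrow> labels t \<noteq> {#}"
    and single: "N > 0 \<Longrightarrow> valid (single N)" "labels (single N) = {#N#}"
    and children: "\<lbrakk>valid t; \<forall>a\<in>#labels t. a < N; t' \<in> children N t\<rbrakk> \<Longrightarrow>
      valid t' \<and> labels t' = add_mset N (labels t) \<and> remove N t' = t"
    and predecessor: "\<lbrakk>valid t'; labels t' = add_mset N L; \<forall>a\<in>#L. a < N; t' \<noteq> single N\<rbrakk> \<Longrightarrow>
      \<exists>t. valid t \<and> labels t = L \<and> t' \<in> children N t"
    and card_children: "\<lbrakk>valid t; \<forall>a\<in>#labels t. a < N\<rbrakk> \<Longrightarrow>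
      finite (children N t) \<and> card (children N t) = c * size (labels t) + d"
begin

section \<open>Growth of unordered forests in general\<close>

definition forests :: "nat \<Rightarrow> 's multiset set" where
  "forests n = {F. (\<forall>t\<in>#F. valid t) \<and> (\<Sum>t\<in>#F. labels t) = mset_set {1..n}}"

lemma forest_labels:
  assumes "F \<in> forests n" and "t \<in># F" and "a \<in># labels t"
  shows "a \<in> {1..n}"
proof -
  have sum: "(\<Sum>t\<in>#F. labels t) = mset_set {1..n}" using assms(1) by (simp add: forests_def)
  have "a \<in># mset_set {1..n}" unfolding sum[symmetric] using assms(2,3) by auto
  then show ?thesis by simp
qed

lemma forest_split:
  assumes F: "F \<in> forests (Suc n)"
  obtains t' R L where "F = add_mset t' R" "valid t'" "\<forall>t\<in>#R. valid t" "labels t' = add_mset (Suc n) L"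
    "L + (\<Sum>t\<in>#R. labels t) = mset_set {1..n}"
proof -
  have sum: "(\<Sum>t\<in>#F. labels t) = add_mset (Suc n) (mset_set {1..n})"
    using F by (simp add: forests_def atLeastAtMostSuc_conv)
  then have "Suc n \<in># (\<Sum>t\<in>#F. labels t)" by simp
  then obtain t' where t': "t' \<in># F" "Suc n \<in># labels t'" by auto
  then obtain R L where RL: "F = add_mset t' R" "labels t' = add_mset (Suc n) L"
    by (metis insert_DiffM)
  then have "L + (\<Sum>t\<in>#R. labels t) = mset_set {1..n}" using sum by simp
  then show ?thesis using that RL F by (auto simp: forests_def)
qed

text \<open>A repeated structure would repeat one of its labels. So forests may be summed over as
  sets, although they are defined as multisets.\<close>

lemma forest_eq_mset_set:
  assumes F: "F \<in> forests n"
  shows "F = mset_set (set_mset F)"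
proof (rule multiset_eqI)
  fix t
  show "count F t = count (mset_set (set_mset F)) t"
  proof (cases "t \<in># F")
    case True
    have "\<not> Suc 0 < count F t"
    proof
      assume "Suc 0 < count F t"
      then obtain R where R: "F = add_mset t (add_mset t R)"
        by (metis True count_add_mset insert_DiffM less_irrefl not_in_iff)
      obtain a where a: "a \<in># labels t"
        using labels_nonempty[of t] F True by (auto simp: forests_def)
      have sum: "labels t + (labels t + (\<Sum>t\<in>#R. labels t)) = mset_set {1..n}"
        using F by (simp add: forests_def R)
      have "count (mset_set {1..n}) a \<ge> 2 * count (labels t) a"
        unfolding sum[symmetric] by simp
      moreover have "count (mset_set {1..n}) a \<le> 1" by (simp add: count_mset_set')
      moreover have "count (labels t) a \<ge> 1" using a by (simp add: Suc_le_eq)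
      ultimately show False by linarith
    qed
    then show ?thesis using True by (simp flip: count_greater_zero_iff)
  qed (simp add: not_in_iff)
qed

lemma forest_size:
  assumes F: "F \<in> forests n"
  shows "size F \<le> n" and "n \<ge> 1 \<Longrightarrow> size F \<ge> 1"
proof -
  have "(\<Sum>t\<in>#F. size (labels t)) = size (\<Sum>t\<in>#F. labels t)"
    by (induction F) auto
  also have "\<dots> = size (mset_set {1..n})"
    using F by (simp only: forests_def mem_Collect_eq)
  finally have sum: "(\<Sum>t\<in>#F. size (labels t)) = n" by simp
  have "\<forall>t\<in>#F. size (labels t) \<ge> 1"
    using F labels_nonempty by (auto simp: forests_def Suc_le_eq nonempty_has_size)
  then have "size F \<le> (\<Sum>t\<in>#F. size (labels t))"
    by (induction F) (auto intro: add_mono)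
  then show "size F \<le> n" by (simp add: sum)
  show "n \<ge> 1 \<Longrightarrow> size F \<ge> 1"
    using sum by (cases F) auto
qed

text \<open>Adding c m + d over the members of the forest gives c n + d k, as their label counts m
  add up to n.\<close>

lemma card_forest_children:
  assumes F: "F \<in> forests n"
  shows "finite (Sigma (set_mset F) (children (Suc n)))"
    and "card (Sigma (set_mset F) (children (Suc n))) = c * n + d * size F"
proof -
  have ch: "finite (children (Suc n) t)" "card (children (Suc n) t) = c * size (labels t) + d"
    if "t \<in># F" for t
    using card_children[of t "Suc n"] forest_labels[OF F that] F that
    by (auto simp: forests_def less_Suc_eq_le)
  then show "finite (Sigma (set_mset F) (children (Suc n)))" by auto
  have "card (Sigma (set_mset F) (children (Suc n))) = (\<Sum>t\<in>set_mset F. c * size (labels t) + d)"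
    using ch by (simp add: card_SigmaI)
  also have "\<dots> = (\<Sum>t\<in>#F. c * size (labels t) + d)"
    using forest_eq_mset_set[OF F] by (simp add: sum_unfold_sum_mset)
  also have "\<dots> = c * size (\<Sum>t\<in>#F. labels t) + d * size F"
    by (induction F) (auto simp: algebra_simps)
  also have "size (\<Sum>t\<in>#F. labels t) = n"
    using F by (simp add: forests_def)
  finally show "card (Sigma (set_mset F) (children (Suc n))) = c * n + d * size F" .
qed

abbreviation grow :: "'s multiset \<times> 's \<times> 's \<Rightarrow> 's multiset" where
  "grow \<equiv> \<lambda>(F, t, t'). add_mset t' (F - {#t#})"

text \<open>The member carrying n + 1 is unique. It is either the fresh single structure or comes
  from a predecessor, which \<open>remove\<close> recovers; the two cases exclude each other because
  a predecessor has a label of its own.\<close>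

lemma forests_Suc:
  shows "inj_on (add_mset (single (Suc n))) (forests n)"
    and "inj_on grow (SIGMA F:forests n. Sigma (set_mset F) (children (Suc n)))"
    and "add_mset (single (Suc n)) ` forests n \<inter>
      grow ` (SIGMA F:forests n. Sigma (set_mset F) (children (Suc n))) = {}"
    and "forests (Suc n) = add_mset (single (Suc n)) ` forests n \<union>
      grow ` (SIGMA F:forests n. Sigma (set_mset F) (children (Suc n)))"
proof -
  let ?N = "Suc n"
  let ?A = "SIGMA F:forests n. Sigma (set_mset F) (children ?N)"
  have old: "?N \<notin># labels t" if "F \<in> forests n" "t \<in># F" for F t
    using forest_labels[OF that, of ?N] by auto
  have ch: "valid t'" "labels t' = add_mset ?N (labels t)" "remove ?N t' = t" "labels t \<noteq> {#}"
    if "F \<in> forests n" "t \<in># F" "t' \<in> children ?N t" for F t t'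
    using children[of t ?N t'] forest_labels[OF that(1,2)] that labels_nonempty[of t]
    by (auto simp: forests_def less_Suc_eq_le)
  \<comment> \<open>The label n + 1 tells the new member apart from all others, so it can be
    cancelled.\<close>
  have same: "u = v \<and> R = S" if "add_mset u R = add_mset v S" "?N \<in># labels u" "?N \<in># labels v"
    "\<forall>t\<in>#R. ?N \<notin># labels t" for u v R S
  proof -
    have "u = v"
    proof (rule ccontr)
      assume "u \<noteq> v"
      then have "v \<in># R" using that(1) by (metis insert_noteq_member)
      then show False using that by blast
    qed
    then show ?thesis using that(1) by simp
  qed
  show "inj_on (add_mset (single (Suc n))) (forests n)" by (rule inj_onI) simp
  show "inj_on grow ?A"
  proof (rule inj_onI)
    fix p q assume p: "p \<in> ?A" and q: "q \<in> ?A" and eq: "grow p = grow q"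
    obtain F t t' where P: "p = (F, t, t')" "F \<in> forests n" "t \<in># F" "t' \<in> children ?N t"
      using p by auto
    obtain G u u' where Q: "q = (G, u, u')" "G \<in> forests n" "u \<in># G" "u' \<in> children ?N u"
      using q by auto
    have "t' = u' \<and> F - {#t#} = G - {#u#}"
    proof (rule same)
      show "\<forall>s\<in>#F - {#t#}. ?N \<notin># labels s" using old[OF P(2)] by (meson in_diffD)
    qed (use eq ch[OF P(2-4)] ch[OF Q(2-4)] in \<open>auto simp: P(1) Q(1)\<close>)
    then show "p = q"
      using ch(3)[OF P(2-4)] ch(3)[OF Q(2-4)] P(3) Q(3) by (metis P(1) Q(1) insert_DiffM)
  qed
  show "add_mset (single ?N) ` forests n \<inter> grow ` ?A = {}"
  proof (rule equals0I)
    fix H assume "H \<in> add_mset (single ?N) ` forests n \<inter> grow ` ?A"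
    then obtain G F t t' where H: "G \<in> forests n" "F \<in> forests n" "t \<in># F" "t' \<in> children ?N t"
      "add_mset (single ?N) G = add_mset t' (F - {#t#})" by auto
    have "single ?N = t' \<and> G = F - {#t#}"
      using H(5) by (rule same) (use old[OF H(1)] ch[OF H(2-4)] in \<open>auto simp: single\<close>)
    then have "{#?N#} = add_mset ?N (labels t)" using ch(2)[OF H(2-4)] single(2) by metis
    then show False using ch(4)[OF H(2-4)] by simp
  qed
  show "forests ?N = add_mset (single ?N) ` forests n \<union> grow ` ?A"
  proof (intro subset_antisym subsetI)
    fix H assume "H \<in> forests ?N"
    then obtain t' R L where H: "H = add_mset t' R" "valid t'" "\<forall>t\<in>#R. valid t"
      "labels t' = add_mset ?N L" "L + (\<Sum>t\<in>#R. labels t) = mset_set {1..n}"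
      by (rule forest_split)
    show "H \<in> add_mset (single ?N) ` forests n \<union> grow ` ?A"
    proof (cases "t' = single ?N")
      case True
      then have "R \<in> forests n" using H by (simp add: forests_def single)
      then show ?thesis using H(1) True by blast
    next
      case False
      have "\<forall>a\<in>#L. a < ?N"
      proof
        fix a assume "a \<in># L"
        then have "a \<in># mset_set {1..n}" unfolding H(5)[symmetric] by simp
        then show "a < ?N" by simp
      qed
      then obtain t where t: "valid t" "labels t = L" "t' \<in> children ?N t"
        using predecessor[OF H(2,4)] False by blast
      have "add_mset t R \<in> forests n" using H t by (simp add: forests_def)
      then show ?thesis
        by (intro UnI2 image_eqI[of _ _ "(add_mset t R, t, t')"]) (simp_all add: H(1) t(3))
    qed
  next
    fix H assume "H \<in> add_mset (single ?N) ` forests n \<union> grow ` ?A"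
    then show "H \<in> forests ?N"
    proof
      assume "H \<in> add_mset (single ?N) ` forests n"
      then show ?thesis by (auto simp: forests_def single atLeastAtMostSuc_conv)
    next
      assume "H \<in> grow ` ?A"
      then obtain F t t' where H: "F \<in> forests n" "t \<in># F" "t' \<in> children ?N t"
        "H = add_mset t' (F - {#t#})" by auto
      obtain R where R: "F = add_mset t R" using H(2) by (metis insert_DiffM)
      have "add_mset ?N (labels t + (\<Sum>t\<in>#R. labels t)) = mset_set {1..?N}"
        using H(1) by (simp add: forests_def R atLeastAtMostSuc_conv)
      then show ?thesis using H(1) ch[OF H(1-3)] by (auto simp: forests_def H(4) R)
    qed
  qed
qed

lemma finite_forests: "finite (forests n)"
proof (induction n)
  case 0
  have "F = {#}" if "F \<in> forests 0" for F using forest_size(1)[OF that] by simp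
  then show ?case by (auto intro: finite_subset[of _ "{{#}}"])
next
  case (Suc n)
  then show ?case
    unfolding forests_Suc(4)[of n]
    by (intro finite_UnI finite_imageI finite_SigmaI[OF _ card_forest_children(1)])
qed

text \<open>Growth inside a member keeps the number of members, and a fresh one is started in one
  way. The factor \<open>of_nat 1\<close> is spelled out to fit
  \<open>funpow_formal_derivative_weights\<close>.\<close>

lemma sum_forests_Suc:
  fixes f :: "nat \<Rightarrow> 'a::comm_semiring_1"
  shows "(\<Sum>F\<in>forests (Suc n). f (size F)) =
    (\<Sum>F\<in>forests n. of_nat (c * n + d * size F) * f (size F) + of_nat 1 * f (Suc (size F)))"
proof -
  let ?A = "SIGMA F:forests n. Sigma (set_mset F) (children (Suc n))"
  have finA: "finite ?A" by (rule finite_SigmaI[OF finite_forests card_forest_children(1)])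
  have "(\<Sum>H\<in>grow ` ?A. f (size H)) = (\<Sum>p\<in>?A. f (size (grow p)))"
    by (simp add: sum.reindex[OF forests_Suc(2)])
  also have "\<dots> = (\<Sum>p\<in>?A. f (size (fst p)))"
  proof (intro sum.cong refl)
    fix p assume "p \<in> ?A"
    then obtain F t t' where "p = (F, t, t')" "t \<in># F" by auto
    then show "f (size (grow p)) = f (size (fst p))"
      by (metis fst_conv insert_DiffM prod.case size_add_mset)
  qed
  also have "\<dots> = (\<Sum>F\<in>forests n. \<Sum>q\<in>Sigma (set_mset F) (children (Suc n)). f (size F))"
    using finite_forests card_forest_children(1) by (subst sum.Sigma) (auto simp: split_def)
  also have "\<dots> = (\<Sum>F\<in>forests n. of_nat (c * n + d * size F) * f (size F))"
    by (intro sum.cong refl) (simp only: sum_constant card_forest_children(2))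
  finally have grow: "(\<Sum>H\<in>grow ` ?A. f (size H)) =
    (\<Sum>F\<in>forests n. of_nat (c * n + d * size F) * f (size F))" .
  have "(\<Sum>F\<in>forests (Suc n). f (size F)) =
    (\<Sum>F\<in>add_mset (single (Suc n)) ` forests n. f (size F)) + (\<Sum>H\<in>grow ` ?A. f (size H))"
    unfolding forests_Suc(4)[of n] using finA finite_forests forests_Suc(3)
    by (intro sum.union_disjoint) auto
  then show ?thesis
    by (simp add: grow sum.reindex[OF forests_Suc(1)] sum.distrib add.commute)
qed

lemma forests_0: "forests 0 = {{#}}"
  using forest_size(1)[of _ 0] by (auto simp: forests_def)

lemma sum_forests:
  assumes "n \<ge> 1"
  shows "(\<Sum>F\<in>forests n. f (size F)) = (\<Sum>k=1..n. of_nat (card {F \<in> forests n. size F = k}) * f k)"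
  by (intro sum_by_statistic finite_forests) (use forest_size assms in auto)

text \<open>With d = 1 the exponent c n + k of y is the number of places in existing members, and
  the single x stands for starting a new one: it gains y^(c+1), the change from (n, k) to (n + 1, k
  + 1).\<close>

lemma forests_grammar:
  assumes d: "d = 1" and D: "formal_derivative (\<x> * \<y> ^ Suc c) (\<y> ^ Suc c) D" and n: "n \<ge> 1"
  shows "(D ^^ n) \<x> =
    \<x> * (\<Sum>k=1..n. of_nat (card {F \<in> forests n. size F = k}) * \<y> ^ (c * n + k))"
proof -
  have D': "formal_derivative (\<x> * \<y> ^ Suc c) (\<y> * \<y> ^ c) D" using D by simp
  let ?m = "\<lambda>n k. \<x> * \<y> ^ (c * n + k)"
  have "D (?m n k) = of_nat (c * n + d * k) * ?m (Suc n) k + of_nat 1 * ?m (Suc n) (Suc k)" for n k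
  proof -
    have "D (\<x> ^ 1 * \<y> ^ (c * n + k)) =
        \<x> ^ 1 * \<y> ^ (c * n + k) * (of_nat 1 * \<y> ^ Suc c + of_nat (c * n + k) * \<y> ^ c)"
      by (rule formal_derivative_monomial[OF D'])
    then show ?thesis by (simp add: d power_add algebra_simps)
  qed
  then have "(D ^^ n) (\<Sum>F\<in>forests 0. ?m 0 (size F)) = (\<Sum>F\<in>forests n. ?m n (size F))"
    by (intro funpow_formal_derivative_weights[where S = forests and m = ?m and st = "\<lambda>_. size"
          and \<alpha> = "\<lambda>n k. c * n + d * k" and \<beta> = "\<lambda>n k. 1", OF D sum_forests_Suc])
  then show ?thesis
    by (simp add: sum_forests[OF n, of "?m n"] forests_0 sum_distrib_left mult.left_commute)
qed

end

subsection \<open>Set partitions\<close>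

text \<open>A block is unordered and offers one place whatever its size, hence c = 0 and d =
  1.\<close>

interpretation blocks: growing_structures
  "\<lambda>B. finite B \<and> B \<noteq> {}" mset_set "\<lambda>N. {N}" "\<lambda>N B. {insert N B}" "\<lambda>N B. B - {N}" 0 1
proof
  fix B' :: "nat set" and N L
  assume B': "finite B' \<and> B' \<noteq> {}" "mset_set B' = add_mset N L" "\<forall>a\<in>#L. a < N" "B' \<noteq> {N}"
  then have "N \<in> B'" by (metis elem_mset_set union_single_eq_member)
  then have "mset_set (B' - {N}) = L" using B' by (simp add: mset_set_Diff)
  moreover have "B' - {N} \<noteq> {}" using B'(4) \<open>N \<in> B'\<close> by auto
  ultimately show "\<exists>B. (finite B \<and> B \<noteq> {}) \<and> mset_set B = L \<and> B' \<in> {insert N B}"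
    using B' \<open>N \<in> B'\<close> by (intro exI[of _ "B' - {N}"]) auto
qed (auto simp: mset_set_empty_iff)

text \<open>That the blocks, as multisets, add up to \<open>mset_set {1..n}\<close> expresses
  covering and disjointness at once.\<close>

lemma stirling_set_eq: "stirling_set n k = card {F \<in> blocks.forests n. size F = k}"
proof -
  have "bij_betw mset_set {P. partition_on {1..n} P \<and> card P = k} {F \<in> blocks.forests n. size F = k}"
  proof (rule bij_betw_byWitness[where f' = set_mset])
    have fin: "finite P" "\<forall>B\<in>P. finite B \<and> B \<noteq> {}" if P: "partition_on {1..n} P" for P
    proof -
      show "finite P" using finite_elements[OF _ P] by simp
      have "B \<subseteq> {1..n}" "B \<noteq> {}" if "B \<in> P" for B using P that by (auto simp: partition_on_def)
      then show "\<forall>B\<in>P. finite B \<and> B \<noteq> {}" by (meson finite_atLeastAtMost finite_subset)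
    qed
    show "\<forall>P\<in>{P. partition_on {1..n} P \<and> card P = k}. set_mset (mset_set P) = P"
      using fin by simp
    show "\<forall>F\<in>{F \<in> blocks.forests n. size F = k}. mset_set (set_mset F) = F"
      using blocks.forest_eq_mset_set by auto
    have sum_blocks: "(\<Sum>B\<in>P. mset_set B) = mset_set (\<Union>P)"
      if "finite P" "disjoint P" "\<forall>B\<in>P. finite B" for P :: "nat set set"
      using that
    proof (induction P rule: finite_induct)
      case (insert B P)
      then have "B \<inter> \<Union>P = {}" by (auto simp: disjoint_def)
      moreover have "disjoint P" using insert.prems(1) by (auto simp: disjoint_def)
      ultimately show ?case using insert by (simp add: mset_set_Union)
    qed simp
    show "mset_set ` {P. partition_on {1..n} P \<and> card P = k} \<subseteq> {F \<in> blocks.forests n. size F = k}"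
    proof clarify
      fix P assume P: "partition_on {1..n} P"
      then have "(\<Sum>B\<in>#mset_set P. mset_set B) = mset_set {1..n}"
        using sum_blocks[of P] fin[OF P] by (simp add: partition_on_def sum_unfold_sum_mset)
      then show "mset_set P \<in> blocks.forests n \<and> size (mset_set P) = card P"
        using fin[OF P] by (simp add: blocks.forests_def)
    qed
    show "set_mset ` {F \<in> blocks.forests n. size F = k} \<subseteq> {P. partition_on {1..n} P \<and> card P = k}"
    proof clarify
      fix F assume F: "F \<in> blocks.forests n"
      let ?P = "set_mset F"
      have F_eq: "F = mset_set ?P" by (rule blocks.forest_eq_mset_set[OF F])
      have sum: "(\<Sum>B\<in>?P. mset_set B) = mset_set {1..n}"
        using F F_eq by (simp add: blocks.forests_def sum_unfold_sum_mset)
      have fin: "\<forall>B\<in>?P. finite B \<and> B \<noteq> {}" using F by (simp add: blocks.forests_def)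
      have "set_mset (\<Sum>B\<in>?P. mset_set B) = \<Union>?P"
        using fin by (simp add: set_mset_sum)
      then have "\<Union>?P = {1..n}" by (simp add: sum)
      \<comment> \<open>A common element of two blocks would be counted twice in the sum.\<close>
      moreover have "B \<inter> C = {}" if BC: "B \<in> ?P" "C \<in> ?P" "B \<noteq> C" for B C
      proof (rule equals0I)
        fix a assume a: "a \<in> B \<inter> C"
        have "(\<Sum>B\<in>{B, C}. count (mset_set B) a) \<le> (\<Sum>B\<in>?P. count (mset_set B) a)"
          using BC by (intro sum_mono2) auto
        also have "\<dots> = count (mset_set {1..n}) a" unfolding sum[symmetric] by (simp add: count_sum)
        also have "\<dots> \<le> 1" by (simp add: count_mset_set')
        finally show False using BC a fin by simp
      qed
      ultimately have "partition_on {1..n} ?P" using fin by (auto simp: partition_on_def disjoint_def)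
      moreover have "card ?P = size F" by (metis F_eq size_mset_set)
      ultimately show "partition_on {1..n} ?P \<and> card ?P = size F" ..
    qed
  qed
  then show ?thesis unfolding stirling_set_def by (rule bij_betw_same_card)
qed

text \<open>In k! x^(k+1) y^k each y stands for a block that may receive the new element. The factor
  k + 1 from the letters x turns k! into (k+1)!, so a new block is opened once.\<close>

lemma stirling_set_grammar:
  assumes D: "formal_derivative (\<x>^2 * \<y>) \<y> D" and n: "n \<ge> 1"
  shows "(D ^^ n) \<x> = \<x> * (\<Sum>k=1..n. fact k * of_nat (stirling_set n k) * \<x>^k * \<y>^k)"
proof -
  have D': "formal_derivative (\<x> * (\<x> * \<y>)) (\<y> * 1) D"
    using D by (simp only: power2_eq_square mult.assoc mult_1_right)
  let ?m = "\<lambda>n k. of_nat (fact k) * (\<x> ^ Suc k * \<y> ^ k)"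
  have "D (?m n k) = of_nat (0 * n + 1 * k) * ?m (Suc n) k + of_nat 1 * ?m (Suc n) (Suc k)" for n k :: nat
  proof -
    have "D (?m n k) = of_nat (fact k) *
        (\<x> ^ Suc k * \<y> ^ k * (of_nat (Suc k) * (\<x> * \<y>) + of_nat k * 1))"
      by (simp only: formal_derivative_monomial[OF D'] formal_derivative_of_nat_mult[OF D])
    also have "\<dots> = of_nat (0 * n + 1 * k) * ?m (Suc n) k + of_nat 1 * ?m (Suc n) (Suc k)"
      by (simp add: algebra_simps)
    finally show ?thesis .
  qed
  then have "(D ^^ n) (\<Sum>F\<in>blocks.forests 0. ?m 0 (size F)) = (\<Sum>F\<in>blocks.forests n. ?m n (size F))"
    by (intro funpow_formal_derivative_weights[where S = blocks.forests and m = ?m and st = "\<lambda>_. size"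
          and \<alpha> = "\<lambda>n k. 0 * n + 1 * k" and \<beta> = "\<lambda>n k. 1", OF D blocks.sum_forests_Suc])
  also have "\<dots> = (\<Sum>k=1..n. of_nat (stirling_set n k) * ?m n k)"
    unfolding stirling_set_eq by (rule blocks.sum_forests[OF n])
  finally show ?thesis
    by (simp add: blocks.forests_0 sum_distrib_left mult_ac)
qed

subsection \<open>Lists\<close>

text \<open>A list of length m has m + 1 gaps, hence c = d = 1.\<close>

interpretation ordered_lists: growing_structures
  "\<lambda>w. w \<noteq> []" mset "\<lambda>N. [N]" "\<lambda>N w. (\<lambda>i. insert_at N i w) ` {..length w}" "\<lambda>N. filter (\<lambda>a. a \<noteq> N)" 1 1
proof
  fix w w' :: "nat list" and N
  assume "\<forall>a\<in>#mset w. a < N" "w' \<in> (\<lambda>i. insert_at N i w) ` {..length w}"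
  then obtain i where w': "w' = insert_at N i w" and "N \<notin> set w" by auto
  have "filter (\<lambda>a. a \<noteq> N) w' = filter (\<lambda>a. a \<noteq> N) (take i w @ drop i w)"
    unfolding w' insert_at_def filter_append by simp
  also have "\<dots> = w" using \<open>N \<notin> set w\<close> by (auto simp: filter_id_conv)
  finally have "filter (\<lambda>a. a \<noteq> N) w' = w" .
  moreover have "w' \<noteq> []" by (simp add: w' insert_at_def)
  ultimately show "w' \<noteq> [] \<and> mset w' = add_mset N (mset w) \<and> filter (\<lambda>a. a \<noteq> N) w' = w"
    by (simp add: w')
next
  fix w' :: "nat list" and N L
  assume w': "mset w' = add_mset N L" "w' \<noteq> [N]"
  then have "N \<in> set w'" by (metis set_mset_mset union_single_eq_member)
  then obtain i w where w: "w' = insert_at N i w" "i \<le> length w" by (rule insert_at_exhaust)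
  moreover have "w \<noteq> []" using w w'(2) by (auto simp: insert_at_def)
  ultimately show "\<exists>w. w \<noteq> [] \<and> mset w = L \<and> w' \<in> (\<lambda>i. insert_at N i w) ` {..length w}"
    using w'(1) by (intro exI[of _ w]) auto
next
  fix w :: "nat list" and N
  assume "\<forall>a\<in>#mset w. a < N"
  then have "inj_on (\<lambda>i. insert_at N i w) {..length w}"
    using insert_at_inject[of N _ w N _ w id] by (auto intro!: inj_onI)
  then show "finite ((\<lambda>i. insert_at N i w) ` {..length w}) \<and>
      card ((\<lambda>i. insert_at N i w) ` {..length w}) = 1 * size (mset w) + 1"
    by (simp add: card_image)
qed auto

lemma lah_grammar:
  assumes D: "formal_derivative (\<x> * \<y>^2) (\<y>^2) D" and n: "n \<ge> 1"
  shows "(D ^^ n) \<x> = \<x> * (\<Sum>k=1..n. of_nat (lah n k) * \<y>^(n + k))"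
proof -
  have "lah n k = card {F \<in> ordered_lists.forests n. size F = k}" for k
    unfolding lah_def ordered_lists.forests_def by (rule arg_cong[where f = card]) auto
  then show ?thesis
    using ordered_lists.forests_grammar[OF _ _ n] D by (simp add: numeral_2_eq_2)
qed

subsection \<open>Plane increasing trees\<close>

text \<open>Lists of trees rather than trees are the natural domain: the root label is fixed, and at
  every vertex the new leaf goes in front of, inside or behind the first subtree.\<close>

fun insert_leaf :: "nat \<Rightarrow> plane_tree list \<Rightarrow> plane_tree list set" where
  "insert_leaf N [] = {[Plane_Node N []]}"
| "insert_leaf N (Plane_Node a us # ts) =
     insert (Plane_Node N [] # Plane_Node a us # ts)
       ((\<lambda>us'. Plane_Node a us' # ts) ` insert_leaf N us \<union>
        (\<lambda>ts'. Plane_Node a us # ts') ` insert_leaf N ts)"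

text \<open>At the label N the subtrees are dropped; after an insertion that node is a leaf, so
  nothing is lost.\<close>

fun remove_leaf :: "nat \<Rightarrow> plane_tree list \<Rightarrow> plane_tree list" where
  "remove_leaf N [] = []"
| "remove_leaf N (Plane_Node a us # ts) =
     (if a = N then ts else Plane_Node a (remove_leaf N us) # remove_leaf N ts)"

abbreviation forest_labels :: "plane_tree list \<Rightarrow> nat multiset" where
  "forest_labels ts \<equiv> (\<Sum>t\<leftarrow>ts. plane_labels t)"

abbreviation forest_increasing :: "plane_tree list \<Rightarrow> bool" where
  "forest_increasing ts \<equiv> (\<forall>t\<in>set ts. plane_increasing t)"

lemma insert_leaf_labels:
  "ts' \<in> insert_leaf N ts \<Longrightarrow> forest_labels ts' = add_mset N (forest_labels ts)"
  by (induction N ts arbitrary: ts' rule: insert_leaf.induct) auto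

lemma insert_leaf_nonempty: "[] \<notin> insert_leaf N ts"
  by (induction N ts rule: insert_leaf.induct) auto

lemma insert_leaf_roots:
  "ts' \<in> insert_leaf N ts \<Longrightarrow> root_label ` set ts' \<subseteq> insert N (root_label ` set ts)"
  by (induction N ts arbitrary: ts' rule: insert_leaf.induct) (simp, fastforce simp: image_subset_iff)

lemma insert_leaf_increasing:
  "\<lbrakk>ts' \<in> insert_leaf N ts; forest_increasing ts; \<forall>a\<in>#forest_labels ts. a < N\<rbrakk> \<Longrightarrow>
    forest_increasing ts'"
proof (induction N ts arbitrary: ts' rule: insert_leaf.induct)
  case (2 N a us ts)
  have above: "\<forall>u\<in>set us'. a < root_label u" if "us' \<in> insert_leaf N us" for us'
    using insert_leaf_roots[OF that] 2 by (auto simp: image_subset_iff)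
  have "forest_increasing us" using 2 by simp
  then show ?case using 2 above by auto
qed auto

lemma remove_leaf_idle: "N \<notin># forest_labels ts \<Longrightarrow> remove_leaf N ts = ts"
  by (induction N ts rule: remove_leaf.induct) auto

lemma remove_insert_leaf:
  "\<lbrakk>ts' \<in> insert_leaf N ts; N \<notin># forest_labels ts\<rbrakk> \<Longrightarrow> remove_leaf N ts' = ts"
  by (induction N ts arbitrary: ts' rule: insert_leaf.induct) (auto simp: remove_leaf_idle)

lemma finite_insert_leaf: "finite (insert_leaf N ts)"
  by (induction N ts rule: insert_leaf.induct) auto

lemma insert_leaf_irrefl: "ts \<notin> insert_leaf N ts"
  using insert_leaf_labels[of ts N ts] by auto

text \<open>A vertex with j children has j + 1 gaps. Over m vertices and the common root above them,
  the numbers of children add up to m, so there are m + (m + 1) gaps.\<close>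

lemma card_insert_leaf:
  "N \<notin># forest_labels ts \<Longrightarrow> card (insert_leaf N ts) = 2 * size (forest_labels ts) + 1"
proof (induction N ts rule: insert_leaf.induct)
  case (2 N a us ts)
  let ?A = "(\<lambda>us'. Plane_Node a us' # ts) ` insert_leaf N us"
  let ?B = "(\<lambda>ts'. Plane_Node a us # ts') ` insert_leaf N ts"
  \<comment> \<open>A common element would contain one of the two lists unchanged, although the
    insertion enlarges its label multiset.\<close>
  have "?A \<inter> ?B = {}" using insert_leaf_irrefl by auto
  moreover have "Plane_Node N [] # Plane_Node a us # ts \<notin> ?A \<union> ?B" using 2 by auto
  ultimately have "card (insert_leaf N (Plane_Node a us # ts)) = Suc (card ?A + card ?B)"
    by (simp add: finite_insert_leaf card_Un_disjoint)
  also have "card ?A = card (insert_leaf N us)" by (intro card_image inj_onI) simp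
  also have "card ?B = card (insert_leaf N ts)" by (intro card_image inj_onI) simp
  finally show ?case using 2 by simp
qed simp

text \<open>Labels increase downwards, so the largest label N sits on a leaf. The inclusion of root
  labels lets the condition at the parent vertex survive the removal.\<close>

lemma insert_leaf_predecessor:
  "\<lbrakk>forest_increasing ts'; forest_labels ts' = add_mset N L; \<forall>a\<in>#L. a < N\<rbrakk> \<Longrightarrow>
    \<exists>ts. forest_increasing ts \<and> root_label ` set ts \<subseteq> root_label ` set ts' \<and> ts' \<in> insert_leaf N ts"
proof (induction N ts' arbitrary: L rule: remove_leaf.induct)
  case (2 N a us ts)
  have bound: "b \<le> N" if "b \<in># forest_labels (Plane_Node a us # ts)" for b
    using that 2(4,5) by (auto simp del: sum_list.Cons list.map)
  show ?case
  proof (cases "a = N")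
    case True
    have "us = []"
    proof (cases us)
      case (Cons u us')
      then have "N < root_label u" using 2(3) True by simp
      moreover have "root_label u \<in># plane_labels u" by (cases u) simp
      then have "root_label u \<le> N" using bound by (simp add: Cons)
      ultimately show ?thesis by simp
    qed
    moreover have "Plane_Node N [] # ts \<in> insert_leaf N ts"
    proof (cases ts)
      case (Cons t ts')
      then show ?thesis by (cases t) simp
    qed simp
    ultimately show ?thesis using 2(3) True by (intro exI[of _ ts]) auto
  next
    case False
    have labels: "add_mset a (forest_labels us + forest_labels ts) = add_mset N L"
      using 2(4) by simp
    then have "N \<in># add_mset a (forest_labels us + forest_labels ts)" by simp
    then consider "N \<in># forest_labels us" | "N \<in># forest_labels ts" using False by auto
    then show ?thesis
    proof cases
      case 1
      then obtain L' where L': "forest_labels us = add_mset N L'" by (metis insert_DiffM)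
      have "L = add_mset a (L' + forest_labels ts)" using labels L' by (simp add: add_mset_commute)
      then obtain us0 where us0: "forest_increasing us0" "root_label ` set us0 \<subseteq> root_label ` set us"
        "us \<in> insert_leaf N us0"
        using 2(1)[OF False _ L'] 2(3,5) by auto
      have "\<forall>u\<in>set us0. a < root_label u" using us0(2) 2(3) by (auto simp: image_subset_iff)
      then show ?thesis
        using us0 2(3) by (intro exI[of _ "Plane_Node a us0 # ts"]) auto
    next
      case 2
      then obtain L' where L': "forest_labels ts = add_mset N L'" by (metis insert_DiffM)
      have "L = add_mset a (forest_labels us + L')" using labels L' by (simp add: add_mset_commute)
      then obtain ts0 where ts0: "forest_increasing ts0" "root_label ` set ts0 \<subseteq> root_label ` set ts"
        "ts \<in> insert_leaf N ts0"
        using "2.IH"(2)[OF False _ L'] "2.prems" by auto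
      then show ?thesis
        using "2.prems" by (intro exI[of _ "Plane_Node a us # ts0"]) auto
    qed
  qed
qed simp

text \<open>The 2m + 1 gaps below the root 0 give c = 2 and d = 1. The smallest structure already
  has one non-root vertex.\<close>

interpretation organic: growing_structures
  "\<lambda>t. root_label t = 0 \<and> subtrees t \<noteq> [] \<and> plane_increasing t" nonroot_labels
  "\<lambda>N. Plane_Node 0 [Plane_Node N []]" "\<lambda>N t. Plane_Node 0 ` insert_leaf N (subtrees t)"
  "\<lambda>N t. Plane_Node 0 (remove_leaf N (subtrees t))" 2 1
proof
  fix t assume "root_label t = 0 \<and> subtrees t \<noteq> [] \<and> plane_increasing t"
  then obtain u us where "subtrees t = u # us" by (cases "subtrees t") auto
  moreover have "plane_labels u \<noteq> {#}" by (cases u) simp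
  ultimately show "nonroot_labels t \<noteq> {#}" by (simp add: nonroot_labels_def)
next
  fix t t' N
  assume t: "root_label t = 0 \<and> subtrees t \<noteq> [] \<and> plane_increasing t"
    and N: "\<forall>a\<in>#nonroot_labels t. a < N" and t': "t' \<in> Plane_Node 0 ` insert_leaf N (subtrees t)"
  obtain ts where ts: "t = Plane_Node 0 ts" using t by (cases t) auto
  obtain ts' where ts': "t' = Plane_Node 0 ts'" "ts' \<in> insert_leaf N ts" using t' by (auto simp: ts)
  have N': "\<forall>a\<in>#forest_labels ts. a < N" using N by (simp add: nonroot_labels_def ts)
  obtain u us where u: "ts = u # us" using t ts by (cases ts) auto
  have "root_label u \<in># plane_labels u" by (cases u) simp
  then have "root_label u < N" using N' by (simp add: u)
  \<comment> \<open>The new leaf may hang directly below the root, whose label is 0.\<close>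
  then have "N > 0" by simp
  then have "\<forall>u\<in>set ts'. 0 < root_label u"
    using insert_leaf_roots[OF ts'(2)] t by (auto simp: ts image_subset_iff)
  moreover have "ts' \<noteq> []" using insert_leaf_nonempty ts'(2) by metis
  moreover have "forest_increasing ts'" using insert_leaf_increasing[OF ts'(2)] N' t by (simp add: ts)
  moreover have "remove_leaf N ts' = ts" using remove_insert_leaf[OF ts'(2)] N' by blast
  ultimately show "(root_label t' = 0 \<and> subtrees t' \<noteq> [] \<and> plane_increasing t') \<and>
      nonroot_labels t' = add_mset N (nonroot_labels t) \<and>
      Plane_Node 0 (remove_leaf N (subtrees t')) = t"
    using insert_leaf_labels[OF ts'(2)] by (simp add: ts ts'(1) nonroot_labels_def)
next
  fix t' N L
  assume t': "root_label t' = 0 \<and> subtrees t' \<noteq> [] \<and> plane_increasing t'"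
    "nonroot_labels t' = add_mset N L" "\<forall>a\<in>#L. a < N" "t' \<noteq> Plane_Node 0 [Plane_Node N []]"
  obtain ts' where ts': "t' = Plane_Node 0 ts'" using t' by (cases t') auto
  obtain ts where ts: "forest_increasing ts" "root_label ` set ts \<subseteq> root_label ` set ts'"
    "ts' \<in> insert_leaf N ts"
    using insert_leaf_predecessor[of ts' N L] t' by (auto simp: ts' nonroot_labels_def)
  have "ts \<noteq> []" using ts(3) t'(4) by (auto simp: ts')
  moreover have "\<forall>u\<in>set ts. 0 < root_label u" using ts(2) t'(1) by (auto simp: ts' image_subset_iff)
  moreover have "forest_labels ts = L"
    using insert_leaf_labels[OF ts(3)] t'(2) by (simp add: ts' nonroot_labels_def)
  ultimately show "\<exists>t. (root_label t = 0 \<and> subtrees t \<noteq> [] \<and> plane_increasing t) \<and>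
      nonroot_labels t = L \<and> t' \<in> Plane_Node 0 ` insert_leaf N (subtrees t)"
    using ts by (intro exI[of _ "Plane_Node 0 ts"]) (simp add: ts' nonroot_labels_def)
next
  fix t N assume N: "\<forall>a\<in>#nonroot_labels t. a < N"
  have "N \<notin># forest_labels (subtrees t)" using N by (auto simp: nonroot_labels_def)
  moreover have "card (Plane_Node 0 ` insert_leaf N (subtrees t)) = card (insert_leaf N (subtrees t))"
    by (intro card_image inj_onI) simp
  ultimately show "finite (Plane_Node 0 ` insert_leaf N (subtrees t)) \<and>
      card (Plane_Node 0 ` insert_leaf N (subtrees t)) = 2 * size (nonroot_labels t) + 1"
    by (simp add: finite_insert_leaf card_insert_leaf nonroot_labels_def)
qed (auto simp: nonroot_labels_def)

lemma organic_forests_grammar: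
  assumes D: "formal_derivative (\<x> * \<y>^3) (\<y>^3) D" and n: "n \<ge> 1"
  shows "(D ^^ n) \<x> = \<x> * (\<Sum>k=1..n. of_nat (card (organic_forests n k)) * \<y>^(2*n + k))"
proof -
  have "organic_forests n k = {F \<in> organic.forests n. size F = k}" for k
    unfolding organic_forests_def organic.forests_def by auto
  then show ?thesis
    using organic.forests_grammar[OF _ _ n] D by (simp add: numeral_3_eq_3 numeral_2_eq_2)
qed

subsection \<open>Increasing r-ary trees\<close>

text \<open>The new node fills one empty child position; the companion function on lists changes
  exactly one entry.\<close>

fun rary_insert :: "nat \<Rightarrow> nat \<Rightarrow> rary_tree \<Rightarrow> rary_tree set"
  and rary_insert_list :: "nat \<Rightarrow> nat \<Rightarrow> rary_tree list \<Rightarrow> rary_tree list set" where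
  "rary_insert r N Empty = {Rary_Node N (replicate r Empty)}"
| "rary_insert r N (Rary_Node a ts) = Rary_Node a ` rary_insert_list r N ts"
| "rary_insert_list r N [] = {}"
| "rary_insert_list r N (t # ts) =
     (\<lambda>t'. t' # ts) ` rary_insert r N t \<union> (\<lambda>ts'. t # ts') ` rary_insert_list r N ts"

fun rary_remove :: "nat \<Rightarrow> rary_tree \<Rightarrow> rary_tree" where
  "rary_remove N Empty = Empty"
| "rary_remove N (Rary_Node a ts) = (if a = N then Empty else Rary_Node a (map (rary_remove N) ts))"

lemma sum_list_replicate_empty: "sum_list (replicate m {#}) = {#}"
  by (induction m) simp_all

lemma rary_insert_labels:
  "t' \<in> rary_insert r N t \<Longrightarrow> rary_labels t' = add_mset N (rary_labels t)"
  "ts' \<in> rary_insert_list r N ts \<Longrightarrow>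
    (\<Sum>t\<leftarrow>ts'. rary_labels t) = add_mset N (\<Sum>t\<leftarrow>ts. rary_labels t)"
  by (induction r N t and r N ts arbitrary: t' and ts' rule: rary_insert_rary_insert_list.induct)
    (auto simp: sum_list_replicate_empty)

lemma rary_insert_rary:
  "t' \<in> rary_insert r N t \<Longrightarrow> rary r t \<Longrightarrow> rary r t'"
  "ts' \<in> rary_insert_list r N ts \<Longrightarrow> \<forall>t\<in>set ts. rary r t \<Longrightarrow>
    length ts' = length ts \<and> (\<forall>t\<in>set ts'. rary r t)"
  by (induction r N t and r N ts arbitrary: t' and ts' rule: rary_insert_rary_insert_list.induct)
    auto

lemma rary_insert_root:
  "t' \<in> rary_insert r N t \<Longrightarrow> t' \<noteq> Empty"
  "t' \<in> rary_insert r N t \<Longrightarrow> a < N \<Longrightarrow> root_above a t \<Longrightarrow> root_above a t'"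
  by (cases t; auto)+

lemma rary_insert_increasing:
  "\<lbrakk>t' \<in> rary_insert r N t; rary_increasing t; \<forall>a\<in>#rary_labels t. a < N\<rbrakk> \<Longrightarrow> rary_increasing t'"
  "\<lbrakk>ts' \<in> rary_insert_list r N ts; \<forall>t\<in>set ts. rary_increasing t;
    \<forall>a\<in>#(\<Sum>t\<leftarrow>ts. rary_labels t). a < N\<rbrakk> \<Longrightarrow>
    (\<forall>t\<in>set ts'. rary_increasing t) \<and>
    (\<forall>a<N. (\<forall>t\<in>set ts. root_above a t) \<longrightarrow> (\<forall>t\<in>set ts'. root_above a t))"
  by (induction r N t and r N ts arbitrary: t' and ts' rule: rary_insert_rary_insert_list.induct)
    (auto simp: rary_insert_root)

lemma rary_remove_idle: "N \<notin># rary_labels t \<Longrightarrow> rary_remove N t = t"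
  by (induction N t rule: rary_remove.induct) (auto intro: map_idI)

lemma rary_remove_insert:
  "\<lbrakk>t' \<in> rary_insert r N t; N \<notin># rary_labels t\<rbrakk> \<Longrightarrow> rary_remove N t' = t"
  "\<lbrakk>ts' \<in> rary_insert_list r N ts; N \<notin># (\<Sum>t\<leftarrow>ts. rary_labels t)\<rbrakk> \<Longrightarrow> map (rary_remove N) ts' = ts"
proof (induction r N t and r N ts arbitrary: t' and ts' rule: rary_insert_rary_insert_list.induct)
  case (4 r N t ts)
  then have "map (rary_remove N) ts = ts"
    by (intro map_idI rary_remove_idle) auto
  then show ?case using 4 by (auto simp: rary_remove_idle)
qed auto

lemma finite_rary_insert: "finite (rary_insert r N t)" "finite (rary_insert_list r N ts)"
  by (induction r N t and r N ts rule: rary_insert_rary_insert_list.induct) auto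

text \<open>Of the r m child positions of a tree with m >= 1 nodes, m - 1 are occupied, which leaves
  (r - 1) m + 1. The empty tree counts as one free position, so in a list every entry contributes an
  extra 1.\<close>

lemma card_rary_insert:
  shows "\<lbrakk>r > 0; rary r t; N \<notin># rary_labels t\<rbrakk> \<Longrightarrow>
      card (rary_insert r N t) = (r - 1) * size (rary_labels t) + 1"
    and "\<lbrakk>r > 0; \<forall>t\<in>set ts. rary r t; N \<notin># (\<Sum>t\<leftarrow>ts. rary_labels t)\<rbrakk> \<Longrightarrow>
      card (rary_insert_list r N ts) = (r - 1) * size (\<Sum>t\<leftarrow>ts. rary_labels t) + length ts"
proof (induction r N t and r N ts rule: rary_insert_rary_insert_list.induct)
  case (2 r N a ts)
  have "card (rary_insert r N (Rary_Node a ts)) = card (rary_insert_list r N ts)"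
    by (simp add: card_image inj_on_def)
  then show ?case using 2 by (cases r) (simp_all add: algebra_simps)
next
  case (4 r N t ts)
  let ?A = "(\<lambda>t'. t' # ts) ` rary_insert r N t" and ?B = "(\<lambda>ts'. t # ts') ` rary_insert_list r N ts"
  have "t \<notin> rary_insert r N t" using rary_insert_labels(1)[of t r N t] by auto
  then have "?A \<inter> ?B = {}" by auto
  then have "card (rary_insert_list r N (t # ts)) = card ?A + card ?B"
    by (simp add: finite_rary_insert card_Un_disjoint)
  also have "card ?A = card (rary_insert r N t)" by (intro card_image inj_onI) simp
  also have "card ?B = card (rary_insert_list r N ts)" by (intro card_image inj_onI) simp
  finally show ?case using 4 by (cases r) (simp_all add: algebra_simps)
qed auto

lemma rary_insert_list_update:
  "\<lbrakk>i < length ts; t \<in> rary_insert r N t0; ts ! i = t\<rbrakk> \<Longrightarrow> ts \<in> rary_insert_list r N (ts[i := t0])"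
  by (induction ts arbitrary: i) (auto simp: nth_Cons split: nat.splits)

text \<open>The largest label N has only empty positions below it, so its node can be replaced by
  \<open>Empty\<close>. Carrying \<open>root_above\<close> along keeps the tree increasing at the
  parent.\<close>

lemma rary_insert_predecessor:
  "\<lbrakk>rary r t'; rary_increasing t'; rary_labels t' = add_mset N L; \<forall>a\<in>#L. a < N\<rbrakk> \<Longrightarrow>
    \<exists>t. rary r t \<and> rary_increasing t \<and> (\<forall>a. root_above a t' \<longrightarrow> root_above a t) \<and> t' \<in> rary_insert r N t"
proof (induction t' arbitrary: L)
  case (Rary_Node a ts)
  have bound: "b \<le> N" if "b \<in># rary_labels (Rary_Node a ts)" for b
    using that Rary_Node.prems(3,4) by (auto simp del: rary_labels.simps)
  show ?case
  proof (cases "a = N")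
    case True
    have "t = Empty" if "t \<in> set ts" for t
    proof (cases t)
      case (Rary_Node b us)
      then have "b \<in># rary_labels (Rary_Node a ts)"
        using that by (auto intro!: bexI[of _ t])
      then have "b \<le> N" by (rule bound)
      moreover have "N < b" using Rary_Node that \<open>rary_increasing (Rary_Node a ts)\<close> True by auto
      ultimately show ?thesis by simp
    qed
    then have "ts = replicate r Empty"
      using Rary_Node.prems(1) by (metis rary.simps(2) replicate_length_same)
    then show ?thesis using True by (intro exI[of _ Empty]) simp
  next
    case False
    have "N \<in># rary_labels (Rary_Node a ts)" unfolding Rary_Node.prems(3) by simp
    then obtain t where t: "t \<in> set ts" "N \<in># rary_labels t"
      using False by auto
    then obtain i where i: "i < length ts" "ts ! i = t" by (metis in_set_conv_nth)
    obtain L' where L': "rary_labels t = add_mset N L'" using t(2) by (metis insert_DiffM)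
    have "rary_labels t \<subseteq># (\<Sum>t\<leftarrow>ts. rary_labels t)"
      using t(1) by (induction ts) (auto intro: subset_mset.order_trans)
    then have "add_mset N L' \<subseteq># rary_labels (Rary_Node a ts)"
      unfolding L' by (auto intro: subset_mset.order_trans)
    then have "L' \<subseteq># L" unfolding Rary_Node.prems(3) by simp
    then have "\<forall>a\<in>#L'. a < N" using Rary_Node.prems(4) by (meson mset_subset_eqD)
    then obtain t0 where t0: "rary r t0" "rary_increasing t0"
      "\<forall>a. root_above a t \<longrightarrow> root_above a t0" "t \<in> rary_insert r N t0"
      using Rary_Node.IH[OF t(1) _ _ L'] Rary_Node.prems(1,2) t(1) by auto
    have "set (ts[i := t0]) \<subseteq> insert t0 (set ts)" by (rule set_update_subset_insert)
    then have "rary r (Rary_Node a (ts[i := t0]))" "rary_increasing (Rary_Node a (ts[i := t0]))"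
      using t0 t(1) Rary_Node.prems(1,2) by auto
    moreover have "Rary_Node a ts \<in> rary_insert r N (Rary_Node a (ts[i := t0]))"
      using rary_insert_list_update[OF i(1) t0(4) i(2)] by simp
    ultimately show ?thesis by (intro exI[of _ "Rary_Node a (ts[i := t0])"]) simp
  qed
qed simp

text \<open>The arity is a variable subject to r > 0, so the locale is instantiated only inside
  proofs that have this hypothesis.\<close>

lemma growing_rary:
  assumes r: "r > 0"
  shows "growing_structures (\<lambda>t. t \<noteq> Empty \<and> rary r t \<and> rary_increasing t) rary_labels
    (\<lambda>N. Rary_Node N (replicate r Empty)) (rary_insert r) rary_remove (r - 1) 1"
proof
  show "rary_labels t \<noteq> {#}" if "t \<noteq> Empty \<and> rary r t \<and> rary_increasing t" for t
    using that by (cases t) auto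
next
  fix t t' N
  assume t: "t \<noteq> Empty \<and> rary r t \<and> rary_increasing t" "\<forall>a\<in>#rary_labels t. a < N"
    "t' \<in> rary_insert r N t"
  have "N \<notin># rary_labels t" using t(2) by blast
  then show "(t' \<noteq> Empty \<and> rary r t' \<and> rary_increasing t') \<and>
      rary_labels t' = add_mset N (rary_labels t) \<and> rary_remove N t' = t"
    using t rary_insert_root(1)[OF t(3)] rary_insert_rary(1)[OF t(3)] rary_insert_increasing(1)[OF t(3)]
      rary_insert_labels(1)[OF t(3)] rary_remove_insert(1)[OF t(3)] by blast
next
  fix t' N L
  assume t': "t' \<noteq> Empty \<and> rary r t' \<and> rary_increasing t'" "rary_labels t' = add_mset N L"
    "\<forall>a\<in>#L. a < N" "t' \<noteq> Rary_Node N (replicate r Empty)"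
  then obtain t where t: "rary r t" "rary_increasing t" "t' \<in> rary_insert r N t"
    using rary_insert_predecessor[of r t' N L] by blast
  moreover have "t \<noteq> Empty" using t(3) t'(4) by auto
  moreover have "rary_labels t = L" using rary_insert_labels(1)[OF t(3)] t'(2) by simp
  ultimately show "\<exists>t. (t \<noteq> Empty \<and> rary r t \<and> rary_increasing t) \<and> rary_labels t = L \<and>
      t' \<in> rary_insert r N t" by blast
next
  fix t N assume "t \<noteq> Empty \<and> rary r t \<and> rary_increasing t" "\<forall>a\<in>#rary_labels t. a < N"
  then show "finite (rary_insert r N t) \<and>
      card (rary_insert r N t) = (r - 1) * size (rary_labels t) + 1"
    using card_rary_insert(1)[OF r, of t N] by (auto simp: finite_rary_insert)
qed (auto simp: sum_list_replicate_empty)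

lemma rary_forests_grammar:
  assumes r: "r > 0" and D: "formal_derivative (\<x> * \<y>^r) (\<y>^r) D" and n: "n \<ge> 1"
  shows "(D ^^ n) \<x> = \<x> * (\<Sum>k=1..n. of_nat (card (rary_forests r n k)) * \<y>^((r - 1)*n + k))"
proof -
  interpret growing_structures "\<lambda>t. t \<noteq> Empty \<and> rary r t \<and> rary_increasing t" rary_labels
    "\<lambda>N. Rary_Node N (replicate r Empty)" "rary_insert r" rary_remove "r - 1" 1
    by (rule growing_rary[OF r])
  have "rary_forests r n k = {F \<in> forests n. size F = k}" for k
    unfolding rary_forests_def forests_def by auto
  then show ?thesis
    using forests_grammar[OF refl _ n] D r by simp
qed

section \<open>Cycles and mobiles\<close>

text \<open>
  Composing with \<open>transpose a b\<close> inserts the fixed point \<open>a\<close> right before \<open>b\<close> into the cycle of \<open>b\<close>.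
\<close>

lemma orbit_transpose_comp:
  assumes q: "q permutes S" and S: "finite S" and a: "a \<notin> S" and b: "b \<in> S"
  shows "x \<in> S \<Longrightarrow> orbit (transpose a b \<circ> q) x =
      (if b \<in> orbit q x then insert a (orbit q x) else orbit q x)"
    and "orbit (transpose a b \<circ> q) a = insert a (orbit q b)"
proof -
  define p where "p = transpose a b \<circ> q"
  have p: "p a = b" "\<And>y. y \<in> S \<Longrightarrow> p y = (if q y = b then a else q y)"
    using a b permutes_not_in[OF q a] permutes_in_image[OF q]
    by (auto simp: p_def transpose_def)
  have sub: "orbit q x \<subseteq> S" if "x \<in> S" for x using permutes_orbit_subset[OF q that] .
  \<comment> \<open>A path of p follows the path of q, with a detour through a whenever q enters
    b.\<close>
  have fwd: "y \<in> orbit p x" if x: "x \<in> S" and y: "y \<in> orbit q x" for x y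
    using y
  proof induction
    case base
    have "a \<in> orbit p x" if "q x = b" using orbit.base[of p x] p(2)[OF x] that by simp
    then show ?case using orbit.base[of p x] orbit.step[of a p x] p(1) p(2)[OF x] by (cases "q x = b") auto
  next
    case (step y)
    then have y: "y \<in> S" using sub[OF x] by auto
    have "a \<in> orbit p x" if "q y = b" using orbit.step[OF step.IH] p(2)[OF y] that by simp
    then show ?case using orbit.step[OF step.IH] orbit.step[of a p x] p(1) p(2)[OF y] by (cases "q y = b") auto
  qed
  have bwd: "y \<in> orbit q x \<or> y = a \<and> b \<in> orbit q x" if x: "x \<in> S" and y: "y \<in> orbit p x" for x y
    using y
  proof induction
    case base
    then show ?case using p(2)[OF x] orbit.base[of q x] by (auto split: if_splits)
  next
    case (step y)
    show ?case
    proof (cases "y = a")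
      case True
      then show ?thesis using step.IH p(1) a sub[OF x] by auto
    next
      case False
      then have y: "y \<in> orbit q x" "y \<in> S" using step.IH sub[OF x] by auto
      then show ?thesis using p(2)[OF y(2)] orbit.step[OF y(1)] by (auto split: if_splits)
    qed
  qed
  have ins: "a \<in> orbit p x" if x: "x \<in> S" and "b \<in> orbit q x" for x
    using that(2)
  proof cases
    case base
    then show ?thesis using orbit.base[of p x] p(2)[OF x] by simp
  next
    case (step y)
    then show ?thesis using orbit.step[OF fwd[OF x step(2)]] p(2)[of y] sub[OF x] by auto
  qed
  have orb: "orbit p x = (if b \<in> orbit q x then insert a (orbit q x) else orbit q x)" if "x \<in> S" for x
    using fwd[OF that] bwd[OF that] ins[OF that] by auto
  show "x \<in> S \<Longrightarrow> orbit (transpose a b \<circ> q) x =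
      (if b \<in> orbit q x then insert a (orbit q x) else orbit q x)"
    using orb unfolding p_def .
  have "b \<in> orbit q b"
    using q S by (intro permutation_self_in_orbit) (auto simp: permutation_permutes)
  then have pb: "orbit p b = insert a (orbit q b)" using orb[OF b] by simp
  have "permutation p"
    unfolding p_def using q S by (intro permutation_compose permutation_swap_id) (auto simp: permutation_permutes)
  \<comment> \<open>The orbit of b under p contains a, and for a permutation all points of a cycle
    have the same orbit.\<close>
  then have "orbit p a = orbit p b"
    using pb by (intro orbit_cyclic_eq3[OF cyclic_on_orbit']) auto
  then show "orbit (transpose a b \<circ> q) a = insert a (orbit q b)"
    unfolding p_def[symmetric] by (simp add: pb)
qed

lemma orbit_fixed_point: "f a = a \<Longrightarrow> orbit f a = {a}"
  by (simp add: orbit_eq_singleton_iff)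

text \<open>For b = a the transposition is the identity and a is a new fixed point. Otherwise a
  joins the cycle of b, and enlarging that one cycle is injective on the set of cycles.\<close>

lemma card_orbits_transpose_comp:
  assumes q: "q permutes S" and S: "finite S" and a: "a \<notin> S" and b: "b \<in> insert a S"
  shows "card (orbit (transpose a b \<circ> q) ` insert a S) = card (orbit q ` S) + of_bool (b = a)"
proof -
  have sub: "orbit q x \<subseteq> S" if "x \<in> S" for x using permutes_orbit_subset[OF q that] .
  show ?thesis
  proof (cases "b = a")
    case True
    have "orbit q a = {a}" using permutes_not_in[OF q a] by (rule orbit_fixed_point)
    moreover have "{a} \<notin> orbit q ` S" using sub a by auto
    ultimately show ?thesis using True S by simp
  next
    case False
    then have bS: "b \<in> S" using b by simp
    let ?h = "\<lambda>X. if b \<in> X then insert a X else X"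
    have "b \<in> orbit q b"
      using q S by (intro permutation_self_in_orbit) (auto simp: permutation_permutes)
    then have "orbit (transpose a b \<circ> q) a = ?h (orbit q b)"
      using orbit_transpose_comp(2)[OF q S a bS] by simp
    moreover have "orbit (transpose a b \<circ> q) ` S = ?h ` orbit q ` S"
      unfolding image_image by (intro image_cong refl orbit_transpose_comp(1)[OF q S a bS])
    ultimately have "orbit (transpose a b \<circ> q) ` insert a S = ?h ` orbit q ` S"
      using bS by auto
    moreover have "inj_on ?h (orbit q ` S)"
    proof (rule inj_onI)
      fix X Y assume XY: "X \<in> orbit q ` S" "Y \<in> orbit q ` S" "?h X = ?h Y"
      have "a \<notin> X" "a \<notin> Y" using XY(1,2) sub a by auto
      then have "X = ?h X - {a}" "Y = ?h Y - {a}" by auto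
      then show "X = Y" using XY(3) by metis
    qed
    ultimately show ?thesis using False by (simp only: card_image) simp
  qed
qed

section \<open>Permutations counted by cycles\<close>

abbreviation cycle_count :: "nat \<Rightarrow> (nat \<Rightarrow> nat) \<Rightarrow> nat" where
  "cycle_count n \<pi> \<equiv> card (orbit \<pi> ` {1..n})"

text \<open>Before each of the n old elements the new one enters an existing cycle; as a fixed point
  it opens a new one.\<close>

lemma sum_permutations_Suc:
  fixes f :: "nat \<Rightarrow> 'a::comm_semiring_1"
  shows "(\<Sum>\<pi>\<in>{\<pi>. \<pi> permutes {1..Suc n}}. f (cycle_count (Suc n) \<pi>)) =
    (\<Sum>\<pi>\<in>{\<pi>. \<pi> permutes {1..n}}.
       of_nat n * f (cycle_count n \<pi>) + of_nat 1 * f (Suc (cycle_count n \<pi>)))"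
proof -
  have S: "{1..Suc n} = insert (Suc n) {1..n}" by auto
  have "(\<Sum>b\<in>insert (Suc n) {1..n}. f (card (orbit (transpose (Suc n) b \<circ> \<pi>) ` insert (Suc n) {1..n}))) =
      of_nat n * f (cycle_count n \<pi>) + of_nat 1 * f (Suc (cycle_count n \<pi>))"
    if \<pi>: "\<pi> permutes {1..n}" for \<pi>
  proof -
    have "(\<Sum>b\<in>insert (Suc n) {1..n}. f (card (orbit (transpose (Suc n) b \<circ> \<pi>) ` insert (Suc n) {1..n}))) =
      (\<Sum>b\<in>insert (Suc n) {1..n}. f (cycle_count n \<pi> + of_bool (b = Suc n)))"
      by (intro sum.cong refl, subst card_orbits_transpose_comp[OF \<pi>]) auto
    also have "\<dots> = f (Suc (cycle_count n \<pi>)) + (\<Sum>b\<in>{1..n}. f (cycle_count n \<pi> + of_bool (b = Suc n)))"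
      by simp
    also have "(\<Sum>b\<in>{1..n}. f (cycle_count n \<pi> + of_bool (b = Suc n))) = (\<Sum>b\<in>{1..n}. f (cycle_count n \<pi>))"
      by (intro sum.cong) auto
    also have "\<dots> = of_nat n * f (cycle_count n \<pi>)" by simp
    finally show ?thesis by (simp only: of_nat_1 mult_1_left add.commute)
  qed
  note insert_all = this
  have "(\<Sum>\<pi>\<in>{\<pi>. \<pi> permutes insert (Suc n) {1..n}}. f (card (orbit \<pi> ` insert (Suc n) {1..n}))) =
      (\<Sum>b\<in>insert (Suc n) {1..n}. \<Sum>\<pi>\<in>{\<pi>. \<pi> permutes {1..n}}.
        f (card (orbit (transpose (Suc n) b \<circ> \<pi>) ` insert (Suc n) {1..n})))"
    by (rule sum_over_permutations_insert) auto
  also have "\<dots> = (\<Sum>\<pi>\<in>{\<pi>. \<pi> permutes {1..n}}. \<Sum>b\<in>insert (Suc n) {1..n}.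
        f (card (orbit (transpose (Suc n) b \<circ> \<pi>) ` insert (Suc n) {1..n})))"
    by (rule sum.swap)
  also have "\<dots> = (\<Sum>\<pi>\<in>{\<pi>. \<pi> permutes {1..n}}.
       of_nat n * f (cycle_count n \<pi>) + of_nat 1 * f (Suc (cycle_count n \<pi>)))"
    by (intro sum.cong refl insert_all) (simp only: mem_Collect_eq)
  finally show ?thesis
    unfolding S .
qed

text \<open>In k! x^(k+1) y^n the letters y are the old elements before which the new one can enter
  a cycle; the factor k + 1 from the letters x is absorbed into the factorial.\<close>

lemma stirling_cycle_grammar:
  assumes D: "formal_derivative (\<x>^2 * \<y>) (\<y>^2) D" and n: "n \<ge> 1"
  shows "(D ^^ n) \<x> = \<x> * (\<Sum>k=1..n. fact k * of_nat (stirling_cycle n k) * \<x>^k * \<y>^n)"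
proof -
  have D': "formal_derivative (\<x> * (\<x> * \<y>)) (\<y> * \<y>) D"
    using D by (simp only: power2_eq_square mult.assoc)
  let ?m = "\<lambda>n k. of_nat (fact k) * (\<x> ^ Suc k * \<y> ^ n)"
  let ?S = "\<lambda>n. {\<pi>. \<pi> permutes {1..n::nat}}"
  have "D (?m n k) = of_nat n * ?m (Suc n) k + of_nat 1 * ?m (Suc n) (Suc k)" for n k :: nat
  proof -
    have "D (?m n k) = of_nat (fact k) *
        (\<x> ^ Suc k * \<y> ^ n * (of_nat (Suc k) * (\<x> * \<y>) + of_nat n * \<y>))"
      by (simp only: formal_derivative_monomial[OF D'] formal_derivative_of_nat_mult[OF D])
    also have "\<dots> = of_nat n * ?m (Suc n) k + of_nat 1 * ?m (Suc n) (Suc k)"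
      by (simp add: algebra_simps)
    finally show ?thesis .
  qed
  then have "(D ^^ n) (\<Sum>\<pi>\<in>?S 0. ?m 0 (cycle_count 0 \<pi>)) = (\<Sum>\<pi>\<in>?S n. ?m n (cycle_count n \<pi>))"
    by (intro funpow_formal_derivative_weights[where S = ?S and m = ?m and st = cycle_count
          and \<alpha> = "\<lambda>n k. n" and \<beta> = "\<lambda>n k. 1", OF D sum_permutations_Suc])
  also have "\<dots> = (\<Sum>k=1..n. of_nat (card {\<pi> \<in> ?S n. cycle_count n \<pi> = k}) * ?m n k)"
  proof (intro sum_by_statistic)
    show "finite (?S n)" by (simp add: finite_permutations)
    fix \<pi> :: "nat \<Rightarrow> nat"
    have "cycle_count n \<pi> \<le> n" using card_image_le[of "{1..n}" "orbit \<pi>"] by simp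
    moreover have "cycle_count n \<pi> > 0" using n by (simp add: card_gt_0_iff)
    ultimately show "cycle_count n \<pi> \<in> {1..n}" by simp
  qed simp
  also have "\<dots> = (\<Sum>k=1..n. of_nat (stirling_cycle n k) * ?m n k)"
    by (simp add: stirling_cycle_def)
  finally show ?thesis
    by (simp add: sum_distrib_left mult_ac)
qed

section \<open>Mobiles counted by leaves\<close>

text \<open>A cyclic order of j >= 1 children has j gaps, one before each child, and a leaf offers
  one place. So the places are the leaves and the nonroot nodes.\<close>

definition mobile_places :: "nat \<Rightarrow> (nat \<Rightarrow> nat) \<times> (nat \<Rightarrow> nat) \<Rightarrow> (nat + nat) set" where
  "mobile_places m = (\<lambda>(par, \<sigma>). Inl ` mobile_leaves m par \<union> Inr ` {2..m})"

text \<open>The new node becomes the only child of a leaf or is placed right before an old nonroot node.\<close>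

definition mobile_grow ::
  "nat \<Rightarrow> (nat \<Rightarrow> nat) \<times> (nat \<Rightarrow> nat) \<Rightarrow> nat + nat \<Rightarrow> (nat \<Rightarrow> nat) \<times> (nat \<Rightarrow> nat)" where
  "mobile_grow N = (\<lambda>(par, \<sigma>) c. case c of
     Inl l \<Rightarrow> (par(N := l), \<sigma>)
   | Inr b \<Rightarrow> (par(N := par b), transpose N b \<circ> \<sigma>))"

text \<open>The largest node N has no children because parents are smaller. If it is fixed by the
  permutation, it is an only child and its removal makes the parent a leaf; otherwise its successor
  b marks the gap.\<close>

lemma increasing_mobiles_Suc:
  assumes m: "m \<ge> 1"
  shows "bij_betw (\<lambda>(M, c). mobile_grow (Suc m) M c)
    (Sigma (increasing_mobiles m) (mobile_places m)) (increasing_mobiles (Suc m))"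
proof (rule bij_betw_imageI)
  let ?N = "Suc m"
  let ?A = "Sigma (increasing_mobiles m) (mobile_places m)"
  let ?f = "\<lambda>(M, c). mobile_grow ?N M c"
  have S: "{2..?N} = insert ?N {2..m}" "?N \<notin> {2..m}" using m by auto
  have old: "\<sigma> permutes {2..m}" "\<sigma> ?N = ?N" "par ?N = undefined"
      "\<And>i. i \<in> {2..m} \<Longrightarrow> orbit \<sigma> i = {j \<in> {2..m}. par j = par i}"
      "\<And>i. i \<in> {2..m} \<Longrightarrow> par i \<in> {1..m} \<and> par i < i" "par \<in> extensional {2..m}"
    if "(par, \<sigma>) \<in> increasing_mobiles m" for par \<sigma>
  proof -
    show \<sigma>: "\<sigma> permutes {2..m}" and "\<And>i. i \<in> {2..m} \<Longrightarrow> orbit \<sigma> i = {j \<in> {2..m}. par j = par i}"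
      "\<And>i. i \<in> {2..m} \<Longrightarrow> par i \<in> {1..m} \<and> par i < i" and ext: "par \<in> extensional {2..m}"
      using that by (auto simp: increasing_mobiles_def PiE_iff)
    show "\<sigma> ?N = ?N" using \<sigma> by (rule permutes_not_in) simp
    show "par ?N = undefined" using ext by (simp add: extensional_def)
  qed
  show "inj_on ?f ?A"
  proof (rule inj_onI)
    fix u v assume u: "u \<in> ?A" and v: "v \<in> ?A" and eq: "?f u = ?f v"
    obtain par \<sigma> c where U: "u = ((par, \<sigma>), c)" "(par, \<sigma>) \<in> increasing_mobiles m"
      "c \<in> mobile_places m (par, \<sigma>)" using u by auto
    obtain par' \<sigma>' c' where V: "v = ((par', \<sigma>'), c')" "(par', \<sigma>') \<in> increasing_mobiles m"
      "c' \<in> mobile_places m (par', \<sigma>')" using v by auto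
    \<comment> \<open>The successor of N reveals the place: N itself below a leaf, and b in the gap
      before b.\<close>
    have at_N: "snd (mobile_grow ?N (par, \<sigma>) c) ?N = (case c of Inl l \<Rightarrow> ?N | Inr b \<Rightarrow> b)"
      if "(par, \<sigma>) \<in> increasing_mobiles m" for par \<sigma> c
      using old(2)[OF that] by (auto simp: mobile_grow_def split: sum.splits)
    have par_N: "(fst (mobile_grow ?N (par, \<sigma>) c))(?N := undefined) = par"
      if "(par, \<sigma>) \<in> increasing_mobiles m" for par \<sigma> c
      using old(3)[OF that] by (auto simp: mobile_grow_def split: sum.splits)
    have eq': "mobile_grow ?N (par, \<sigma>) c = mobile_grow ?N (par', \<sigma>') c'"
      using eq by (simp add: U(1) V(1))
    have par: "par = par'" using par_N[OF U(2), of c] par_N[OF V(2), of c'] eq' by simp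
    have "(case c of Inl l \<Rightarrow> ?N | Inr b \<Rightarrow> b) = (case c' of Inl l \<Rightarrow> ?N | Inr b \<Rightarrow> b)"
      using at_N[OF U(2), of c] at_N[OF V(2), of c'] eq' by simp
    then consider l l' where "c = Inl l" "c' = Inl l'" | b where "c = Inr b" "c' = Inr b"
      using U(3) V(3) by (auto simp: mobile_places_def)
    then show "u = v"
    proof cases
      case 1
      have "(par(?N := l)) ?N = (par'(?N := l')) ?N" using eq' 1 by (simp add: mobile_grow_def del: fun_upd_apply)
      then show ?thesis using eq' 1 par by (simp add: U(1) V(1) mobile_grow_def)
    next
      case 2
      then have "transpose ?N b \<circ> (transpose ?N b \<circ> \<sigma>) = transpose ?N b \<circ> (transpose ?N b \<circ> \<sigma>')"
        using eq' by (simp add: mobile_grow_def)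
      then have "\<sigma> = \<sigma>'" by (simp flip: comp_assoc)
      then show ?thesis using 2 par by (simp add: U(1) V(1))
    qed
  qed
  show "?f ` ?A = increasing_mobiles ?N"
  proof (intro subset_antisym subsetI)
    fix M' assume "M' \<in> ?f ` ?A"
    then obtain par \<sigma> c where M: "(par, \<sigma>) \<in> increasing_mobiles m" "c \<in> mobile_places m (par, \<sigma>)"
      "M' = mobile_grow ?N (par, \<sigma>) c" by auto
    note old = old[OF M(1)]
    show "M' \<in> increasing_mobiles ?N"
    proof (cases c)
      case (Inl l)
      then have l: "l \<in> {1..m}" "\<And>j. j \<in> {2..m} \<Longrightarrow> par j \<noteq> l"
        using M(2) by (auto simp: mobile_places_def mobile_leaves_def)
      let ?par = "par(?N := l)"
      have "\<sigma> permutes {2..?N}" using old(1) unfolding S by (rule permutes_imp_permutes_insert)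
      moreover have "orbit \<sigma> i = {j \<in> {2..?N}. ?par j = ?par i}" if "i \<in> {2..?N}" for i
      proof (cases "i = ?N")
        case True
        have "{j \<in> {2..?N}. ?par j = ?par i} = {?N}" using l(2) True m by (auto simp: S)
        then show ?thesis using True orbit_fixed_point[of \<sigma> ?N] old(2) by simp
      next
        case False
        then have "i \<in> {2..m}" using that by auto
        then show ?thesis using old(4)[of i] l(2)[of i] by (auto simp: S)
      qed
      ultimately show ?thesis
        using old(5,6) l(1)
        by (auto simp: M(3) Inl mobile_grow_def increasing_mobiles_def PiE_iff S extensional_def
            intro: le_SucI)
    next
      case (Inr b)
      then have b: "b \<in> {2..m}" using M(2) by (auto simp: mobile_places_def)
      let ?par = "par(?N := par b)" and ?\<sigma> = "transpose ?N b \<circ> \<sigma>"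
      note orb = orbit_transpose_comp[OF old(1) _ S(2) b]
      have "?\<sigma> permutes {2..?N}"
        unfolding S using b old(1)
        by (intro permutes_compose permutes_imp_permutes_insert permutes_swap_id) auto
      moreover have "orbit ?\<sigma> i = {j \<in> {2..?N}. ?par j = ?par i}" if "i \<in> {2..?N}" for i
      proof (cases "i = ?N")
        case True
        then show ?thesis using orb(2) old(4)[OF b] b by (auto simp: S)
      next
        case False
        then have i: "i \<in> {2..m}" using that by auto
        then show ?thesis using orb(1)[OF _ i] old(4)[OF i] b by (auto simp: S)
      qed
      ultimately show ?thesis
        using old(5,6) b
        by (auto simp: M(3) Inr mobile_grow_def increasing_mobiles_def PiE_iff S extensional_def
            less_Suc_eq_le intro: le_SucI)
    qed
  next
    fix M' assume "M' \<in> increasing_mobiles ?N"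
    then obtain par' \<sigma>' where M': "M' = (par', \<sigma>')" "\<sigma>' permutes {2..?N}" "par' \<in> extensional {2..?N}"
      "\<And>i. i \<in> {2..?N} \<Longrightarrow> par' i \<in> {1..?N} \<and> par' i < i"
      "\<And>i. i \<in> {2..?N} \<Longrightarrow> orbit \<sigma>' i = {j \<in> {2..?N}. par' j = par' i}"
      by (auto simp: increasing_mobiles_def PiE_iff)
    define b where "b = \<sigma>' ?N"
    \<comment> \<open>This composition sends N to itself and so cuts it out of its cycle.\<close>
    define \<sigma> where "\<sigma> = transpose ?N b \<circ> \<sigma>'"
    \<comment> \<open>The value \<open>undefined\<close> is what extensionality requires outside the
      domain of the smaller mobile.\<close>
    define par where "par = par'(?N := undefined)"
    have \<sigma>: "\<sigma> permutes {2..m}"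
      using permutes_insert_lemma[of \<sigma>' ?N "{2..m}"] M'(2) by (simp add: S \<sigma>_def b_def)
    have \<sigma>'_eq: "\<sigma>' = transpose ?N b \<circ> \<sigma>" by (simp add: \<sigma>_def flip: comp_assoc)
    have N: "?N \<in> {2..?N}" using m by simp
    have b: "b \<in> {2..?N}" using permutes_in_image[OF M'(2)] N by (simp add: b_def)
    have par'_eq: "par(?N := par' ?N) = par'" by (simp add: par_def)
    have orb: "orbit \<sigma> i = orbit \<sigma>' i - {?N}" if i: "i \<in> {2..m}" for i
    proof -
      have "?N \<notin> orbit \<sigma> i" using permutes_orbit_subset[OF \<sigma> i] by auto
      moreover have "orbit \<sigma>' i = orbit \<sigma> i \<or> orbit \<sigma>' i = insert ?N (orbit \<sigma> i)"
      proof (cases "b = ?N")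
        case False
        then have "b \<in> {2..m}" using b by auto
        then show ?thesis using orbit_transpose_comp(1)[OF \<sigma> _ S(2) _ i, of b] by (simp flip: \<sigma>'_eq)
      qed (simp add: \<sigma>'_eq)
      ultimately show ?thesis by auto
    qed
    have par_old: "par j = par' j" if "j \<in> {2..m}" for j
      using that by (simp add: par_def)
    have "(par, \<sigma>) \<in> increasing_mobiles m"
    proof -
      have "orbit \<sigma> i = {j \<in> {2..m}. par j = par i}" if "i \<in> {2..m}" for i
      proof -
        have "i \<in> {2..?N}" using that by auto
        then have "orbit \<sigma> i = {j \<in> {2..?N}. par' j = par' i} - {?N}"
          using orb[OF that] M'(5)[of i] by (simp only:)
        also have "\<dots> = {j \<in> {2..m}. par' j = par' i}" by (auto simp: S)
        also have "\<dots> = {j \<in> {2..m}. par j = par i}"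
          using par_old that by (intro Collect_cong conj_cong refl) simp
        finally show ?thesis .
      qed
      moreover have "par i \<in> {1..m} \<and> par i < i" if "i \<in> {2..m}" for i
        using M'(4)[of i] that par_old[OF that] by simp
      moreover have "par \<in> extensional {2..m}"
        using M'(3) by (auto simp: par_def extensional_def S)
      ultimately show ?thesis using \<sigma> by (simp add: increasing_mobiles_def PiE_iff)
    qed
    moreover have "\<exists>c \<in> mobile_places m (par, \<sigma>). mobile_grow ?N (par, \<sigma>) c = M'"
    proof (cases "b = ?N")
      case True
      then have "orbit \<sigma>' ?N = {?N}" by (intro orbit_fixed_point) (simp add: b_def)
      have "par' j \<noteq> par' ?N" if j: "j \<in> {2..m}" for j
      proof
        assume "par' j = par' ?N"
        then have "j \<in> orbit \<sigma>' ?N" unfolding M'(5)[OF N] using j by simp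
        then show False using \<open>orbit \<sigma>' ?N = {?N}\<close> j by simp
      qed
      moreover have "par' ?N \<in> {1..m}" using M'(4)[OF N] by auto
      ultimately have "par' ?N \<in> mobile_leaves m par" by (auto simp: mobile_leaves_def par_def)
      moreover have "\<sigma> = \<sigma>'" using True by (simp add: \<sigma>_def)
      ultimately show ?thesis
        using M'(1) par'_eq by (intro bexI[of _ "Inl (par' ?N)"]) (auto simp: mobile_grow_def mobile_places_def)
    next
      case False
      then have bm: "b \<in> {2..m}" using b by auto
      have "b \<in> orbit \<sigma>' ?N" unfolding b_def by (rule orbit.base)
      then have "par' b = par' ?N" unfolding M'(5)[OF N] by simp
      then have "par b = par' ?N" using False by (simp add: par_def)
      then show ?thesis
        using bm M'(1) par'_eq \<sigma>'_eq
        by (intro bexI[of _ "Inr b"]) (auto simp: mobile_grow_def mobile_places_def)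
    qed
    ultimately show "M' \<in> ?f ` ?A" by force
  qed
qed

lemma finite_mobile_leaves: "finite (mobile_leaves m par)"
  by (simp add: mobile_leaves_def)

lemma finite_increasing_mobiles: "finite (increasing_mobiles m)"
proof (rule finite_subset)
  show "increasing_mobiles m \<subseteq> ({2..m} \<rightarrow>\<^sub>E {1..m}) \<times> {\<sigma>. \<sigma> permutes {2..m}}"
    by (auto simp: increasing_mobiles_def)
qed (auto intro: finite_PiE simp: finite_permutations)

abbreviation leaf_count :: "nat \<Rightarrow> (nat \<Rightarrow> nat) \<times> (nat \<Rightarrow> nat) \<Rightarrow> nat" where
  "leaf_count m M \<equiv> card (mobile_leaves m (fst M))"

text \<open>N is always a new leaf. Below a leaf l it replaces l; beside an existing child b its
  parent was no leaf, so the number rises.\<close>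

lemma leaf_count_mobile_grow:
  assumes M: "M \<in> increasing_mobiles m" and c: "c \<in> mobile_places m M"
  shows "leaf_count (Suc m) (mobile_grow (Suc m) M c) =
    (case c of Inl l \<Rightarrow> leaf_count m M | Inr b \<Rightarrow> Suc (leaf_count m M))"
proof -
  obtain par \<sigma> where M_eq: "M = (par, \<sigma>)" by (cases M)
  have par: "par i < i" if "i \<in> {2..m}" for i
    using M that by (auto simp: M_eq increasing_mobiles_def)
  have new: "Suc m \<notin> mobile_leaves m par" by (simp add: mobile_leaves_def)
  have leaves: "mobile_leaves (Suc m) (par(Suc m := v)) = insert (Suc m) (mobile_leaves m par - {v})"
    if v: "1 \<le> v" "v \<le> m" for v
  proof -
    have "{2..Suc m} = insert (Suc m) {2..m}" using v by auto
    then have "mobile_leaves (Suc m) (par(Suc m := v)) =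
        {x \<in> insert (Suc m) {1..m}. v \<noteq> x \<and> (\<forall>j\<in>{2..m}. par j \<noteq> x)}"
      using v by (auto simp: mobile_leaves_def)
    moreover have "par j \<noteq> Suc m" if "j \<in> {2..m}" for j using par[OF that] that by simp
    ultimately show ?thesis using v by (auto simp: mobile_leaves_def)
  qed
  show ?thesis
  proof (cases c)
    case (Inl l)
    then have l: "l \<in> mobile_leaves m par" using c by (auto simp: M_eq mobile_places_def)
    then have "mobile_leaves (Suc m) (par(Suc m := l)) = insert (Suc m) (mobile_leaves m par - {l})"
      by (intro leaves) (auto simp: mobile_leaves_def)
    moreover have "card (mobile_leaves m par) > 0" using l finite_mobile_leaves by (auto simp: card_gt_0_iff)
    ultimately show ?thesis
      using l new by (simp add: M_eq Inl mobile_grow_def finite_mobile_leaves card_Diff_singleton)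
  next
    case (Inr b)
    then have b: "b \<in> {2..m}" using c by (auto simp: M_eq mobile_places_def)
    have "1 \<le> par b" "par b \<le> m" using M b by (auto simp: M_eq increasing_mobiles_def)
    moreover have "par b \<notin> mobile_leaves m par" using b by (auto simp: mobile_leaves_def)
    ultimately have "mobile_leaves (Suc m) (par(Suc m := par b)) = insert (Suc m) (mobile_leaves m par)"
      using leaves[of "par b"] by simp
    then show ?thesis using new by (simp add: M_eq Inr mobile_grow_def finite_mobile_leaves)
  qed
qed

lemma sum_increasing_mobiles_Suc:
  fixes f :: "nat \<Rightarrow> 'a::comm_semiring_1"
  shows "(\<Sum>M\<in>increasing_mobiles (Suc (Suc n)). f (leaf_count (Suc (Suc n)) M)) =
    (\<Sum>M\<in>increasing_mobiles (Suc n).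
       of_nat (leaf_count (Suc n) M) * f (leaf_count (Suc n) M) +
       of_nat n * f (Suc (leaf_count (Suc n) M)))"
proof -
  let ?m = "Suc n"
  have places: "finite (mobile_places ?m M)" for M
    by (simp add: mobile_places_def finite_mobile_leaves split: prod.splits)
  have "(\<Sum>M\<in>increasing_mobiles (Suc ?m). f (leaf_count (Suc ?m) M)) =
    (\<Sum>M\<in>increasing_mobiles ?m. \<Sum>c\<in>mobile_places ?m M. f (leaf_count (Suc ?m) (mobile_grow (Suc ?m) M c)))"
    using places
    by (subst sum.reindex_bij_betw[OF increasing_mobiles_Suc, symmetric])
      (simp_all add: sum.Sigma finite_increasing_mobiles split_def)
  also have "\<dots> = (\<Sum>M\<in>increasing_mobiles ?m.
      of_nat (leaf_count ?m M) * f (leaf_count ?m M) + of_nat n * f (Suc (leaf_count ?m M)))"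
  proof (intro sum.cong refl)
    fix M assume M: "M \<in> increasing_mobiles ?m"
    have places_eq: "mobile_places ?m M = Inl ` mobile_leaves ?m (fst M) \<union> Inr ` {2..?m}"
      by (simp add: mobile_places_def split_def)
    have "(\<Sum>c\<in>mobile_places ?m M. f (leaf_count (Suc ?m) (mobile_grow (Suc ?m) M c))) =
      (\<Sum>c\<in>mobile_places ?m M. case c of Inl l \<Rightarrow> f (leaf_count ?m M) | Inr b \<Rightarrow> f (Suc (leaf_count ?m M)))"
      by (intro sum.cong refl) (simp add: leaf_count_mobile_grow[OF M] split: sum.splits)
    also have "\<dots> = of_nat (leaf_count ?m M) * f (leaf_count ?m M) + of_nat n * f (Suc (leaf_count ?m M))"
      unfolding places_eq by (subst sum.union_disjoint) (auto simp: finite_mobile_leaves sum.reindex)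
    finally show "(\<Sum>c\<in>mobile_places ?m M. f (leaf_count (Suc ?m) (mobile_grow (Suc ?m) M c))) =
      of_nat (leaf_count ?m M) * f (leaf_count ?m M) + of_nat n * f (Suc (leaf_count ?m M))" .
  qed
  finally show ?thesis .
qed

text \<open>In x^n y^k the letters x are the nonroot nodes, whose places raise the number of leaves,
  and the letters y are the leaves, whose places preserve it. The start y is the mobile with a
  single node.\<close>

lemma mobile_grammar:
  assumes D: "formal_derivative (\<x>^2 * \<y>) (\<x> * \<y>) D" and n: "n \<ge> 1"
  shows "(D ^^ n) \<y> = \<x>^n * (\<Sum>k=1..n. of_nat (mobile_number n k) * \<y>^k)"
proof -
  have D': "formal_derivative (\<x> * (\<x> * \<y>)) (\<y> * \<x>) D"
    using D by (simp only: power2_eq_square mult.assoc mult.commute[of \<y> \<x>])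
  let ?m = "\<lambda>n k. \<x> ^ n * \<y> ^ k"
  let ?S = "\<lambda>n. increasing_mobiles (Suc n)"
  have "D (?m n k) = of_nat k * ?m (Suc n) k + of_nat n * ?m (Suc n) (Suc k)" for n k :: nat
  proof -
    have "D (?m n k) = \<x> ^ n * \<y> ^ k * (of_nat n * (\<x> * \<y>) + of_nat k * \<x>)"
      by (rule formal_derivative_monomial[OF D'])
    also have "\<dots> = of_nat k * ?m (Suc n) k + of_nat n * ?m (Suc n) (Suc k)"
      by (simp add: algebra_simps)
    finally show ?thesis .
  qed
  then have "(D ^^ n) (\<Sum>M\<in>?S 0. ?m 0 (leaf_count (Suc 0) M)) = (\<Sum>M\<in>?S n. ?m n (leaf_count (Suc n) M))"
    by (intro funpow_formal_derivative_weights[where S = ?S and m = ?m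
          and st = "\<lambda>n. leaf_count (Suc n)" and \<alpha> = "\<lambda>n k. k" and \<beta> = "\<lambda>n k. n",
          OF D sum_increasing_mobiles_Suc])
  also have "?S 0 = {(\<lambda>_. undefined, id)}"
    by (auto simp: increasing_mobiles_def)
  also have "(\<Sum>M\<in>\<dots>. ?m 0 (leaf_count (Suc 0) M)) = \<y>"
    by (simp add: mobile_leaves_def)
  also have "(\<Sum>M\<in>?S n. ?m n (leaf_count (Suc n) M)) =
      (\<Sum>k=1..n. of_nat (card {M \<in> ?S n. leaf_count (Suc n) M = k}) * ?m n k)"
  proof (intro sum_by_statistic finite_increasing_mobiles)
    fix M assume M: "M \<in> ?S n"
    have par: "fst M i \<ge> 1" "fst M i < i" if "i \<in> {2..Suc n}" for i
      using M that by (auto simp: increasing_mobiles_def)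
    \<comment> \<open>For n >= 1 node 2 is a child of the root, so the root is no leaf and there are
      at most n leaves.\<close>
    have "fst M 2 = 1" using par[of 2] n by simp
    then have "1 \<notin> mobile_leaves (Suc n) (fst M)"
      using n by (auto simp: mobile_leaves_def intro!: bexI[of _ 2])
    moreover have "mobile_leaves (Suc n) (fst M) \<subseteq> {1..Suc n}" by (auto simp: mobile_leaves_def)
    moreover have "{1..Suc n} - {1} = {2..Suc n}" by auto
    ultimately have "mobile_leaves (Suc n) (fst M) \<subseteq> {2..Suc n}" by blast
    then have "leaf_count (Suc n) M \<le> card {2..Suc n}" by (intro card_mono) auto
    \<comment> \<open>The largest node has no children, which excludes k = 0.\<close>
    moreover have "Suc n \<in> mobile_leaves (Suc n) (fst M)"
      using par by (fastforce simp: mobile_leaves_def)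
    then have "leaf_count (Suc n) M > 0" using finite_mobile_leaves by (auto simp: card_gt_0_iff)
    ultimately show "leaf_count (Suc n) M \<in> {1..n}" by simp
  qed simp
  also have "\<dots> = (\<Sum>k=1..n. of_nat (mobile_number n k) * ?m n k)"
    by (simp add: mobile_number_def split_def)
  finally show ?thesis
    by (simp add: sum_distrib_left mult_ac)
qed

section \<open>The twelve grammars\<close>

theorem theorem6:
  fixes n :: nat
  assumes "n \<ge> 1"
  shows
    "(\<forall>D. formal_derivative (\<x> * \<y>^2) (\<x>^2 * \<y>) D \<longrightarrow>
        (D ^^ n) (\<x> * \<y>) =
          \<x> * \<y> * (\<Sum>k=0..n. of_nat (eulerian_B n k) * \<x>^(2*n - 2*k) * \<y>^(2*k))) \<and>
     (\<forall>D. formal_derivative (\<x> * \<y>^2) (\<x>^2 * \<y>) D \<longrightarrow>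
        (D ^^ n) (\<x>^2 * \<y>^2) =
          2^n * \<x>^2 * \<y>^2 *
            (\<Sum>k=0..n. of_nat (eulerian (n + 1) k) * \<x>^(2*n - 2*k) * \<y>^(2*k))) \<and>
     (\<forall>D. formal_derivative (\<x> * \<y>^2) (\<x>^2 * \<y>) D \<longrightarrow>
        (D ^^ n) \<x> =
          \<x> * (\<Sum>k=1..n. of_nat (matchings_odd_min n k) * \<x>^(2*n - 2*k) * \<y>^(2*k))) \<and>
     (\<forall>(r::nat) D. formal_derivative (\<x> * \<y>) (\<x> * \<y>) D \<longrightarrow>
        (D ^^ n) (\<x> * \<y>^r) =
          \<x> * (\<Sum>k=0..n. of_nat (restricted_eulerian r (n + r) k) * \<x>^k * \<y>^(n + r - k))) \<and>
     (\<forall>D. formal_derivative (\<x> * \<y>^2) (\<x> * \<y>) D \<longrightarrow>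
        (D ^^ n) \<x> =
          \<x> * (\<Sum>k=0..n - 1. 2^k * of_nat (eulerian n k) * \<x>^k * \<y>^(2*n - 2*k))) \<and>
     (\<forall>T D. sqrt_eulerian_numbers T \<longrightarrow> formal_derivative (\<x> * \<y>^2) (\<x> * \<y>) D \<longrightarrow>
        (D ^^ n) \<y> =
          (\<Sum>k=1..n. scalar (T n k) * \<x>^k * \<y>^(2*n - 2*k + 1))) \<and>
     (\<forall>D. formal_derivative (\<x>^2 * \<y>) \<y> D \<longrightarrow>
        (D ^^ n) \<x> =
          \<x> * (\<Sum>k=1..n. fact k * of_nat (stirling_set n k) * \<x>^k * \<y>^k)) \<and>
     (\<forall>D. formal_derivative (\<x>^2 * \<y>) (\<y>^2) D \<longrightarrow>
        (D ^^ n) \<x> =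
          \<x> * (\<Sum>k=1..n. fact k * of_nat (stirling_cycle n k) * \<x>^k * \<y>^n)) \<and>
     (\<forall>D. formal_derivative (\<x> * \<y>^2) (\<y>^2) D \<longrightarrow>
        (D ^^ n) \<x> =
          \<x> * (\<Sum>k=1..n. of_nat (lah n k) * \<y>^(n + k))) \<and>
     (\<forall>D. formal_derivative (\<x> * \<y>^3) (\<y>^3) D \<longrightarrow>
        (D ^^ n) \<x> =
          \<x> * (\<Sum>k=1..n. of_nat (card (organic_forests n k)) * \<y>^(2*n + k))) \<and>
     (\<forall>(r::nat) D. r \<ge> 4 \<longrightarrow> formal_derivative (\<x> * \<y>^r) (\<y>^r) D \<longrightarrow>
        (D ^^ n) \<x> =
          \<x> * (\<Sum>k=1..n. of_nat (card (rary_forests r n k)) * \<y>^((r - 1)*n + k))) \<and>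
     (\<forall>D. formal_derivative (\<x>^2 * \<y>) (\<x> * \<y>) D \<longrightarrow>
        (D ^^ n) \<y> =
          \<x>^n * (\<Sum>k=1..n. of_nat (mobile_number n k) * \<y>^k))"
  by (intro conjI allI impI)
    (rule eulerian_B_grammar eulerian_grammar matchings_grammar restricted_eulerian_grammar
      eulerian_grammar_half sqrt_eulerian_grammar stirling_set_grammar stirling_cycle_grammar
      lah_grammar organic_forests_grammar rary_forests_grammar mobile_grammar;
     (assumption | rule assms | simp))+

end
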